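(* Let $F$ be a field of characteristic zero and $W$ a unital $\mathbb{Z}_2$-graded $F$-algebra admitting both actions below. Let $UT_2^F$ and $UT_2^D$ denote the algebra of $2\times2$ upper triangular matrices over $F$ with the canonical $\mathbb{Z}_2$-grading, regarded as a $\mathbb{Z}_2$-graded $W$-algebra where $W$ acts by left and right multiplication as the algebra $F=F1_{UT_2}$, respectively as the algebra $D=Fe_{11}\oplus Fe_{22}$. Then $UT_2^F$ and $UT_2^D$ generate two distinct varieties of $\mathbb{Z}_2$-graded $W$-algebras of almost polynomial growth.
   Context: The canonical grading is $UT_2^0=Fe_{11}\oplus Fe_{22}$, $UT_2^1=Fe_{12}$. A $\mathbb{Z}_2$-graded $W$-algebra is a $\mathbb{Z}_2$-graded associative $F$-algebra $A$ that is a unital $W$-bimodule with $(a_1a_2)w=a_1(a_2w)$, $w(a_1a_2)=(wa_1)a_2$, $(a_1w)a_2=a_1(wa_2)$ and $W^gA^h\subseteq A^{g+h}$, $A^hW^g\subseteq A^{g+h}$. "$W$ acts as a unital graded subalgebra $B\subseteq UT_2$ by left and right multiplication" means there is a surjective unital graded homomorphism $\varphi:W\to B$ with $wa=\varphi(w)a$, $aw=a\varphi(w)$. Let $\{w_i\}$ be a vector space basis of $W$, $y_1,y_2,\dots$ variables of degree $0$ and $z_1,z_2,\dots$ variables of degree $1$. The free $\mathbb{Z}_2$-graded $W$-algebra $W\langle Y,Z\rangle$ has vector space basis the monomials $w_{i_0}u_1w_{i_1}\cdots w_{i_{n-1}}u_nw_{i_n}$, $n\ge1$, each $u_j$ a variable;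 product is juxtaposition followed by multiplication in $W$, $W$ acts by multiplication at the two ends, and a variable $x$ is identified with $1_Wx1_W$. $\mathrm{Id}^{\mathbb{Z}_2,W}(A)$ is the set of elements vanishing under all substitutions of $y$'s by elements of $A^0$ and $z$'s by elements of $A^1$. $P_n^{\mathbb{Z}_2,W}$ is the span of all monomials $w_{i_0}u_{\sigma(1)}w_{i_1}\cdots u_{\sigma(n)}w_{i_n}$, $\sigma\in S_n$, $u_i\in\{y_i,z_i\}$, and $c_n^{\mathbb{Z}_2,W}(A)=\dim_F P_n^{\mathbb{Z}_2,W}/(P_n^{\mathbb{Z}_2,W}\cap\mathrm{Id}^{\mathbb{Z}_2,W}(A))$. The variety $\mathrm{var}^{\mathbb{Z}_2,W}(A)$ is the class of all $\mathbb{Z}_2$-graded $W$-algebras $B$ with $\mathrm{Id}^{\mathbb{Z}_2,W}(A)\subseteq\mathrm{Id}^{\mathbb{Z}_2,W}(B)$, and $c_n^{\mathbb{Z}_2,W}(\mathrm{var}^{\mathbb{Z}_2,W}(A))=c_n^{\mathbb{Z}_2,W}(A)$. A variety $\mathcal V$ has almost polynomial growth if $c_n^{\mathbb{Z}_2,W}(\mathcal V)$ grows exponentially but $c_n^{\mathbb{Z}_2,W}(\mathcal U)$ is polynomially bounded for every proper subvariety $\mathcal U\subsetneq\mathcal V$. *)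

theory Defs
  imports
    "HOL-Analysis.Cartesian_Space"
    "HOL-Algebra.Module"
    "HOL-Combinatorics.Permutations"
    "HOL-Library.Poly_Mapping"
    "HOL-Library.Extended_Nat"
    "HOL-Library.Z2"
begin

section \<open>Graded $W$-algebras\<close>

text \<open>
  The acting algebra \<open>W\<close> is a type, graded by \<open>\<int>\<^sub>2\<close> (the type \<^typ>\<open>bit\<close>, with addition mod 2).
  The algebras on which it acts live on carrier sets, so that one can form classes of them.
\<close>

locale graded_unital_algebra = vector_space scale
  for scale :: "'f::field \<Rightarrow> 'w::ring_1 \<Rightarrow> 'w" +
  fixes grade :: "bit \<Rightarrow> 'w set"
  assumes mult_scale_left: "scale c v * w = scale c (v * w)"
    and mult_scale_right: "v * scale c w = scale c (v * w)"
    and grade_subspace: "subspace (grade g)"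
    and grade_direct: "\<exists>!p. fst p \<in> grade 0 \<and> snd p \<in> grade 1 \<and> w = fst p + snd p"
    and grade_mult: "v \<in> grade g \<Longrightarrow> w \<in> grade h \<Longrightarrow> v * w \<in> grade (g + h)"

definition scalars :: "'f::field ring"
  where "scalars = \<lparr>carrier = UNIV, monoid.mult = (*), one = 1, zero = 0, add = (+)\<rparr>"

text \<open>
  The algebras are not required to be unital: the field \<^const>\<open>one\<close> inherited from the library
  record is not constrained by any axiom below and does not enter any definition.
\<close>

record ('f, 'w, 'a) walg = "('f, 'a) module" +
  homog :: "bit \<Rightarrow> 'a set"
  lact :: "'w \<Rightarrow> 'a \<Rightarrow> 'a"
  ract :: "'a \<Rightarrow> 'w \<Rightarrow> 'a"

locale graded_W_algebra =
  W: graded_unital_algebra scaleW gradeW + module scalars A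
  for scaleW :: "'f::field \<Rightarrow> 'w::ring_1 \<Rightarrow> 'w"
    and gradeW :: "bit \<Rightarrow> 'w set"
    and A :: "('f, 'w, 'a) walg" (structure) +
  assumes mult_closed: "\<lbrakk>x \<in> carrier A; y \<in> carrier A\<rbrakk> \<Longrightarrow> x \<otimes> y \<in> carrier A"
    and mult_assoc: "\<lbrakk>x \<in> carrier A; y \<in> carrier A; z \<in> carrier A\<rbrakk>
          \<Longrightarrow> (x \<otimes> y) \<otimes> z = x \<otimes> (y \<otimes> z)"
    and mult_add_left: "\<lbrakk>x \<in> carrier A; y \<in> carrier A; z \<in> carrier A\<rbrakk>
          \<Longrightarrow> (x \<oplus> y) \<otimes> z = x \<otimes> z \<oplus> y \<otimes> z"
    and mult_add_right: "\<lbrakk>x \<in> carrier A; y \<in> carrier A; z \<in> carrier A\<rbrakk>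
          \<Longrightarrow> z \<otimes> (x \<oplus> y) = z \<otimes> x \<oplus> z \<otimes> y"
    and mult_smult_left: "\<lbrakk>x \<in> carrier A; y \<in> carrier A\<rbrakk> \<Longrightarrow> (c \<odot> x) \<otimes> y = c \<odot> (x \<otimes> y)"
    and mult_smult_right: "\<lbrakk>x \<in> carrier A; y \<in> carrier A\<rbrakk> \<Longrightarrow> x \<otimes> (c \<odot> y) = c \<odot> (x \<otimes> y)"
    and homog_submodule: "submodule (homog A g) scalars A"
    and homog_direct: "x \<in> carrier A
          \<Longrightarrow> \<exists>!p. fst p \<in> homog A 0 \<and> snd p \<in> homog A 1 \<and> x = fst p \<oplus> snd p"
    and homog_mult: "\<lbrakk>x \<in> homog A g; y \<in> homog A h\<rbrakk> \<Longrightarrow> x \<otimes> y \<in> homog A (g + h)"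
    and lact_closed: "x \<in> carrier A \<Longrightarrow> lact A w x \<in> carrier A"
    and lact_add: "\<lbrakk>x \<in> carrier A; y \<in> carrier A\<rbrakk> \<Longrightarrow> lact A w (x \<oplus> y) = lact A w x \<oplus> lact A w y"
    and lact_smult: "x \<in> carrier A \<Longrightarrow> lact A w (c \<odot> x) = c \<odot> lact A w x"
    and lact_plus: "x \<in> carrier A \<Longrightarrow> lact A (v + w) x = lact A v x \<oplus> lact A w x"
    and lact_scale: "x \<in> carrier A \<Longrightarrow> lact A (scaleW c w) x = c \<odot> lact A w x"
    and lact_times: "x \<in> carrier A \<Longrightarrow> lact A (v * w) x = lact A v (lact A w x)"
    and lact_one: "x \<in> carrier A \<Longrightarrow> lact A 1 x = x"
    and ract_closed: "x \<in> carrier A \<Longrightarrow> ract A x w \<in> carrier A"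
    and ract_add: "\<lbrakk>x \<in> carrier A; y \<in> carrier A\<rbrakk> \<Longrightarrow> ract A (x \<oplus> y) w = ract A x w \<oplus> ract A y w"
    and ract_smult: "x \<in> carrier A \<Longrightarrow> ract A (c \<odot> x) w = c \<odot> ract A x w"
    and ract_plus: "x \<in> carrier A \<Longrightarrow> ract A x (v + w) = ract A x v \<oplus> ract A x w"
    and ract_scale: "x \<in> carrier A \<Longrightarrow> ract A x (scaleW c w) = c \<odot> ract A x w"
    and ract_times: "x \<in> carrier A \<Longrightarrow> ract A x (v * w) = ract A (ract A x v) w"
    and ract_one: "x \<in> carrier A \<Longrightarrow> ract A x 1 = x"
    and lact_ract: "x \<in> carrier A \<Longrightarrow> ract A (lact A v x) w = lact A v (ract A x w)"
    and mult_ract: "\<lbrakk>x \<in> carrier A; y \<in> carrier A\<rbrakk> \<Longrightarrow> ract A (x \<otimes> y) w = x \<otimes> ract A y w"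
    and lact_mult: "\<lbrakk>x \<in> carrier A; y \<in> carrier A\<rbrakk> \<Longrightarrow> lact A w (x \<otimes> y) = lact A w x \<otimes> y"
    and ract_mult_lact: "\<lbrakk>x \<in> carrier A; y \<in> carrier A\<rbrakk> \<Longrightarrow> ract A x w \<otimes> y = x \<otimes> lact A w y"
    and lact_homog: "\<lbrakk>w \<in> gradeW g; x \<in> homog A h\<rbrakk> \<Longrightarrow> lact A w x \<in> homog A (g + h)"
    and ract_homog: "\<lbrakk>w \<in> gradeW g; x \<in> homog A h\<rbrakk> \<Longrightarrow> ract A x w \<in> homog A (h + g)"


section \<open>The free graded $W$-algebra, identities and codimensions\<close>

text \<open>\<open>Y i\<close> and \<open>Z i\<close> are the variables $y_{i+1}$ and $z_{i+1}$.\<close>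

datatype gvar = Y nat | Z nat

fun vdeg :: "gvar \<Rightarrow> bit" where
  "vdeg (Y i) = 0"
| "vdeg (Z i) = 1"

text \<open>
  \<open>(w\<^sub>0, [(u\<^sub>1, w\<^sub>1), \<dots>, (u\<^sub>n, w\<^sub>n)])\<close> stands for the monomial \<open>w\<^sub>0 u\<^sub>1 w\<^sub>1 \<dots> u\<^sub>n w\<^sub>n\<close>.
  Elements of the free algebra are formal linear combinations of monomials whose \<open>w\<^sub>i\<close> belong to
  the chosen basis \<open>\<B>\<close> of \<open>W\<close>. Its product is not needed: identities and codimensions only
  involve the vector space structure and the values of the monomials under substitutions.
\<close>

type_synonym 'w wmonom = "'w \<times> (gvar \<times> 'w) list"
type_synonym ('f, 'w) wpoly = "'w wmonom \<Rightarrow>\<^sub>0 'f"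

definition pscale :: "'f::field \<Rightarrow> ('f, 'w) wpoly \<Rightarrow> ('f, 'w) wpoly"
  where "pscale c p = Poly_Mapping.map (\<lambda>a. c * a) p"

lemma lookup_pscale [simp]: "Poly_Mapping.lookup (pscale c p) m = c * Poly_Mapping.lookup p m"
  by (auto simp: pscale_def Poly_Mapping.map.rep_eq when_def)

lemma vector_space_pscale: "vector_space pscale"
  by unfold_locales (auto intro!: poly_mapping_eqI simp: lookup_add algebra_simps)

abbreviation pspan :: "('f::field, 'w) wpoly set \<Rightarrow> ('f, 'w) wpoly set"
  where "pspan \<equiv> Modules.module.span pscale"

definition free_W_algebra :: "'w set \<Rightarrow> ('f::field, 'w) wpoly set"
  where "free_W_algebra \<B> =
    pspan {Poly_Mapping.single (w, us) 1 | w us. w \<in> \<B> \<and> us \<noteq> [] \<and> snd ` set us \<subseteq> \<B>}"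

text \<open>Only \<open>n \<ge> 1\<close> is meaningful: the free algebra has no monomials of degree 0.\<close>

definition multilinear :: "'w set \<Rightarrow> nat \<Rightarrow> ('f::field, 'w) wpoly set"
  where "multilinear \<B> n =
    pspan {Poly_Mapping.single (w 0, map (\<lambda>j. (u (\<sigma> j), w (Suc j))) [0..<n]) 1 | w u \<sigma>.
      \<sigma> permutes {..<n} \<and> (\<forall>j\<le>n. w j \<in> \<B>) \<and> (\<forall>i<n. u i \<in> {Y i, Z i})}"

text \<open>The empty word has no value; the first equation is a dummy.\<close>

fun eval_word :: "('f, 'w, 'a) walg \<Rightarrow> (gvar \<Rightarrow> 'a) \<Rightarrow> (gvar \<times> 'w) list \<Rightarrow> 'a" where
  "eval_word A s [] = \<zero>\<^bsub>A\<^esub>"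
| "eval_word A s [(u, w)] = ract A (s u) w"
| "eval_word A s ((u, w) # us) = ract A (s u) w \<otimes>\<^bsub>A\<^esub> eval_word A s us"

definition eval_poly :: "('f::field, 'w, 'a) walg \<Rightarrow> (gvar \<Rightarrow> 'a) \<Rightarrow> ('f, 'w) wpoly \<Rightarrow> 'a"
  where "eval_poly A s p =
    finsum A (\<lambda>m. Poly_Mapping.lookup p m \<odot>\<^bsub>A\<^esub> lact A (fst m) (eval_word A s (snd m))) (Poly_Mapping.keys p)"

definition W_Id :: "'w set \<Rightarrow> ('f::field, 'w, 'a) walg \<Rightarrow> ('f, 'w) wpoly set"
  where "W_Id \<B> A =
    {p \<in> free_W_algebra \<B>. \<forall>s. (\<forall>x. s x \<in> homog A (vdeg x)) \<longrightarrow> eval_poly A s p = \<zero>\<^bsub>A\<^esub>}"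

text \<open>
  \<open>B\<close> lifts a basis of the quotient \<open>P / N\<close>: its cosets are linearly independent (so
  pairwise distinct) and span.
\<close>

definition quotient_basis ::
    "('f::field \<Rightarrow> 'v::ab_group_add \<Rightarrow> 'v) \<Rightarrow> 'v set \<Rightarrow> 'v set \<Rightarrow> 'v set \<Rightarrow> bool"
  where "quotient_basis sc P N B \<longleftrightarrow> B \<subseteq> P
    \<and> (\<forall>T c. finite T \<and> T \<subseteq> B \<and> (\<Sum>v\<in>T. sc (c v) v) \<in> N \<longrightarrow> (\<forall>v\<in>T. c v = 0))
    \<and> (\<forall>p\<in>P. \<exists>q\<in>Modules.module.span sc B. p - q \<in> N)"

definition quotient_dim ::
    "('f::field \<Rightarrow> 'v::ab_group_add \<Rightarrow> 'v) \<Rightarrow> 'v set \<Rightarrow> 'v set \<Rightarrow> enat"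
  where "quotient_dim sc P N =
    (let B = (SOME B. quotient_basis sc P N B) in if finite B then enat (card B) else \<infinity>)"

definition codim :: "'w set \<Rightarrow> ('f::field, 'w, 'a) walg \<Rightarrow> nat \<Rightarrow> enat"
  where "codim \<B> A n = quotient_dim pscale (multilinear \<B> n) (multilinear \<B> n \<inter> W_Id \<B> A)"


section \<open>Varieties\<close>

text \<open>
  A variety is represented by its members whose carrier is contained in a type \<open>'u\<close>. As soon as
  \<open>'u\<close> is at least as large as the free algebra, every variety is generated by one of these
  members (a copy of its relatively free algebra of countable rank) and so is determined by them.
\<close>

definition variety ::
    "('f::field \<Rightarrow> 'w::ring_1 \<Rightarrow> 'w) \<Rightarrow> (bit \<Rightarrow> 'w set) \<Rightarrow> 'w set \<Rightarrow> ('f, 'w, 'a) walg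
      \<Rightarrow> ('f, 'w, 'u) walg set"
  where "variety scaleW gradeW \<B> A = {B. graded_W_algebra scaleW gradeW B \<and> W_Id \<B> A \<subseteq> W_Id \<B> B}"

definition is_variety ::
    "('f::field \<Rightarrow> 'w::ring_1 \<Rightarrow> 'w) \<Rightarrow> (bit \<Rightarrow> 'w set) \<Rightarrow> 'w set \<Rightarrow> ('f, 'w, 'u) walg set \<Rightarrow> bool"
  where "is_variety scaleW gradeW \<B> V \<longleftrightarrow>
    (\<exists>A :: ('f, 'w, 'u) walg. graded_W_algebra scaleW gradeW A \<and> V = variety scaleW gradeW \<B> A)"

definition variety_codim :: "'w set \<Rightarrow> ('f::field, 'w, 'u) walg set \<Rightarrow> nat \<Rightarrow> enat"
  where "variety_codim \<B> V n =
    quotient_dim pscale (multilinear \<B> n) (multilinear \<B> n \<inter> (\<Inter>B\<in>V. W_Id \<B> B))"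

lemma variety_codim_generated:
  fixes A :: "('f::field, 'w::ring_1, 'u) walg"
  assumes "graded_W_algebra scaleW gradeW A"
  shows "variety_codim \<B> (variety scaleW gradeW \<B> A :: ('f, 'w, 'u) walg set) = codim \<B> A"
proof -
  have "(\<Inter>B\<in>(variety scaleW gradeW \<B> A :: ('f, 'w, 'u) walg set). W_Id \<B> B) = W_Id \<B> A"
    using assms by (auto simp: variety_def)
  then show ?thesis
    by (simp add: fun_eq_iff variety_codim_def codim_def)
qed

definition polynomially_bounded :: "(nat \<Rightarrow> enat) \<Rightarrow> bool"
  where "polynomially_bounded c \<longleftrightarrow> (\<exists>C k. \<forall>n\<ge>1. c n \<le> enat (C * n ^ k))"

definition exponential_growth :: "(nat \<Rightarrow> enat) \<Rightarrow> bool"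
  where "exponential_growth c \<longleftrightarrow> (\<exists>a b::real. 1 < a \<and>
    (\<forall>\<^sub>F n in sequentially. \<exists>d. c n = enat d \<and> a ^ n \<le> real d \<and> real d \<le> b ^ n))"

definition almost_polynomial_growth ::
    "('f::field \<Rightarrow> 'w::ring_1 \<Rightarrow> 'w) \<Rightarrow> (bit \<Rightarrow> 'w set) \<Rightarrow> 'w set \<Rightarrow> ('f, 'w, 'u) walg set \<Rightarrow> bool"
  where "almost_polynomial_growth scaleW gradeW \<B> V \<longleftrightarrow>
    is_variety scaleW gradeW \<B> V \<and> exponential_growth (variety_codim \<B> V)
    \<and> (\<forall>U. is_variety scaleW gradeW \<B> U \<and> U \<subset> V \<longrightarrow> polynomially_bounded (variety_codim \<B> U))"


section \<open>Upper triangular matrices\<close>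

definition mscale :: "'f::field \<Rightarrow> 'f^2^2 \<Rightarrow> 'f^2^2"
  where "mscale c M = (\<chi> i j. c * M $ i $ j)"

definition munit :: "2 \<Rightarrow> 2 \<Rightarrow> 'f::field^2^2"
  where "munit k l = (\<chi> i j. if i = k \<and> j = l then 1 else 0)"

definition scalar_matrices :: "('f::field^2^2) set"
  where "scalar_matrices = {mscale a (mat 1) | a. True}"

definition diagonal_matrices :: "('f::field^2^2) set"
  where "diagonal_matrices = {mscale a (munit 1 1) + mscale b (munit 2 2) | a b. True}"

definition UT2_homog :: "bit \<Rightarrow> ('f::field^2^2) set"
  where "UT2_homog g = (if g = 0 then diagonal_matrices else {mscale c (munit 1 2) | c. True})"

definition UT2 :: "('w \<Rightarrow> 'f::field^2^2) \<Rightarrow> ('f, 'w, 'f^2^2) walg"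
  where "UT2 \<phi> =
    \<lparr>carrier = {M. M $ 2 $ 1 = 0}, monoid.mult = (**), one = mat 1, zero = 0, add = (+),
     smult = mscale, homog = UT2_homog,
     lact = (\<lambda>w M. \<phi> w ** M), ract = (\<lambda>M w. M ** \<phi> w)\<rparr>"

definition graded_unital_hom_onto ::
    "('f::field \<Rightarrow> 'w::ring_1 \<Rightarrow> 'w) \<Rightarrow> (bit \<Rightarrow> 'w set) \<Rightarrow> ('f^2^2) set \<Rightarrow> ('w \<Rightarrow> 'f^2^2) \<Rightarrow> bool"
  where "graded_unital_hom_onto scaleW gradeW B \<phi> \<longleftrightarrow>
    (\<forall>v w. \<phi> (v + w) = \<phi> v + \<phi> w) \<and> (\<forall>c w. \<phi> (scaleW c w) = mscale c (\<phi> w))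
    \<and> (\<forall>v w. \<phi> (v * w) = \<phi> v ** \<phi> w) \<and> \<phi> 1 = mat 1
    \<and> range \<phi> = B \<and> (\<forall>g. \<phi> ` gradeW g \<subseteq> B \<inter> UT2_homog g)"

lemma mscale_nth [simp]: "mscale c M $ i $ j = c * M $ i $ j"
  by (simp add: mscale_def)

lemma munit_nth [simp]: "munit k l $ i $ j = (if i = k \<and> j = l then 1 else 0)"
  by (simp add: munit_def)

lemma matrix_2_eq_iff:
  "A = B \<longleftrightarrow> A $ 1 $ 1 = B $ 1 $ 1 \<and> A $ 1 $ 2 = B $ 1 $ 2 \<and> A $ 2 $ 1 = B $ 2 $ 1 \<and> A $ 2 $ 2 = B $ 2 $ 2"
  for A B :: "'f::field^2^2"
  by (auto simp: vec_eq_iff forall_2)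

lemma mat_mult_2_nth: "(A ** B) $ i $ j = A $ i $ 1 * B $ 1 $ j + A $ i $ 2 * B $ 2 $ j"
  for A B :: "'f::field^2^2"
  by (simp add: matrix_matrix_mult_def sum_2)

lemma mat_1_nth: "(mat 1 :: 'f::field^2^2) $ i $ j = (if i = j then 1 else 0)"
  by (simp add: mat_def)

lemma diagonal_matrices_iff: "M \<in> diagonal_matrices \<longleftrightarrow> M $ 1 $ 2 = 0 \<and> M $ 2 $ 1 = 0"
  by (auto simp: diagonal_matrices_def matrix_2_eq_iff)

lemma UT2_homog_iff: "M \<in> UT2_homog g \<longleftrightarrow>
    (if g = 0 then M $ 1 $ 2 = 0 \<and> M $ 2 $ 1 = 0 else M $ 1 $ 1 = 0 \<and> M $ 2 $ 1 = 0 \<and> M $ 2 $ 2 = 0)"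
  by (auto simp: UT2_homog_def diagonal_matrices_iff matrix_2_eq_iff)

lemma scalars_sel [simp]:
  "carrier scalars = UNIV" "monoid.mult scalars = (*)" "\<one>\<^bsub>scalars\<^esub> = 1"
  "\<zero>\<^bsub>scalars\<^esub> = 0" "add scalars = (+)"
  by (simp_all add: scalars_def)

lemma cring_scalars: "cring (scalars :: 'f::field ring)"
  by (rule cringI; (rule abelian_groupI comm_monoidI)?)
     (auto simp: algebra_simps intro: exI[of _ "- _"] add.left_inverse)

lemma UT2_sel [simp]:
  "carrier (UT2 \<phi>) = {M. M $ 2 $ 1 = 0}" "monoid.mult (UT2 \<phi>) = (**)" "\<one>\<^bsub>UT2 \<phi>\<^esub> = mat 1"
  "\<zero>\<^bsub>UT2 \<phi>\<^esub> = 0" "add (UT2 \<phi>) = (+)" "smult (UT2 \<phi>) = mscale" "homog (UT2 \<phi>) = UT2_homog"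
  "lact (UT2 \<phi>) = (\<lambda>w M. \<phi> w ** M)" "ract (UT2 \<phi>) = (\<lambda>M w. M ** \<phi> w)"
  by (simp_all add: UT2_def)

lemma abelian_group_UT2: "abelian_group (UT2 \<phi>)"
proof (rule abelian_groupI)
  fix M assume "M \<in> carrier (UT2 \<phi>)"
  then show "\<exists>N\<in>carrier (UT2 \<phi>). N \<oplus>\<^bsub>UT2 \<phi>\<^esub> M = \<zero>\<^bsub>UT2 \<phi>\<^esub>"
    by (intro bexI[of _ "- M"]) auto
qed (auto simp: algebra_simps)

lemma module_UT2: "Module.module scalars (UT2 \<phi>)"
  by (rule moduleI[OF cring_scalars abelian_group_UT2])
     (auto simp: matrix_2_eq_iff algebra_simps)

lemma graded_W_algebra_UT2:
  fixes \<phi> :: "'w::ring_1 \<Rightarrow> 'f::field^2^2"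
  assumes "graded_unital_algebra scaleW gradeW"
    and \<phi>: "graded_unital_hom_onto scaleW gradeW B \<phi>" and B: "B \<subseteq> diagonal_matrices"
  shows "graded_W_algebra scaleW gradeW (UT2 \<phi>)"
proof -
  interpret W: graded_unital_algebra scaleW gradeW by fact
  interpret M: Module.module scalars "UT2 \<phi>" by (rule module_UT2)
  have hom: "\<phi> (v + w) = \<phi> v + \<phi> w" "\<phi> (scaleW c w) = mscale c (\<phi> w)"
      "\<phi> (v * w) = \<phi> v ** \<phi> w" "\<phi> 1 = mat 1" for v w c
    using \<phi> by (auto simp: graded_unital_hom_onto_def)
  have diag: "\<phi> w $ 1 $ 2 = 0" "\<phi> w $ 2 $ 1 = 0" for w
    using \<phi> B by (auto simp: graded_unital_hom_onto_def diagonal_matrices_iff subset_iff)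
  have homog: "\<phi> w \<in> UT2_homog g" if "w \<in> gradeW g" for w g
    using \<phi> that by (simp add: graded_unital_hom_onto_def image_subset_iff)
  have sub: "submodule (UT2_homog g) scalars (UT2 \<phi>)" for g
  proof (rule M.submoduleI)
    fix M :: "'f^2^2" assume M: "M \<in> UT2_homog g"
    then have "- M \<in> carrier (UT2 \<phi>)" "M \<in> carrier (UT2 \<phi>)"
      by (auto simp: UT2_homog_iff split: if_splits)
    then have "\<ominus>\<^bsub>UT2 \<phi>\<^esub> M = - M"
      by (intro M.minus_equality) auto
    with M show "\<ominus>\<^bsub>UT2 \<phi>\<^esub> M \<in> UT2_homog g"
      by (auto simp: UT2_homog_iff split: if_splits)
  qed (auto simp: UT2_homog_iff split: if_splits)
  have direct: "\<exists>!p. fst p \<in> UT2_homog 0 \<and> snd p \<in> UT2_homog 1 \<and> M = fst p + snd p"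
    if "M $ 2 $ 1 = 0" for M :: "'f^2^2"
    by (rule ex1I[of _ "(mscale (M $ 1 $ 1) (munit 1 1) + mscale (M $ 2 $ 2) (munit 2 2),
          mscale (M $ 1 $ 2) (munit 1 2))"])
       (use that in \<open>auto simp: UT2_homog_iff prod_eq_iff matrix_2_eq_iff\<close>)
  have mult: "M ** N \<in> UT2_homog (g + h)" if "M \<in> UT2_homog g" "N \<in> UT2_homog h"
    for M N :: "'f^2^2" and g h
    using that by (cases g; cases h) (auto simp: UT2_homog_iff mat_mult_2_nth)
  show ?thesis
  proof (intro graded_W_algebra.intro graded_W_algebra_axioms.intro)
    show "submodule (homog (UT2 \<phi>) g) scalars (UT2 \<phi>)" for g
      using sub by simp
    show "\<exists>!p. fst p \<in> homog (UT2 \<phi>) 0 \<and> snd p \<in> homog (UT2 \<phi>) 1 \<and> M = fst p \<oplus>\<^bsub>UT2 \<phi>\<^esub> snd p"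
      if "M \<in> carrier (UT2 \<phi>)" for M
      using direct that by simp
    show "M \<otimes>\<^bsub>UT2 \<phi>\<^esub> N \<in> homog (UT2 \<phi>) (g + h)"
      if "M \<in> homog (UT2 \<phi>) g" "N \<in> homog (UT2 \<phi>) h" for M N g h
      using mult that by simp
    show "lact (UT2 \<phi>) w M \<in> homog (UT2 \<phi>) (g + h)"
      if "w \<in> gradeW g" "M \<in> homog (UT2 \<phi>) h" for w M g h
      using mult homog that by simp
    show "ract (UT2 \<phi>) M w \<in> homog (UT2 \<phi>) (h + g)"
      if "w \<in> gradeW g" "M \<in> homog (UT2 \<phi>) h" for w M g h
      using mult homog that by simp
  qed (fact W.graded_unital_algebra_axioms M.module_axioms |
       auto simp: hom matrix_2_eq_iff mat_mult_2_nth mat_1_nth diag algebra_simps)+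
qed

end

theory Submission
  imports
    Defs
    "HOL-Library.Function_Algebras"
begin

text \<open>
  Both algebras are instances of one situation: \<open>W\<close> acts on the upper triangular matrices through a
  homomorphism \<open>\<phi>\<close> into the diagonal matrices. Write \<open>\<alpha> w\<close> and \<open>\<beta> w\<close> for the two diagonal
  entries of \<open>\<phi> w\<close>. In every algebra of the variety generated by \<open>UT2 \<phi>\<close>, even elements commute
  with each other and with \<open>W\<close>, the product of two odd elements vanishes, and \<open>w z = \<alpha> w z\<close>,
  \<open>z w = \<beta> w z\<close> for odd \<open>z\<close> (locale \<open>triangular_W_algebra\<close>). So the values of multilinear
  monomials of degree \<open>n\<close> are combinations of \<open>e y\<^sub>1 \<dots> y\<^sub>n\<close>, for at most two
  elements \<open>e\<close> of \<open>W\<close>, and of the products \<open>y\<^sub>I z\<^sub>i y\<^sub>J\<close> in which a set \<open>I\<close> of even variables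
  stands to the left of one odd variable and the other ones to the right. This gives the exponential
  upper bound \<open>2 + n 2\<^sup>n\<close> for the codimensions, and for \<open>UT2 \<phi>\<close> itself the \<open>2\<^sup>n\<^sup>-\<^sup>1\<close> choices of
  \<open>I\<close> are linearly independent, as the idempotents \<open>e\<^sub>1\<^sub>1\<close> and \<open>e\<^sub>2\<^sub>2\<close> separate them.

  Now let \<open>A\<close> generate a proper subvariety, so that \<open>A\<close> satisfies an identity \<open>f\<close> that fails in
  \<open>UT2 \<phi>\<close>. Every even element of \<open>UT2 \<phi>\<close> is a polynomial without constant term in \<open>y = diag(1, 2)\<close>,
  and every odd one is a multiple of \<open>z = e\<^sub>1\<^sub>2\<close>. Substituting such expressions turns \<open>f\<close> into a
  combination of terms \<open>\<omega> y\<^sup>j\<close> and \<open>y\<^sup>i z y\<^sup>j\<close> with coefficients that do not depend on the algebra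
  (\<open>form_poly\<close>); it vanishes on \<open>A\<close>, but not on \<open>UT2 \<phi>\<close>. Since the field has characteristic zero,
  \<open>A\<close> also satisfies the homogeneous components and their polarisations. Two cases arise. Either
  \<open>\<omega> y\<^sub>1 \<dots> y\<^sub>d = 0\<close> with \<open>\<phi> \<omega> \<noteq> 0\<close>, and then \<open>y\<^sub>1 \<dots> y\<^sub>d z = 0\<close> or \<open>z y\<^sub>1 \<dots> y\<^sub>d = 0\<close>.
  Or a nonzero symmetric multilinear form in the left and right multiplications by \<open>y\<^sub>1, \<dots>, y\<^sub>d\<close>
  vanishes on odd elements. Putting a product \<open>x y\<close> in place of one variable \<open>y\<close> of the form, and
  comparing with multiples of the form by \<open>x\<close>, splits off that variable and leaves behind a commutator
  with \<open>x\<close> (\<open>commutator_extraction\<close>). In both cases some \<open>k\<close> is such that an odd element vanishes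
  as soon as it has been multiplied by at least \<open>k\<close> even elements on the left, by \<open>k\<close> on the right,
  and commuted with \<open>k\<close> of them (\<open>commutator_identity\<close>).

  Such an identity bounds the codimensions polynomially: left multiplication is right multiplication
  plus commutator, and rewriting left multiplications this way reduces every \<open>y\<^sub>I z\<^sub>i y\<^sub>J\<close> to
  products in which all but at most \<open>2 k\<close> of the variables act on \<open>z\<^sub>i\<close> from the same side
  (\<open>odd_value_spanned\<close>). The number of these products is polynomial in \<open>n\<close>.

  The two varieties differ because some element of \<open>W\<close> is mapped to \<open>e\<^sub>1\<^sub>1\<close> in one action and to
  a scalar in the other one.
\<close>

section \<open>Dimensions of quotients\<close>

lemma vector_space_pointwise: "vector_space (\<lambda>c f x. c * f x :: 'f::field)"
  by unfold_locales (auto simp: fun_eq_iff algebra_simps)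

lemma sum_fun_apply: "(\<Sum>a\<in>T. f a) x = (\<Sum>a\<in>T. f a x :: 'f::comm_monoid_add)"
  by (induction T rule: infinite_finite_induct) auto

text \<open>
  A basis of \<open>N\<close> is extended to a basis of \<open>P\<close>; the vectors added lift a basis of the quotient,
  because the linear map that fixes them and kills the basis of \<open>N\<close> kills all of \<open>N\<close>.
\<close>

lemma (in vector_space) quotient_basis_exists:
  assumes P: "subspace P" and N: "subspace N" and "N \<subseteq> P"
  shows "\<exists>B. quotient_basis scale P N B"
proof -
  obtain C where C: "C \<subseteq> N" "independent C" "N \<subseteq> span C"
    by (rule maximal_independent_subset_extend[of "{}" N]) (auto simp: independent_empty)
  obtain D where D: "C \<subseteq> D" "D \<subseteq> P" "independent D" "P \<subseteq> span D"
    using maximal_independent_subset_extend[of C P] C \<open>N \<subseteq> P\<close> by blast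
  interpret pair: vector_space_pair scale scale ..
  obtain g where g: "Vector_Spaces.linear scale scale g" "\<And>x. x \<in> D \<Longrightarrow> g x = (if x \<in> C then 0 else x)"
    using pair.linear_independent_extend[OF \<open>independent D\<close>, of "\<lambda>x. if x \<in> C then 0 else x"] by blast
  interpret g: Vector_Spaces.linear scale scale g by fact
  have kill: "g v = 0" if "v \<in> N" for v
  proof -
    have "v \<in> span C" using C that by blast
    moreover have "g x = 0" if "x \<in> C" for x using g D that by auto
    ultimately show ?thesis by (rule g.eq_0_on_span[rotated])
  qed
  have "quotient_basis scale P N (D - C)"
    unfolding quotient_basis_def
  proof (intro conjI allI impI ballI)
    fix T c v assume T: "finite T \<and> T \<subseteq> D - C \<and> (\<Sum>v\<in>T. c v *s v) \<in> N" and "v \<in> T"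
    have "0 = g (\<Sum>v\<in>T. c v *s v)" using kill T by simp
    also have "\<dots> = (\<Sum>v\<in>T. c v *s g v)" by (simp add: g.sum g.scale)
    also have "\<dots> = (\<Sum>v\<in>T. c v *s v)" by (rule sum.cong) (use g(2) T in auto)
    finally show "c v = 0"
      using independentD[OF \<open>independent D\<close>, of T c v] T \<open>v \<in> T\<close> by (metis Diff_subset subset_trans)
  next
    fix p assume "p \<in> P"
    then have "p \<in> span (C \<union> (D - C))" using D by (auto simp: Un_absorb1)
    then obtain x y where "p = x + y" "x \<in> span C" "y \<in> span (D - C)"
      unfolding span_Un by blast
    moreover have "x \<in> N"
      using span_minimal[OF C(1) N] calculation by blast
    ultimately show "\<exists>q\<in>span (D - C). p - q \<in> N" by (intro bexI[of _ y]) auto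
  qed (use D in auto)
  then show ?thesis by blast
qed

text \<open>
  Modulo \<open>N\<close>, the elements of \<open>P\<close> are determined by \<open>card X\<close> linear coordinates: \<open>g\<close> is
  injective on the span of any lift of a basis of the quotient.
\<close>

lemma (in vector_space) quotient_dim_le:
  fixes g :: "'b \<Rightarrow> 'x \<Rightarrow> 'a"
  assumes P: "subspace P" and N: "subspace N" and "N \<subseteq> P" and X: "finite X"
    and add: "\<And>p q x. g (p + q) x = g p x + g q x" and scale: "\<And>c p x. g (scale c p) x = c * g p x"
    and ker: "\<And>p. p \<in> P \<Longrightarrow> \<forall>x\<in>X. g p x = 0 \<Longrightarrow> p \<in> N"
  shows "quotient_dim scale P N \<le> enat (card X)"
proof -
  define B where "B = (SOME B. quotient_basis scale P N B)"
  have B: "quotient_basis scale P N B"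
    unfolding B_def by (rule someI_ex) (rule quotient_basis_exists[OF P N \<open>N \<subseteq> P\<close>])
  then have BP: "B \<subseteq> P" by (simp add: quotient_basis_def)
  interpret f: vector_space "\<lambda>c f x. c * f x :: 'a" by (rule vector_space_pointwise)
  define h where "h p x = (if x \<in> X then g p x else 0)" for p x
  interpret h: Vector_Spaces.linear scale "\<lambda>c f x. c * f x :: 'a" h
    by unfold_locales (auto simp: h_def fun_eq_iff add scale)
  define e where "e k x = (if x = k then 1 else 0 :: 'a)" for k x :: 'x
  have zero: "p \<in> N" if "p \<in> P" "h p = 0" for p
  proof (rule ker[OF that(1)], rule ballI)
    fix x assume "x \<in> X"
    then show "g p x = 0" using fun_cong[OF that(2), of x] by (simp add: h_def)
  qed
  have indep: "\<forall>v\<in>T. c v = 0" if "finite T" "T \<subseteq> B" "(\<Sum>v\<in>T. c v *s v) \<in> N" for T c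
    using B that unfolding quotient_basis_def by blast
  have span_B: "v \<in> P" if "v \<in> span B" for v
    using that span_minimal[OF BP P] by blast
  have "inj_on h (span B)"
  proof (subst h.inj_on_iff_eq_0)
    show "\<forall>v\<in>span B. h v = 0 \<longrightarrow> v = 0"
    proof (intro ballI impI)
      fix v assume v: "v \<in> span B" "h v = 0"
      then obtain T c where Tc: "finite T" "T \<subseteq> B" "v = (\<Sum>a\<in>T. c a *s a)"
        by (auto simp: span_explicit)
      have "\<forall>a\<in>T. c a = 0" using indep[OF Tc(1,2)] zero[of v] v Tc span_B by blast
      then show "v = 0" using Tc by simp
    qed
  qed auto
  moreover have "independent B"
  proof -
    have "0 \<in> N" using N by (rule subspace_0)
    then show ?thesis
      using indep unfolding independent_explicit_module by metis
  qed
  ultimately have ind: "f.independent (h ` B)" by (rule h.independent_injective_image[rotated])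
  have "h p \<in> f.span (e ` X)" for p
  proof -
    have "h p = (\<Sum>k\<in>X. (\<lambda>x. h p k * e k x))"
    proof
      fix x
      have "(\<Sum>k\<in>X. (\<lambda>x. h p k * e k x)) x = (\<Sum>k\<in>X. if k = x then h p x else 0)"
        unfolding sum_fun_apply by (rule sum.cong) (auto simp: e_def)
      also have "\<dots> = h p x" using X by (simp add: h_def)
      finally show "h p x = (\<Sum>k\<in>X. (\<lambda>x. h p k * e k x)) x" ..
    qed
    also have "\<dots> \<in> f.span (e ` X)"
      by (intro f.span_sum f.span_scale f.span_base) auto
    finally show ?thesis .
  qed
  then have "finite (h ` B) \<and> card (h ` B) \<le> card (e ` X)"
    using X ind by (intro f.independent_span_bound) auto
  moreover have "inj_on h B" using \<open>inj_on h (span B)\<close> span_superset by (rule inj_on_subset)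
  moreover have "card (e ` X) \<le> card X" using X by (rule card_image_le)
  ultimately have "finite B" "card B \<le> card X"
    by (auto simp: card_image finite_image_iff)
  then show ?thesis by (simp add: quotient_dim_def flip: B_def)
qed

text \<open>
  The coordinate functions \<open>g p\<close> with \<open>p \<in> P\<close> are all attained on the span of a lifted basis, since
  \<open>N\<close> has zero coordinates, and the vectors \<open>v x\<close> produce a multiple of every unit vector.
\<close>

lemma (in vector_space) quotient_dim_ge:
  fixes g :: "'b \<Rightarrow> 'x \<Rightarrow> 'a"
  assumes P: "subspace P" and N: "subspace N" and "N \<subseteq> P" and X: "finite X"
    and add: "\<And>p q x. g (p + q) x = g p x + g q x" and scale: "\<And>c p x. g (scale c p) x = c * g p x"
    and kill: "\<And>p x. p \<in> N \<Longrightarrow> x \<in> X \<Longrightarrow> g p x = 0"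
    and v: "\<And>x. x \<in> X \<Longrightarrow> v x \<in> P" 
    and dual: "\<And>x y. x \<in> X \<Longrightarrow> y \<in> X \<Longrightarrow> g (v x) y = 0 \<longleftrightarrow> x \<noteq> y"
  shows "enat (card X) \<le> quotient_dim scale P N"
proof -
  define B where "B = (SOME B. quotient_basis scale P N B)"
  have B: "quotient_basis scale P N B"
    unfolding B_def by (rule someI_ex) (rule quotient_basis_exists[OF P N \<open>N \<subseteq> P\<close>])
  interpret f: vector_space "\<lambda>c f x. c * f x :: 'a" by (rule vector_space_pointwise)
  define h where "h p x = (if x \<in> X then g p x else 0)" for p x
  interpret h: Vector_Spaces.linear scale "\<lambda>c f x. c * f x :: 'a" h
    by unfold_locales (auto simp: h_def fun_eq_iff add scale)
  have "card X \<le> card B" if "finite B"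
  proof -
    have inj: "inj_on (\<lambda>x. h (v x)) X"
    proof (rule inj_onI)
      fix x y assume "x \<in> X" "y \<in> X" "h (v x) = h (v y)"
      have "g (v x) x = g (v y) x"
        using fun_cong[OF \<open>h (v x) = h (v y)\<close>, of x] \<open>x \<in> X\<close> by (simp add: h_def)
      moreover have "g (v x) x \<noteq> 0" using dual \<open>x \<in> X\<close> by blast
      ultimately show "x = y" using dual \<open>x \<in> X\<close> \<open>y \<in> X\<close> by metis
    qed
    have "f.independent ((\<lambda>x. h (v x)) ` X)"
    proof (rule f.independent_if_scalars_zero)
      fix c w assume eq: "(\<Sum>w\<in>(\<lambda>x. h (v x)) ` X. (\<lambda>x. c w * w x)) = 0" and "w \<in> (\<lambda>x. h (v x)) ` X"
      then obtain y where y: "y \<in> X" "w = h (v y)" by auto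
      have "0 = (\<Sum>w\<in>(\<lambda>x. h (v x)) ` X. (\<lambda>x. c w * w x)) y" using eq by simp
      also have "\<dots> = (\<Sum>x\<in>X. c (h (v x)) * h (v x) y)"
        by (simp add: sum_fun_apply sum.reindex[OF inj])
      also have "\<dots> = (\<Sum>x\<in>X. if x = y then c w * g (v y) y else 0)"
        by (rule sum.cong) (use y dual in \<open>auto simp: h_def\<close>)
      also have "\<dots> = c w * g (v y) y" using X y by simp
      finally show "c w = 0" using dual[of y y] y by simp
    qed (use X in auto)
    moreover have "(\<lambda>x. h (v x)) ` X \<subseteq> f.span (h ` B)"
    proof (rule image_subsetI)
      fix x assume "x \<in> X"
      moreover have "\<forall>p\<in>P. \<exists>q\<in>span B. p - q \<in> N" using B by (simp add: quotient_basis_def)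
      ultimately obtain q where q: "q \<in> span B" "v x - q \<in> N"
        using v by blast
      have "h (v x - q) = 0" using kill[OF q(2)] by (intro ext) (simp add: h_def)
      then have "h (v x) = h q" by (simp add: h.diff)
      moreover have "h q \<in> f.span (h ` B)" using q(1) unfolding h.span_image by (rule imageI)
      ultimately show "h (v x) \<in> f.span (h ` B)" by simp
    qed
    ultimately have "card ((\<lambda>x. h (v x)) ` X) \<le> card (h ` B)"
      using that by (intro conjunct2[OF f.independent_span_bound]) auto
    also have "\<dots> \<le> card B" using that by (rule card_image_le)
    finally show ?thesis by (simp add: card_image inj)
  qed
  then show ?thesis by (simp add: quotient_dim_def flip: B_def)
qed

section \<open>Evaluation\<close>

abbreviation eval_monom :: "('f, 'w, 'a) walg \<Rightarrow> (gvar \<Rightarrow> 'a) \<Rightarrow> 'w wmonom \<Rightarrow> 'a"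
  where "eval_monom A s m \<equiv> lact A (fst m) (eval_word A s (snd m))"

abbreviation admissible :: "('f, 'w, 'a) walg \<Rightarrow> (gvar \<Rightarrow> 'a) \<Rightarrow> bool"
  where "admissible A s \<equiv> \<forall>x. s x \<in> homog A (vdeg x)"

interpretation P: vector_space pscale by (rule vector_space_pscale)

context graded_W_algebra
begin

lemmas algebra_closed [simp] = mult_closed lact_closed ract_closed

lemma smult_closed' [simp]: "x \<in> carrier A \<Longrightarrow> c \<odot> x \<in> carrier A"
  by (simp add: smult_closed)

lemma smult_add' [simp]: "x \<in> carrier A \<Longrightarrow> (c + d) \<odot> x = c \<odot> x \<oplus> d \<odot> x"
  using smult_l_distr[of c d x] by simp

lemma smult_smult: "x \<in> carrier A \<Longrightarrow> c \<odot> (d \<odot> x) = (c * d) \<odot> x"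
  using smult_assoc1[of c d x] by simp

lemma one_smult [simp]: "x \<in> carrier A \<Longrightarrow> 1 \<odot> x = x"
  using smult_one[of x] by simp

lemma zero_smult [simp]: "x \<in> carrier A \<Longrightarrow> 0 \<odot> x = \<zero>"
  using smult_l_null[of x] by simp

lemma smult_zero [simp]: "c \<odot> \<zero> = \<zero>"
  using smult_r_null[of c] by simp

lemma smult_add: "x \<in> carrier A \<Longrightarrow> y \<in> carrier A \<Longrightarrow> c \<odot> (x \<oplus> y) = c \<odot> x \<oplus> c \<odot> y"
  using smult_r_distr[of c x y] by simp

lemma smult_eq_zero: "x \<in> carrier A \<Longrightarrow> c \<odot> x = \<zero> \<Longrightarrow> c \<noteq> 0 \<Longrightarrow> x = \<zero>"
  using smult_smult[of x "inverse c" c] by simp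

lemma homog_closed [simp]: "x \<in> homog A g \<Longrightarrow> x \<in> carrier A"
  using submoduleE(1)[OF homog_submodule[of g]] by blast

lemma homog_add [simp]: "x \<in> homog A g \<Longrightarrow> y \<in> homog A g \<Longrightarrow> x \<oplus> y \<in> homog A g"
  using submoduleE(5)[OF homog_submodule[of g]] by blast

lemma homog_smult [simp]: "x \<in> homog A g \<Longrightarrow> c \<odot> x \<in> homog A g"
  using submoduleE(4)[OF homog_submodule[of g]] by simp

lemma homog_uminus [simp]: "x \<in> homog A g \<Longrightarrow> \<ominus> x \<in> homog A g"
  using submoduleE(3)[OF homog_submodule[of g]] by blast

lemma homog_zero [simp]: "\<zero> \<in> homog A g"
proof -
  obtain x where x: "x \<in> homog A g" using submoduleE(2)[OF homog_submodule[of g]] by blast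
  then have "0 \<odot> x \<in> homog A g" by (rule homog_smult)
  with x show ?thesis by simp
qed

lemma minus_eq_smult: "x \<in> carrier A \<Longrightarrow> \<ominus> x = (- 1) \<odot> x"
proof -
  assume x: "x \<in> carrier A"
  have "(- 1) \<odot> x \<oplus> x = (- 1 + 1) \<odot> x" using x by (subst smult_add') auto
  also have "\<dots> = \<zero>" using x by simp
  finally show ?thesis using x by (intro minus_equality) auto
qed

lemma zero_mult [simp]: "x \<in> carrier A \<Longrightarrow> \<zero> \<otimes> x = \<zero>"
  using mult_smult_left[of \<zero> x 0] by simp

lemma mult_zero [simp]: "x \<in> carrier A \<Longrightarrow> x \<otimes> \<zero> = \<zero>"
  using mult_smult_right[of x \<zero> 0] by simp

lemma lact_zero [simp]: "lact A w \<zero> = \<zero>"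
  using lact_smult[of \<zero> w 0] by simp

lemma ract_zero [simp]: "ract A \<zero> w = \<zero>"
  using ract_smult[of \<zero> 0 w] by simp

lemma eval_word_Cons:
  "us \<noteq> [] \<Longrightarrow> eval_word A s ((u, w) # us) = ract A (s u) w \<otimes> eval_word A s us"
  by (cases us) auto

lemma eval_word_closed [simp]: "admissible A s \<Longrightarrow> eval_word A s us \<in> carrier A"
proof (induction us)
  case (Cons a us)
  have "s x \<in> carrier A" for x using Cons.prems homog_closed by blast
  with Cons show ?case by (cases a; cases "us = []") (auto simp: eval_word_Cons)
qed simp

lemma eval_poly_superset:
  assumes "admissible A s" "finite K" "Poly_Mapping.keys p \<subseteq> K"
  shows "eval_poly A s p = (\<Oplus>m\<in>K. Poly_Mapping.lookup p m \<odot> eval_monom A s m)"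
  unfolding eval_poly_def
proof (rule add.finprod_mono_neutral_cong_left)
  show "Poly_Mapping.lookup p m \<odot> eval_monom A s m = \<zero>" if "m \<in> K - Poly_Mapping.keys p" for m
    using assms that by (simp add: in_keys_iff)
qed (use assms in auto)

lemma eval_poly_closed [simp]: "admissible A s \<Longrightarrow> eval_poly A s p \<in> carrier A"
  unfolding eval_poly_def by (rule finsum_closed) auto

lemma eval_poly_zero [simp]: "eval_poly A s 0 = \<zero>"
  by (simp add: eval_poly_def)

lemma eval_poly_add:
  assumes s: "admissible A s"
  shows "eval_poly A s (p + q) = eval_poly A s p \<oplus> eval_poly A s q"
proof -
  let ?K = "Poly_Mapping.keys p \<union> Poly_Mapping.keys q"
  have "eval_poly A s (p + q) = (\<Oplus>m\<in>?K. Poly_Mapping.lookup (p + q) m \<odot> eval_monom A s m)"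
    using keys_add[of p q] by (intro eval_poly_superset s) auto
  also have "\<dots> = (\<Oplus>m\<in>?K. Poly_Mapping.lookup p m \<odot> eval_monom A s m \<oplus> Poly_Mapping.lookup q m \<odot> eval_monom A s m)"
    using s by (intro finsum_cong') (auto simp: lookup_add)
  also have "\<dots> = (\<Oplus>m\<in>?K. Poly_Mapping.lookup p m \<odot> eval_monom A s m) \<oplus> (\<Oplus>m\<in>?K. Poly_Mapping.lookup q m \<odot> eval_monom A s m)"
    using s by (intro finsum_addf) auto
  also have "\<dots> = eval_poly A s p \<oplus> eval_poly A s q"
    by (subst (1 2) eval_poly_superset[OF s, of ?K]) auto
  finally show ?thesis .
qed

lemma eval_poly_pscale:
  assumes s: "admissible A s"
  shows "eval_poly A s (pscale c p) = c \<odot> eval_poly A s p"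
proof -
  let ?K = "Poly_Mapping.keys p"
  have "eval_poly A s (pscale c p) = (\<Oplus>m\<in>?K. Poly_Mapping.lookup (pscale c p) m \<odot> eval_monom A s m)"
    by (intro eval_poly_superset s) (auto simp: in_keys_iff)
  also have "\<dots> = (\<Oplus>m\<in>?K. c \<odot> (Poly_Mapping.lookup p m \<odot> eval_monom A s m))"
    using s by (intro finsum_cong') (auto simp: smult_smult)
  also have "\<dots> = c \<odot> eval_poly A s p"
    unfolding eval_poly_def using s by (intro finsum_smult_ldistr[symmetric]) auto
  finally show ?thesis .
qed

lemma eval_poly_diff:
  assumes s: "admissible A s"
  shows "eval_poly A s (p - q) = eval_poly A s p \<ominus> eval_poly A s q"
proof -
  have "p - q = p + pscale (- 1) q" by (auto intro!: poly_mapping_eqI simp: lookup_add lookup_minus)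
  then show ?thesis
    by (metis s eval_poly_add eval_poly_pscale eval_poly_closed minus_eq_smult minus_eq)
qed

lemma eval_poly_single [simp]:
  assumes s: "admissible A s"
  shows "eval_poly A s (Poly_Mapping.single m c) = c \<odot> eval_monom A s m"
  using s by (subst eval_poly_superset[of s "{m}"]) auto

lemma vanishing_subspace: "P.subspace {p. \<forall>s. admissible A s \<longrightarrow> eval_poly A s p = \<zero>}"
  by (rule P.subspaceI) (auto simp: eval_poly_add eval_poly_pscale)

end

lemma subspace_free_W_algebra: "P.subspace (free_W_algebra \<B>)"
  unfolding free_W_algebra_def by (rule P.subspace_span)

lemma subspace_multilinear: "P.subspace (multilinear \<B> n)"
  unfolding multilinear_def by (rule P.subspace_span)

lemma (in graded_W_algebra) subspace_W_Id: "P.subspace (W_Id \<B> A)"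
proof -
  have "W_Id \<B> A = free_W_algebra \<B> \<inter> {p. \<forall>s. admissible A s \<longrightarrow> eval_poly A s p = \<zero>}"
    by (auto simp: W_Id_def)
  then show ?thesis by (simp add: P.subspace_inter subspace_free_W_algebra vanishing_subspace)
qed

lemma multilinear_subset_free: 
  assumes "n \<ge> 1" shows "multilinear \<B> n \<subseteq> free_W_algebra \<B>"
  unfolding multilinear_def free_W_algebra_def
proof (rule P.span_mono, safe)
  fix w :: "nat \<Rightarrow> 'a" and u \<sigma>
  assume "\<forall>j\<le>n. w j \<in> \<B>"
  then show "\<exists>w' us. Poly_Mapping.single (w 0, map (\<lambda>j. (u (\<sigma> j), w (Suc j))) [0..<n]) 1 = Poly_Mapping.single (w', us) 1
      \<and> w' \<in> \<B> \<and> us \<noteq> [] \<and> snd ` set us \<subseteq> \<B>"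
    using assms by (intro exI conjI) (auto simp: Suc_le_eq)
qed


text \<open>
  A slot is a nonempty monomial with one coefficient left open. The free algebra only contains
  monomials with coefficients in the basis \<open>\<B>\<close>, which need not contain the unit of \<open>W\<close>. The
  relations below, which express that a monomial is linear in each coefficient, hold
  in every graded \<open>W\<close>-algebra; modulo them all coefficients can be expanded in the basis.
\<close>

definition slots :: "('w \<Rightarrow> 'w wmonom) set"
  where "slots = {\<lambda>v. (v, us) | us. us \<noteq> []} \<union> {\<lambda>v. (w, xs @ (u, v) # ys) | w xs u ys. True}"

definition slot_relations :: "('f::field \<Rightarrow> 'w::ring_1 \<Rightarrow> 'w) \<Rightarrow> ('f, 'w) wpoly set"
  where "slot_relations scaleW =
    {Poly_Mapping.single (m (v + w)) 1 - Poly_Mapping.single (m v) 1 - Poly_Mapping.single (m w) 1 | m v w. m \<in> slots}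
    \<union> {Poly_Mapping.single (m (scaleW c v)) 1 - Poly_Mapping.single (m v) c | m c v. m \<in> slots}"

context graded_unital_algebra
begin

text \<open>
  The coefficients that can be expanded form a subspace, so it suffices to expand the basis elements.
\<close>

lemma expand_slot:
  assumes basis: "span \<B> = UNIV" and m: "m \<in> slots"
    and IH: "\<And>b. b \<in> \<B> \<Longrightarrow> \<exists>p\<in>free_W_algebra \<B>. Poly_Mapping.single (m b) 1 - p \<in> pspan (slot_relations scale)"
  shows "\<exists>p\<in>free_W_algebra \<B>. Poly_Mapping.single (m w) 1 - p \<in> pspan (slot_relations scale)"
proof -
  let ?N = "pspan (slot_relations scale)"
  let ?V = "{w. \<exists>p\<in>free_W_algebra \<B>. Poly_Mapping.single (m w) 1 - p \<in> ?N}"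
  have add: "Poly_Mapping.single (m (v + w)) 1 - Poly_Mapping.single (m v) 1 - Poly_Mapping.single (m w) 1 \<in> ?N" for v w
    using m unfolding slot_relations_def by (intro P.span_base) blast
  have scale: "Poly_Mapping.single (m (scale c v)) 1 - Poly_Mapping.single (m v) c \<in> ?N" for c v
    using m unfolding slot_relations_def by (intro P.span_base) blast
  have "subspace ?V"
  proof (rule subspaceI)
    show "0 \<in> ?V"
      using scale[of 0 0] P.subspace_0[OF subspace_free_W_algebra] by (auto intro!: bexI[of _ 0])
    fix v w c assume "v \<in> ?V"
    then obtain p where p: "p \<in> free_W_algebra \<B>" "Poly_Mapping.single (m v) 1 - p \<in> ?N" by blast
    have "Poly_Mapping.single (m (scale c v)) 1 - pscale c p
      = (Poly_Mapping.single (m (scale c v)) 1 - Poly_Mapping.single (m v) c) + pscale c (Poly_Mapping.single (m v) 1 - p)"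
      by (rule poly_mapping_eqI) (simp add: lookup_minus lookup_add lookup_single when_def algebra_simps)
    also have "\<dots> \<in> ?N" using p scale by (intro P.span_add P.span_scale)
    finally show "scale c v \<in> ?V"
      using P.subspace_scale[OF subspace_free_W_algebra p(1)] by blast
    assume "w \<in> ?V"
    then obtain q where q: "q \<in> free_W_algebra \<B>" "Poly_Mapping.single (m w) 1 - q \<in> ?N" by blast
    have "Poly_Mapping.single (m (v + w)) 1 - (p + q)
      = (Poly_Mapping.single (m (v + w)) 1 - Poly_Mapping.single (m v) 1 - Poly_Mapping.single (m w) 1)
        + (Poly_Mapping.single (m v) 1 - p) + (Poly_Mapping.single (m w) 1 - q)"
      by (simp add: algebra_simps)
    also have "\<dots> \<in> ?N" using p q add by (intro P.span_add)
    finally show "v + w \<in> ?V"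
      using P.subspace_add[OF subspace_free_W_algebra p(1) q(1)] by blast
  qed
  moreover have "\<B> \<subseteq> ?V" using IH by blast
  ultimately have "span \<B> \<subseteq> ?V" by (rule span_minimal[rotated])
  then show ?thesis using basis by blast
qed

lemma expand_monom:
  assumes basis: "span \<B> = UNIV" and "us \<noteq> []"
  shows "\<exists>p\<in>free_W_algebra \<B>. Poly_Mapping.single (w, us) 1 - p \<in> pspan (slot_relations scale)"
proof -
  have word: "\<exists>p\<in>free_W_algebra \<B>. Poly_Mapping.single (b, xs @ us) 1 - p \<in> pspan (slot_relations scale)"
    if "b \<in> \<B>" "snd ` set xs \<subseteq> \<B>" "xs @ us \<noteq> []" for b xs us
    using that
  proof (induction us arbitrary: xs)
    case Nil
    then have "Poly_Mapping.single (b, xs) 1 \<in> free_W_algebra \<B>"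
      unfolding free_W_algebra_def by (intro P.span_base) auto
    then show ?case by (auto simp: P.span_zero intro!: bexI)
  next
    case (Cons a us)
    have "\<exists>p\<in>free_W_algebra \<B>. Poly_Mapping.single (b, xs @ (fst a, b') # us) 1 - p \<in> pspan (slot_relations scale)"
      if "b' \<in> \<B>" for b'
      using Cons.IH[of "xs @ [(fst a, b')]"] Cons.prems that by simp
    moreover have "(\<lambda>v. (b, xs @ (fst a, v) # us)) \<in> slots" unfolding slots_def by blast
    ultimately show ?case
      using expand_slot[OF basis, where m = "\<lambda>v. (b, xs @ (fst a, v) # us)" and w = "snd a"]
      by simp
  qed
  show ?thesis
    by (rule expand_slot[OF basis, where m = "\<lambda>v. (v, us)"]) (use word[of _ "[]" us] assms in \<open>auto simp: slots_def\<close>)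
qed

lemma expand_poly:
  assumes basis: "span \<B> = UNIV" and "\<And>m. m \<in> Poly_Mapping.keys p \<Longrightarrow> snd m \<noteq> []"
  shows "\<exists>q\<in>free_W_algebra \<B>. p - q \<in> pspan (slot_relations scale)"
proof -
  have "\<exists>q\<in>free_W_algebra \<B>. Poly_Mapping.single m 1 - q \<in> pspan (slot_relations scale)"
    if "m \<in> Poly_Mapping.keys p" for m
    using expand_monom[OF basis, of "snd m" "fst m"] assms(2)[OF that] by simp
  then obtain q where q: "\<And>m. m \<in> Poly_Mapping.keys p \<Longrightarrow> q m \<in> free_W_algebra \<B>"
    "\<And>m. m \<in> Poly_Mapping.keys p \<Longrightarrow> Poly_Mapping.single m 1 - q m \<in> pspan (slot_relations scale)"
    by metis
  let ?q = "\<Sum>m\<in>Poly_Mapping.keys p. pscale (Poly_Mapping.lookup p m) (q m)"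
  have "p = (\<Sum>m\<in>Poly_Mapping.keys p. pscale (Poly_Mapping.lookup p m) (Poly_Mapping.single m 1))"
  proof (rule poly_mapping_eqI)
    fix k
    have "Poly_Mapping.lookup (\<Sum>m\<in>Poly_Mapping.keys p. pscale (Poly_Mapping.lookup p m) (Poly_Mapping.single m 1)) k
      = (\<Sum>m\<in>Poly_Mapping.keys p. if m = k then Poly_Mapping.lookup p m else 0)"
      unfolding lookup_sum by (rule sum.cong) (auto simp: lookup_single when_def)
    also have "\<dots> = Poly_Mapping.lookup p k" by (simp add: in_keys_iff)
    finally show "Poly_Mapping.lookup p k = Poly_Mapping.lookup (\<Sum>m\<in>Poly_Mapping.keys p. pscale (Poly_Mapping.lookup p m) (Poly_Mapping.single m 1)) k" ..
  qed
  then have "p - ?q = (\<Sum>m\<in>Poly_Mapping.keys p. pscale (Poly_Mapping.lookup p m) (Poly_Mapping.single m 1 - q m))"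
    by (simp add: P.scale_right_diff_distrib sum_subtractf)
  also have "\<dots> \<in> pspan (slot_relations scale)"
    by (intro P.span_sum P.span_scale q)
  finally show ?thesis
    by (rule bexI)
      (intro P.subspace_sum[OF subspace_free_W_algebra] P.subspace_scale[OF subspace_free_W_algebra] q(1))
qed

end

context graded_W_algebra
begin

lemma eval_word_slot_add:
  assumes s: "admissible A s"
  shows "eval_word A s (xs @ (u, v + w) # ys) = eval_word A s (xs @ (u, v) # ys) \<oplus> eval_word A s (xs @ (u, w) # ys)"
proof (induction xs)
  case Nil
  have "s u \<in> carrier A" using s homog_closed by blast
  then show ?case using s by (cases "ys = []") (simp_all add: eval_word_Cons ract_plus mult_add_left)
next
  case (Cons x xs)
  have "s (fst x) \<in> carrier A" using s homog_closed by blast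
  with Cons s show ?case by (cases x) (simp add: eval_word_Cons mult_add_right)
qed

lemma eval_word_slot_scale:
  assumes s: "admissible A s"
  shows "eval_word A s (xs @ (u, scaleW c v) # ys) = c \<odot> eval_word A s (xs @ (u, v) # ys)"
proof (induction xs)
  case Nil
  have "s u \<in> carrier A" using s homog_closed by blast
  then show ?case using s by (cases "ys = []") (simp_all add: eval_word_Cons ract_scale mult_smult_left)
next
  case (Cons x xs)
  have "s (fst x) \<in> carrier A" using s homog_closed by blast
  with Cons s show ?case by (cases x) (simp add: eval_word_Cons mult_smult_right)
qed

lemma eval_slot_relations:
  assumes "p \<in> pspan (slot_relations scaleW)" and s: "admissible A s"
  shows "eval_poly A s p = \<zero>"
proof -
  have add: "eval_monom A s (m (v + w)) = eval_monom A s (m v) \<oplus> eval_monom A s (m w)" if "m \<in> slots" for m v w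
    using that s by (auto simp: slots_def lact_plus lact_add eval_word_slot_add)
  have scale: "eval_monom A s (m (scaleW c v)) = c \<odot> eval_monom A s (m v)" if "m \<in> slots" for m c v
    using that s by (auto simp: slots_def lact_scale lact_smult eval_word_slot_scale)
  have cancel: "(x \<oplus> y) \<ominus> x \<ominus> y = \<zero>" if "x \<in> carrier A" "y \<in> carrier A" for x y
  proof -
    have "(x \<oplus> y) \<ominus> x \<ominus> y = (x \<oplus> y) \<ominus> (x \<oplus> y)" using that by (simp add: a_minus_def a_assoc minus_add)
    then show ?thesis using that by (simp add: a_minus_def r_neg)
  qed
  have "slot_relations scaleW \<subseteq> {p. eval_poly A s p = \<zero>}"
    using s add scale
    by (auto simp: slot_relations_def eval_poly_diff cancel) (simp add: a_minus_def r_neg)?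
  moreover have "P.subspace {p. eval_poly A s p = \<zero>}"
    using s by (intro P.subspaceI) (auto simp: eval_poly_add eval_poly_pscale)
  ultimately show ?thesis using assms(1) P.span_minimal by blast
qed

text \<open>
  Identities with arbitrary coefficients pass to the variety just as those in the free algebra do:
  modulo the slot relations they agree with elements of the free algebra.
\<close>

lemma identity_transfer:
  fixes A' :: "('f, 'w, 'b) walg"
  assumes A': "graded_W_algebra scaleW gradeW A'" and basis: "W.span \<B> = UNIV"
    and sub: "W_Id \<B> A' \<subseteq> W_Id \<B> A"
    and keys: "\<And>m. m \<in> Poly_Mapping.keys p \<Longrightarrow> snd m \<noteq> []"
    and van: "\<And>s. admissible A' s \<Longrightarrow> eval_poly A' s p = \<zero>\<^bsub>A'\<^esub>"
    and s: "admissible A s"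
  shows "eval_poly A s p = \<zero>"
proof -
  interpret A': graded_W_algebra scaleW gradeW A' by fact
  obtain q where q: "q \<in> free_W_algebra \<B>" "p - q \<in> pspan (slot_relations scaleW)"
    using W.expand_poly[OF basis keys] by blast
  have "p = q + (p - q)" by simp
  have "eval_poly A' s q = \<zero>\<^bsub>A'\<^esub>" if s: "admissible A' s" for s
  proof -
    have "eval_poly A' s p = eval_poly A' s q \<oplus>\<^bsub>A'\<^esub> eval_poly A' s (p - q)"
      by (subst \<open>p = q + (p - q)\<close>) (rule A'.eval_poly_add[OF s])
    then show ?thesis using van[OF s] A'.eval_slot_relations[OF q(2) s] s by simp
  qed
  then have "q \<in> W_Id \<B> A'" using q by (simp add: W_Id_def)
  then have "eval_poly A s q = \<zero>" using sub s by (auto simp: W_Id_def)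
  moreover have "eval_poly A s p = eval_poly A s q \<oplus> eval_poly A s (p - q)"
    by (subst \<open>p = q + (p - q)\<close>) (rule eval_poly_add[OF s])
  ultimately show ?thesis using eval_slot_relations[OF q(2) s] by simp
qed

end

section \<open>Copies of algebras\<close>

text \<open>
  Varieties consist of algebras on a fixed universe. The algebra of upper triangular matrices is
  moved into it along an injection \<open>h\<close>; the copy has the same identities.
\<close>

definition transport :: "('a \<Rightarrow> 'u) \<Rightarrow> ('f, 'w, 'a) walg \<Rightarrow> ('f, 'w, 'u) walg"
  where "transport h A =
    \<lparr>carrier = h ` carrier A, monoid.mult = (\<lambda>x y. h (inv_into UNIV h x \<otimes>\<^bsub>A\<^esub> inv_into UNIV h y)), one = h \<one>\<^bsub>A\<^esub>,
     zero = h \<zero>\<^bsub>A\<^esub>, add = (\<lambda>x y. h (inv_into UNIV h x \<oplus>\<^bsub>A\<^esub> inv_into UNIV h y)),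
     smult = (\<lambda>c x. h (c \<odot>\<^bsub>A\<^esub> inv_into UNIV h x)), homog = (\<lambda>g. h ` homog A g),
     lact = (\<lambda>w x. h (lact A w (inv_into UNIV h x))), ract = (\<lambda>x w. h (ract A (inv_into UNIV h x) w))\<rparr>"

lemma transport_sel [simp]:
  "carrier (transport h A) = h ` carrier A" "\<zero>\<^bsub>transport h A\<^esub> = h \<zero>\<^bsub>A\<^esub>"
  "homog (transport h A) g = h ` homog A g"
  by (simp_all add: transport_def)

context graded_W_algebra
begin

context
  fixes h :: "'a \<Rightarrow> 'u"
  assumes inj: "inj h"
begin

lemma transport_ops:
  "h x \<otimes>\<^bsub>transport h A\<^esub> h y = h (x \<otimes> y)" "h x \<oplus>\<^bsub>transport h A\<^esub> h y = h (x \<oplus> y)"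
  "c \<odot>\<^bsub>transport h A\<^esub> h x = h (c \<odot> x)"
  "lact (transport h A) w (h x) = h (lact A w x)" "ract (transport h A) (h x) w = h (ract A x w)"
  by (simp_all add: transport_def inv_f_f[OF inj])

lemma module_transport: "Module.module scalars (transport h A)"
proof (rule moduleI[OF cring_scalars abelian_groupI])
  show "\<exists>y\<in>carrier (transport h A). y \<oplus>\<^bsub>transport h A\<^esub> x = \<zero>\<^bsub>transport h A\<^esub>"
    if "x \<in> carrier (transport h A)" for x
  proof -
    obtain x' where "x = h x'" "x' \<in> carrier A" using \<open>x \<in> carrier (transport h A)\<close> by auto
    then show ?thesis by (intro bexI[of _ "h (\<ominus> x')"]) (auto simp: transport_ops l_neg)
  qed
qed (auto simp: transport_ops a_ac smult_add smult_smult)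

lemma graded_W_algebra_transport: "graded_W_algebra scaleW gradeW (transport h A)"
proof -
  interpret M: Module.module scalars "transport h A" by (rule module_transport)
  have sub: "submodule (h ` homog A g) scalars (transport h A)" for g
  proof (rule M.submoduleI)
    fix x assume "x \<in> h ` homog A g"
    then obtain x' where x': "x = h x'" "x' \<in> homog A g" by auto
    then have "\<ominus>\<^bsub>transport h A\<^esub> x = h (\<ominus> x')"
      by (intro M.minus_equality) (auto simp: transport_ops l_neg)
    then show "\<ominus>\<^bsub>transport h A\<^esub> x \<in> h ` homog A g" using x' by simp
  qed (auto simp: transport_ops)
  have direct: "\<exists>!p. fst p \<in> h ` homog A 0 \<and> snd p \<in> h ` homog A 1 \<and> h x = fst p \<oplus>\<^bsub>transport h A\<^esub> snd p"
    if x: "x \<in> carrier A" for x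
  proof -
    obtain p where p: "fst p \<in> homog A 0" "snd p \<in> homog A 1" "x = fst p \<oplus> snd p"
      and uniq: "\<And>q. fst q \<in> homog A 0 \<and> snd q \<in> homog A 1 \<and> x = fst q \<oplus> snd q \<Longrightarrow> q = p"
      using homog_direct[OF x] by (metis (no_types, lifting))
    show ?thesis
    proof (rule ex1I[of _ "(h (fst p), h (snd p))"])
      fix q assume "fst q \<in> h ` homog A 0 \<and> snd q \<in> h ` homog A 1 \<and> h x = fst q \<oplus>\<^bsub>transport h A\<^esub> snd q"
      then obtain a b where ab: "a \<in> homog A 0" "b \<in> homog A 1" "q = (h a, h b)" "h x = h (a \<oplus> b)"
        by (cases q) (auto simp: transport_ops)
      then have "(a, b) = p" using uniq[of "(a, b)"] inj by (simp add: inj_eq)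
      then show "q = (h (fst p), h (snd p))" using ab by auto
    qed (use p in \<open>auto simp: transport_ops\<close>)
  qed
  show ?thesis
  proof (intro graded_W_algebra.intro graded_W_algebra_axioms.intro)
    show "submodule (homog (transport h A) g) scalars (transport h A)" for g
      using sub by simp
    show "\<exists>!p. fst p \<in> homog (transport h A) 0 \<and> snd p \<in> homog (transport h A) 1 \<and> x = fst p \<oplus>\<^bsub>transport h A\<^esub> snd p"
      if "x \<in> carrier (transport h A)" for x
    proof -
      obtain x' where "x = h x'" "x' \<in> carrier A" using \<open>x \<in> carrier (transport h A)\<close> by auto
      then show ?thesis using direct[of x'] by (simp only: transport_sel)
    qed
    show "x \<otimes>\<^bsub>transport h A\<^esub> y \<in> homog (transport h A) (g + g')"
      if "x \<in> homog (transport h A) g" "y \<in> homog (transport h A) g'" for x y g g'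
      using that homog_mult by (auto simp only: transport_ops transport_sel)
    show "lact (transport h A) w x \<in> homog (transport h A) (g + g')"
      if "w \<in> gradeW g" "x \<in> homog (transport h A) g'" for x w g g'
      using that lact_homog by (auto simp only: transport_ops transport_sel)
    show "ract (transport h A) x w \<in> homog (transport h A) (g' + g)"
      if "w \<in> gradeW g" "x \<in> homog (transport h A) g'" for x w g g'
      using that ract_homog by (auto simp only: transport_ops transport_sel)
  qed (fact W.graded_unital_algebra_axioms M.module_axioms |
       auto simp: transport_ops inj_image_mem_iff[OF inj] mult_assoc mult_add_left mult_add_right mult_smult_left mult_smult_right
         lact_add lact_smult lact_plus lact_scale lact_times lact_one ract_add ract_smult
         ract_plus ract_scale ract_times ract_one lact_ract mult_ract lact_mult ract_mult_lact)+
qed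

lemma eval_word_transport:
  assumes "admissible A s"
  shows "eval_word (transport h A) (\<lambda>x. h (s x)) us = h (eval_word A s us)"
proof (induction us)
  case (Cons a us)
  then show ?case by (cases a; cases us) (auto simp: transport_ops)
qed simp

lemma eval_poly_transport:
  assumes s: "admissible A s"
  shows "eval_poly (transport h A) (\<lambda>x. h (s x)) p = h (eval_poly A s p)"
proof -
  interpret T: graded_W_algebra scaleW gradeW "transport h A" by (rule graded_W_algebra_transport)
  let ?f = "\<lambda>m. Poly_Mapping.lookup p m \<odot> eval_monom A s m"
  have "finsum (transport h A) (\<lambda>m. h (?f m)) K = h (finsum A ?f K)" if "finite K" for K
    using that
  proof induction
    case (insert k K)
    have "(\<lambda>m. h (?f m)) \<in> K \<rightarrow> carrier (transport h A)" "?f \<in> K \<rightarrow> carrier A" using s by auto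
    then show ?case using insert s by (subst T.finsum_insert; (subst finsum_insert)?) (auto simp: transport_ops)
  qed simp
  then show ?thesis by (simp add: eval_poly_def eval_word_transport[OF s] transport_ops)
qed

lemma W_Id_transport: "W_Id \<B> (transport h A) = W_Id \<B> A"
proof -
  have "(\<forall>s. admissible (transport h A) s \<longrightarrow> eval_poly (transport h A) s p = \<zero>\<^bsub>transport h A\<^esub>)
    \<longleftrightarrow> (\<forall>s. admissible A s \<longrightarrow> eval_poly A s p = \<zero>)" for p
  proof safe
    fix s assume *: "\<forall>s. admissible (transport h A) s \<longrightarrow> eval_poly (transport h A) s p = \<zero>\<^bsub>transport h A\<^esub>"
      and s: "admissible A s"
    have "admissible (transport h A) (\<lambda>x. h (s x))" using s by simp
    then have "h (eval_poly A s p) = h \<zero>" using * eval_poly_transport[OF s] by fastforce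
    then show "eval_poly A s p = \<zero>" using inj by (simp add: inj_eq)
  next
    fix s assume *: "\<forall>s. admissible A s \<longrightarrow> eval_poly A s p = \<zero>" and s: "admissible (transport h A) s"
    define s' where "s' x = inv_into UNIV h (s x)" for x
    have "s x = h (s' x) \<and> s' x \<in> homog A (vdeg x)" for x
    proof -
      obtain a where "s x = h a" "a \<in> homog A (vdeg x)" using s by auto
      then show ?thesis using inj by (simp add: s'_def)
    qed
    then have "s = (\<lambda>x. h (s' x))" "admissible A s'" by auto
    then show "eval_poly (transport h A) s p = \<zero>\<^bsub>transport h A\<^esub>"
      using * eval_poly_transport[of s' p] by simp
  qed
  then show ?thesis by (simp add: W_Id_def)
qed

end

lemma smult_sum_eq_zero:
  assumes "x \<in> carrier A" "u \<in> carrier A" "v \<in> carrier A"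
  shows "x \<oplus> ((- a) \<odot> u \<oplus> (- b) \<odot> v) = \<zero> \<longleftrightarrow> x = a \<odot> u \<oplus> b \<odot> v"
proof -
  have "(- a) \<odot> u \<oplus> (- b) \<odot> v = \<ominus> (a \<odot> u \<oplus> b \<odot> v)"
    using assms by (simp add: minus_eq_smult smult_add smult_smult)
  then have "x \<oplus> ((- a) \<odot> u \<oplus> (- b) \<odot> v) = x \<ominus> (a \<odot> u \<oplus> b \<odot> v)" by (simp add: a_minus_def)
  moreover have "x \<ominus> y = \<zero> \<longleftrightarrow> x = y" if "y \<in> carrier A" for y
    using that assms by (metis a_minus_def a_inv_closed minus_equality minus_minus r_neg)
  ultimately show ?thesis using assms by simp
qed

text \<open>
  All relations needed below express a monomial by at most two others.
\<close>

lemma linear_relation_transfer: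
  fixes A' :: "('f, 'w, 'b) walg"
  assumes A': "graded_W_algebra scaleW gradeW A'" and basis: "W.span \<B> = UNIV"
    and sub: "W_Id \<B> A' \<subseteq> W_Id \<B> A" and m: "snd m \<noteq> []" "snd m1 \<noteq> []" "snd m2 \<noteq> []"
    and rel: "\<And>s. admissible A' s \<Longrightarrow>
      eval_monom A' s m = a \<odot>\<^bsub>A'\<^esub> eval_monom A' s m1 \<oplus>\<^bsub>A'\<^esub> b \<odot>\<^bsub>A'\<^esub> eval_monom A' s m2"
    and s: "admissible A s"
  shows "eval_monom A s m = a \<odot> eval_monom A s m1 \<oplus> b \<odot> eval_monom A s m2"
proof -
  interpret A': graded_W_algebra scaleW gradeW A' by fact
  let ?p = "Poly_Mapping.single m 1 + (Poly_Mapping.single m1 (- a) + Poly_Mapping.single m2 (- b))"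
  have "eval_poly A s ?p = \<zero>"
  proof (rule identity_transfer[OF A' basis sub _ _ s])
    show "snd k \<noteq> []" if "k \<in> Poly_Mapping.keys ?p" for k
      using that m by (auto simp: in_keys_iff lookup_add lookup_single when_def split: if_splits)
    show "eval_poly A' s ?p = \<zero>\<^bsub>A'\<^esub>" if s: "admissible A' s" for s
      using rel[OF s] s by (simp add: A'.eval_poly_add A'.smult_sum_eq_zero)
  qed
  then show ?thesis using s by (simp add: eval_poly_add smult_sum_eq_zero)
qed

end

section \<open>Relations in the variety of upper triangular matrices\<close>

text \<open>
  The consequences of the identities of \<open>UT2 \<phi>\<close> on which the whole proof rests; \<open>\<alpha> w\<close> and \<open>\<beta> w\<close>
  are the diagonal entries of \<open>\<phi> w\<close>. The elements \<open>e1\<close> and \<open>e2\<close> describe the image of \<open>\<phi>\<close>: they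
  act as \<open>e\<^sub>1\<^sub>1\<close> and \<open>e\<^sub>2\<^sub>2\<close> if the image consists of all diagonal matrices, while \<open>e1 = 1\<close> and
  \<open>e2 = 0\<close> if it consists of the scalar matrices.
\<close>

locale triangular_W_algebra = graded_W_algebra scaleW gradeW A
  for scaleW :: "'f::field_char_0 \<Rightarrow> 'w::ring_1 \<Rightarrow> 'w" and gradeW :: "bit \<Rightarrow> 'w set"
    and A :: "('f, 'w, 'a) walg" (structure) +
  fixes \<alpha> \<beta> :: "'w \<Rightarrow> 'f" and e1 e2 :: 'w
  assumes even_commute: "\<lbrakk>x \<in> homog A 0; y \<in> homog A 0\<rbrakk> \<Longrightarrow> x \<otimes> y = y \<otimes> x"
    and odd_odd: "\<lbrakk>x \<in> homog A 1; y \<in> homog A 1\<rbrakk> \<Longrightarrow> x \<otimes> y = \<zero>"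
    and ract_even: "x \<in> homog A 0 \<Longrightarrow> ract A x w = lact A w x"
    and lact_even: "x \<in> homog A 0 \<Longrightarrow> lact A w x = \<alpha> w \<odot> lact A e1 x \<oplus> \<beta> w \<odot> lact A e2 x"
    and lact_odd: "x \<in> homog A 1 \<Longrightarrow> lact A w x = \<alpha> w \<odot> x"
    and ract_odd: "x \<in> homog A 1 \<Longrightarrow> ract A x w = \<beta> w \<odot> x"

lemma all_gvar: "(\<forall>v. Q v) \<longleftrightarrow> (\<forall>i. Q (Y i)) \<and> (\<forall>i. Q (Z i))"
  by (metis gvar.exhaust)

lemma admissible_UT2: "(\<forall>x. s x \<in> UT2_homog (vdeg x)) \<longleftrightarrow>
    (\<forall>i. s (Y i) $ 1 $ 2 = 0 \<and> s (Y i) $ 2 $ 1 = 0) \<and>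
    (\<forall>i. s (Z i) $ 1 $ 1 = 0 \<and> s (Z i) $ 2 $ 1 = 0 \<and> s (Z i) $ 2 $ 2 = 0)"
  by (auto simp: UT2_homog_iff all_gvar split: if_splits)
  
text \<open>
  Each relation holds in \<open>UT2 \<phi>\<close> by a matrix computation and is transferred to \<open>A\<close> as an identity
  in the variables \<open>y\<^sub>1, y\<^sub>2, z\<^sub>1, z\<^sub>2\<close>.
\<close>

lemma triangular_W_algebraI:
  fixes scaleW :: "'f::field_char_0 \<Rightarrow> 'w::ring_1 \<Rightarrow> 'w" and A :: "('f, 'w, 'a) walg"
  assumes A: "graded_W_algebra scaleW gradeW A" and basis: "Modules.module.span scaleW \<B> = UNIV"
    and \<phi>: "graded_unital_hom_onto scaleW gradeW B \<phi>" "B \<subseteq> diagonal_matrices"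
    and e: "\<And>w. \<phi> w = mscale (\<phi> w $ 1 $ 1) (\<phi> e1) + mscale (\<phi> w $ 2 $ 2) (\<phi> e2)"
    and sub: "W_Id \<B> (UT2 \<phi>) \<subseteq> W_Id \<B> A"
  shows "triangular_W_algebra scaleW gradeW A (\<lambda>w. \<phi> w $ 1 $ 1) (\<lambda>w. \<phi> w $ 2 $ 2) e1 e2"
proof -
  interpret graded_W_algebra scaleW gradeW A by fact
  have U: "graded_W_algebra scaleW gradeW (UT2 \<phi>)"
    by (rule graded_W_algebra_UT2[OF W.graded_unital_algebra_axioms \<phi>])
  have diag: "\<phi> w $ 1 $ 2 = 0" "\<phi> w $ 2 $ 1 = 0" for w
    using \<phi> by (auto simp: graded_unital_hom_onto_def diagonal_matrices_iff subset_iff)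
  have one: "\<phi> 1 = mat 1" using \<phi> by (simp add: graded_unital_hom_onto_def)
  have e_nth: "\<phi> w $ i $ j = \<phi> w $ 1 $ 1 * \<phi> e1 $ i $ j + \<phi> w $ 2 $ 2 * \<phi> e2 $ i $ j" for w i j
    by (subst e) simp
  note transfer = linear_relation_transfer[OF U basis sub]
  define sub where "sub x y z z' = (\<lambda>v. case v of Y i \<Rightarrow> if i = 0 then x else y | Z i \<Rightarrow> if i = 0 then z else z')"
    for x y z z' :: 'a
  have adm: "admissible A (sub x y z z')"
    if "x \<in> homog A 0" "y \<in> homog A 0" "z \<in> homog A 1" "z' \<in> homog A 1" for x y z z'
    using that by (auto simp: sub_def split: gvar.splits)
  note calc = admissible_UT2 diag one matrix_2_eq_iff mat_mult_2_nth mat_1_nth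
  let ?o = "\<zero>\<^bsub>A\<^esub>"
  show ?thesis
  proof (unfold_locales, goal_cases)
    case (1 x y)
    then show ?case
      using transfer[of "(1, [(Y 0, 1), (Y 1, 1)])" "(1, [(Y 1, 1), (Y 0, 1)])" "(1, [(Y 1, 1), (Y 0, 1)])" 1 0
          "sub x y ?o ?o"] adm[of x y ?o ?o]
      by (simp add: calc sub_def lact_one ract_one)
  next
    case (2 x y)
    then show ?case
      using transfer[of "(1, [(Z 0, 1), (Z 1, 1)])" "(1, [(Z 1, 1), (Z 0, 1)])" "(1, [(Z 1, 1), (Z 0, 1)])" 0 0
          "sub ?o ?o x y"] adm[of ?o ?o x y]
      by (simp add: calc sub_def lact_one ract_one)
  next
    case (3 x w)
    then show ?case
      using transfer[of "(1, [(Y 0, w)])" "(w, [(Y 0, 1)])" "(w, [(Y 0, 1)])" 1 0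
          "sub x ?o ?o ?o"] adm[of x ?o ?o ?o]
      by (simp add: calc sub_def lact_one ract_one)
  next
    case (4 x w)
    have rel: "\<phi> w $ i $ j * t = \<phi> w $ 1 $ 1 * (\<phi> e1 $ i $ j * t) + \<phi> w $ 2 $ 2 * (\<phi> e2 $ i $ j * t)" for i j t
      by (subst e_nth) (simp add: algebra_simps)
    from 4 show ?case
      using transfer[of "(w, [(Y 0, 1)])" "(e1, [(Y 0, 1)])" "(e2, [(Y 0, 1)])" "\<phi> w $ 1 $ 1" "\<phi> w $ 2 $ 2"
          "sub x ?o ?o ?o"] adm[of x ?o ?o ?o]
      by (simp add: calc sub_def lact_one ract_one flip: rel)
  next
    case (5 x w)
    then show ?case
      using transfer[of "(w, [(Z 0, 1)])" "(1, [(Z 0, 1)])" "(1, [(Z 0, 1)])" "\<phi> w $ 1 $ 1" 0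
          "sub ?o ?o x ?o"] adm[of ?o ?o x ?o]
      by (simp add: calc sub_def lact_one ract_one)
  next
    case (6 x w)
    then show ?case
      using transfer[of "(1, [(Z 0, w)])" "(1, [(Z 0, 1)])" "(1, [(Z 0, 1)])" "\<phi> w $ 2 $ 2" 0
          "sub ?o ?o x ?o"] adm[of ?o ?o x ?o]
      by (simp add: calc sub_def lact_one ract_one)
  qed
qed

section \<open>Spanning sets of values\<close>

context graded_W_algebra
begin

text \<open>
  Linear combinations with coefficients that do not depend on the point \<open>s\<close> at which the functions
  are evaluated. Only the values on \<open>S\<close> matter.
\<close>

inductive spanned :: "'s set \<Rightarrow> ('s \<Rightarrow> 'a) set \<Rightarrow> ('s \<Rightarrow> 'a) \<Rightarrow> bool" for S G
  where
    zero: "(\<And>s. s \<in> S \<Longrightarrow> v s = \<zero>) \<Longrightarrow> spanned S G v"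
  | step: "g \<in> G \<Longrightarrow> spanned S G v \<Longrightarrow> (\<And>s. s \<in> S \<Longrightarrow> v' s = c \<odot> g s \<oplus> v s) \<Longrightarrow> spanned S G v'"

context
  fixes S :: "'s set" and G :: "('s \<Rightarrow> 'a) set"
  assumes G: "\<forall>g\<in>G. \<forall>s\<in>S. g s \<in> carrier A"
begin

lemma spanned_closed: "spanned S G v \<Longrightarrow> s \<in> S \<Longrightarrow> v s \<in> carrier A"
  by (induction rule: spanned.induct) (auto simp: G)

lemma spanned_cong: "spanned S G v \<Longrightarrow> (\<And>s. s \<in> S \<Longrightarrow> v' s = v s) \<Longrightarrow> spanned S G v'"
proof (erule spanned.cases)
  fix g v1 v'' c
  assume "\<And>s. s \<in> S \<Longrightarrow> v' s = v s" "v = v''" "g \<in> G" "spanned S G v1" "\<And>s. s \<in> S \<Longrightarrow> v'' s = c \<odot> g s \<oplus> v1 s"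
  then show ?thesis by (intro spanned.step[of g G S v1 v' c]) simp_all
qed (simp add: spanned.zero)

lemma spanned_smult: "spanned S G v \<Longrightarrow> (\<And>s. s \<in> S \<Longrightarrow> v' s = c \<odot> v s) \<Longrightarrow> spanned S G v'"
proof (induction arbitrary: v' rule: spanned.induct)
  case (zero v)
  then show ?case by (intro spanned.zero) simp
next
  case (step g v v1 c')
  have "spanned S G (\<lambda>s. c \<odot> v s)" by (rule step.IH) simp
  then show ?case
    by (rule spanned.step[OF step.hyps(1), where c = "c * c'"])
      (use step.hyps step.prems in \<open>simp add: smult_add smult_smult G spanned_closed\<close>)
qed

lemma spanned_add:
  assumes "spanned S G v1" "spanned S G v2" "\<And>s. s \<in> S \<Longrightarrow> v s = v1 s \<oplus> v2 s"
  shows "spanned S G v"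
  using assms(1,3)
proof (induction arbitrary: v rule: spanned.induct)
  case (zero v1)
  with assms(2) show ?case by (auto intro!: spanned_cong[of v2] simp: spanned_closed[OF assms(2)])
next
  case (step g v1 v1' c)
  have "spanned S G (\<lambda>s. v1 s \<oplus> v2 s)" by (rule step.IH) simp
  then show ?case
    by (rule spanned.step[OF step.hyps(1), where c = c])
      (use step.hyps step.prems assms(2) in \<open>simp add: G spanned_closed a_assoc\<close>)
qed

lemma spanned_base: "g \<in> G \<Longrightarrow> (\<And>s. s \<in> S \<Longrightarrow> v s = g s) \<Longrightarrow> spanned S G v"
  by (rule spanned.step[of g _ _ "\<lambda>s. \<zero>" _ 1]) (auto intro: spanned.zero simp: G)

lemma spanned_trans: "spanned S H v \<Longrightarrow> (\<And>h. h \<in> H \<Longrightarrow> spanned S G h) \<Longrightarrow> spanned S G v"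
proof (induction rule: spanned.induct)
  case (step h v v' c)
  have "spanned S G (\<lambda>s. c \<odot> h s)" by (rule spanned_smult[OF step.prems[OF step.hyps(1)]]) simp
  moreover have "spanned S G v" by (rule step.IH) (rule step.prems)
  ultimately show ?case by (rule spanned_add) (rule step.hyps)
qed (auto intro: spanned.zero)

lemma spanned_finsum:
  assumes "finite G" "spanned S G v"
  shows "\<exists>c. \<forall>s\<in>S. v s = (\<Oplus>g\<in>G. c g \<odot> g s)"
  using assms(2)
proof (induction rule: spanned.induct)
  case (zero v)
  have "(\<Oplus>g\<in>G. 0 \<odot> g s) = \<zero>" if "s \<in> S" for s
    by (rule add.finprod_one_eqI) (simp add: G that)
  with zero show ?case by (intro exI[of _ "\<lambda>_. 0"]) simp
next
  case (step g v v' a)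
  then obtain c where c: "\<forall>s\<in>S. v s = (\<Oplus>g\<in>G. c g \<odot> g s)" by blast
  have split: "(\<Oplus>g\<in>G. d g \<odot> g s) = d g \<odot> g s \<oplus> (\<Oplus>g\<in>G - {g}. d g \<odot> g s)" if "s \<in> S" for d s
  proof -
    have "(\<Oplus>g\<in>insert g (G - {g}). d g \<odot> g s) = d g \<odot> g s \<oplus> (\<Oplus>g\<in>G - {g}. d g \<odot> g s)"
      using \<open>finite G\<close> step.hyps(1) that by (intro finsum_insert) (auto simp: G)
    then show ?thesis using step.hyps(1) by (simp add: insert_absorb)
  qed
  have "v' s = (\<Oplus>h\<in>G. (c(g := a + c g)) h \<odot> h s)" if s: "s \<in> S" for s
  proof -
    have "(\<Oplus>h\<in>G - {g}. (c(g := a + c g)) h \<odot> h s) = (\<Oplus>h\<in>G - {g}. c h \<odot> h s)"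
      using s by (intro finsum_cong') (auto simp: G)
    moreover have "(\<Oplus>h\<in>G - {g}. c h \<odot> h s) \<in> carrier A"
      using s by (intro finsum_closed) (auto simp: G)
    ultimately show ?thesis
      using step.hyps s c by (simp add: split G a_assoc)
  qed
  then show ?case by blast
qed

end

text \<open>
  Expressing the values of the multilinear monomials by finitely many functions \<open>G\<close> gives each
  multilinear element \<open>card G\<close> linear coordinates, and an element with zero coordinates is an identity.
\<close>

lemma codim_le:
  assumes n: "n \<ge> 1" and G: "finite G" "\<And>g s. g \<in> G \<Longrightarrow> admissible A s \<Longrightarrow> g s \<in> carrier A"
    and spanned: "\<And>w u \<sigma>. \<lbrakk>\<sigma> permutes {..<n}; \<forall>i<n. u i \<in> {Y i, Z i}\<rbrakk> \<Longrightarrow>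
      spanned {s. admissible A s} G (\<lambda>s. eval_monom A s (w 0, map (\<lambda>j. (u (\<sigma> j), w (Suc j))) [0..<n]))"
  shows "codim \<B> A n \<le> enat (card G)"
proof -
  define M :: "'w wmonom set" where "M = {(w 0, map (\<lambda>j. (u (\<sigma> j), w (Suc j))) [0..<n]) | w u \<sigma>.
      \<sigma> permutes {..<n} \<and> (\<forall>j\<le>n. w j \<in> \<B>) \<and> (\<forall>i<n. u i \<in> {Y i, Z i})}"
  have gens: "multilinear \<B> n = pspan ((\<lambda>m. Poly_Mapping.single m 1) ` M)"
    unfolding multilinear_def M_def by (rule arg_cong[of _ _ pspan]) blast
  have "\<forall>m\<in>M. \<exists>c. \<forall>s. admissible A s \<longrightarrow> eval_monom A s m = (\<Oplus>g\<in>G. c g \<odot> g s)"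
  proof
    fix m assume "m \<in> M"
    then have "spanned {s. admissible A s} G (\<lambda>s. eval_monom A s m)"
      unfolding M_def using spanned by auto
    with spanned_finsum[OF _ G(1) this] G(2)
    show "\<exists>c. \<forall>s. admissible A s \<longrightarrow> eval_monom A s m = (\<Oplus>g\<in>G. c g \<odot> g s)" by simp
  qed
  from bchoice[OF this] obtain c where
    c: "\<And>m s. m \<in> M \<Longrightarrow> admissible A s \<Longrightarrow> eval_monom A s m = (\<Oplus>g\<in>G. c m g \<odot> g s)"
    by blast
  define f where "f p g = (\<Sum>m\<in>Poly_Mapping.keys p. Poly_Mapping.lookup p m * c m g)" for p g
  have f_superset: "f p g = (\<Sum>m\<in>K. Poly_Mapping.lookup p m * c m g)"
    if "finite K" "Poly_Mapping.keys p \<subseteq> K" for p g K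
    unfolding f_def using that by (intro sum.mono_neutral_left) (auto simp: in_keys_iff)
  have f_add: "f (p + q) g = f p g + f q g" for p q g
  proof -
    let ?K = "Poly_Mapping.keys p \<union> Poly_Mapping.keys q"
    have "f (p + q) g = (\<Sum>m\<in>?K. Poly_Mapping.lookup (p + q) m * c m g)"
      using keys_add[of p q] by (intro f_superset) auto
    also have "\<dots> = f p g + f q g"
      by (subst (1 2) f_superset[of ?K]) (auto simp: lookup_add algebra_simps sum.distrib)
    finally show ?thesis .
  qed
  have f_scale: "f (pscale a p) g = a * f p g" for a p g
  proof -
    have "f (pscale a p) g = (\<Sum>m\<in>Poly_Mapping.keys p. Poly_Mapping.lookup (pscale a p) m * c m g)"
      by (intro f_superset) (auto simp: in_keys_iff)
    then show ?thesis by (simp add: f_def sum_distrib_left mult.assoc)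
  qed
  have eval: "eval_poly A s p = (\<Oplus>g\<in>G. f p g \<odot> g s)" if p: "p \<in> multilinear \<B> n" and s: "admissible A s" for p s
  proof -
    have G': "(\<lambda>g. a g \<odot> g s) \<in> G \<rightarrow> carrier A" for a using G s by auto
    let ?V = "{p. eval_poly A s p = (\<Oplus>g\<in>G. f p g \<odot> g s)}"
    have "(\<lambda>m. Poly_Mapping.single m 1) ` M \<subseteq> ?V"
    proof (rule image_subsetI)
      fix m assume "m \<in> M"
      have "eval_poly A s (Poly_Mapping.single m 1) = eval_monom A s m" using s by simp
      also have "\<dots> = (\<Oplus>g\<in>G. f (Poly_Mapping.single m 1) g \<odot> g s)"
        using c[OF \<open>m \<in> M\<close> s] by (simp add: f_def)
      finally show "Poly_Mapping.single m 1 \<in> ?V" by simp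
    qed
    moreover have "P.subspace ?V"
    proof (rule P.subspaceI)
      have "(\<Oplus>g\<in>G. f 0 g \<odot> g s) = \<zero>"
        by (rule add.finprod_one_eqI) (use G s in \<open>simp add: f_def\<close>)
      then show "0 \<in> ?V" by simp
      show "p + q \<in> ?V" if "p \<in> ?V" "q \<in> ?V" for p q
      proof -
        have "(\<Oplus>g\<in>G. f (p + q) g \<odot> g s) = (\<Oplus>g\<in>G. f p g \<odot> g s \<oplus> f q g \<odot> g s)"
          using G s by (intro finsum_cong') (auto simp: f_add)
        also have "\<dots> = (\<Oplus>g\<in>G. f p g \<odot> g s) \<oplus> (\<Oplus>g\<in>G. f q g \<odot> g s)"
          by (intro finsum_addf G')
        finally show ?thesis using that s by (simp add: eval_poly_add)
      qed
      show "pscale a p \<in> ?V" if "p \<in> ?V" for a p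
      proof -
        have "(\<Oplus>g\<in>G. f (pscale a p) g \<odot> g s) = (\<Oplus>g\<in>G. a \<odot> (f p g \<odot> g s))"
          using G s by (intro finsum_cong') (auto simp: f_scale smult_smult)
        also have "\<dots> = a \<odot> (\<Oplus>g\<in>G. f p g \<odot> g s)"
          using G(1) G' by (intro finsum_smult_ldistr[symmetric]) auto
        finally show ?thesis using that s by (simp add: eval_poly_pscale)
      qed
    qed
    ultimately have "multilinear \<B> n \<subseteq> ?V" unfolding gens by (rule P.span_minimal)
    then show ?thesis using p by blast
  qed
  show ?thesis unfolding codim_def
  proof (rule P.quotient_dim_le[where g = f])
    show "P.subspace (multilinear \<B> n)" by (rule subspace_multilinear)
    then show "P.subspace (multilinear \<B> n \<inter> W_Id \<B> A)" by (rule P.subspace_inter[OF _ subspace_W_Id])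
    show "p \<in> multilinear \<B> n \<inter> W_Id \<B> A" if "p \<in> multilinear \<B> n" "\<forall>g\<in>G. f p g = 0" for p
    proof -
      have "eval_poly A s p = \<zero>" if "admissible A s" for s
        unfolding eval[OF \<open>p \<in> multilinear \<B> n\<close> that]
        by (rule add.finprod_one_eqI) (use G \<open>\<forall>g\<in>G. f p g = 0\<close> that in auto)
      then show ?thesis using that multilinear_subset_free[OF n] by (auto simp: W_Id_def)
    qed
  qed (simp_all only: G f_add f_scale Int_lower1)
qed

end

section \<open>Even elements acting on odd ones\<close>

text \<open>
  The three ways in which an even element \<open>x\<close> acts on an odd element \<open>z\<close>: \<open>x z\<close>, \<open>z x\<close> and the
  commutator \<open>x z - z x\<close>.
\<close>

datatype side = Lft | Rgt | Dif

lemma swap_invariant: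
  assumes "mset xs = mset ys" "set xs \<subseteq> S"
    and "\<And>us x y vs. set (us @ x # y # vs) \<subseteq> S \<Longrightarrow> f (us @ x # y # vs) = f (us @ y # x # vs)"
  shows "f xs = f ys"
  using assms
proof (induction xs arbitrary: ys f)
  case (Cons x xs)
  then have "x \<in> set ys" by (metis list.set_intros(1) set_mset_mset)
  then obtain us vs where ys: "ys = us @ x # vs" by (auto simp: in_set_conv_decomp)
  have "set ys \<subseteq> S" using Cons.prems by (metis set_mset_mset)
  then have "f (us @ x # vs) = f (x # us @ vs)"
    unfolding ys
  proof (induction us arbitrary: vs rule: rev_induct)
    case (snoc u us)
    then show ?case using Cons.prems(3)[of us u x vs] by simp
  qed simp
  moreover have "f (x # xs) = f (x # us @ vs)"
  proof (rule Cons.IH[where f = "\<lambda>zs. f (x # zs)"])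
    show "f (x # ts @ u # v # ws) = f (x # ts @ v # u # ws)" if "set (ts @ u # v # ws) \<subseteq> S" for ts u v ws
      using Cons.prems(3)[of "x # ts" u v ws] Cons.prems(2) that by simp
  qed (use Cons.prems ys in auto)
  ultimately show ?case by (simp add: ys)
qed simp

context graded_W_algebra
begin

definition act :: "side \<times> 'a \<Rightarrow> 'a \<Rightarrow> 'a"
  where "act p z = (case fst p of Lft \<Rightarrow> snd p \<otimes> z | Rgt \<Rightarrow> z \<otimes> snd p
    | Dif \<Rightarrow> snd p \<otimes> z \<oplus> (- 1) \<odot> (z \<otimes> snd p))"

abbreviation acts :: "(side \<times> 'a) list \<Rightarrow> 'a \<Rightarrow> 'a"
  where "acts ps z \<equiv> foldr act ps z"

text \<open>
  The algebras have no unit, so the empty product is a dummy.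
\<close>

fun mprod :: "'a list \<Rightarrow> 'a" where
  "mprod [] = \<zero>"
| "mprod [x] = x"
| "mprod (x # xs) = x \<otimes> mprod xs"

lemma mprod_Cons: "xs \<noteq> [] \<Longrightarrow> mprod (x # xs) = x \<otimes> mprod xs"
  by (cases xs) auto

lemma homog_mult_even [simp]: "x \<in> homog A 0 \<Longrightarrow> y \<in> homog A g \<Longrightarrow> x \<otimes> y \<in> homog A g"
  using homog_mult[of x 0 y g] unfolding add_0_left by blast

lemma homog_mult_even' [simp]: "x \<in> homog A g \<Longrightarrow> y \<in> homog A 0 \<Longrightarrow> x \<otimes> y \<in> homog A g"
  using homog_mult[of x g y 0] unfolding add_0_right by blast

lemma mprod_even [simp]: "set xs \<subseteq> homog A 0 \<Longrightarrow> mprod xs \<in> homog A 0"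
  by (induction xs rule: mprod.induct) auto

end

context triangular_W_algebra
begin

lemma even_left_commute:
  "\<lbrakk>x \<in> homog A 0; y \<in> homog A 0; z \<in> carrier A\<rbrakk> \<Longrightarrow> x \<otimes> (y \<otimes> z) = y \<otimes> (x \<otimes> z)"
  by (metis even_commute homog_closed mult_assoc)

lemma mprod_swap: "set (us @ x # y # vs) \<subseteq> homog A 0 \<Longrightarrow> mprod (us @ x # y # vs) = mprod (us @ y # x # vs)"
proof (induction us)
  case Nil
  then have xy: "x \<in> homog A 0" "y \<in> homog A 0" "set vs \<subseteq> homog A 0" by simp_all
  then show ?case
    using even_commute[OF xy(1,2)] even_left_commute[OF xy(1,2) homog_closed[OF mprod_even[OF xy(3)]]]
    by (cases "vs = []") (simp_all add: mprod_Cons)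
qed (simp add: mprod_Cons)

text \<open>
  Even elements commute, so the order of the factors is irrelevant.
\<close>

lemma mprod_mset_cong:
  assumes "mset xs = mset ys" "set xs \<subseteq> homog A 0"
  shows "mprod xs = mprod ys"
  using assms mprod_swap by (rule swap_invariant)

lemma act_closed [simp]: "snd p \<in> homog A 0 \<Longrightarrow> z \<in> homog A 1 \<Longrightarrow> act p z \<in> homog A 1"
  by (auto simp: act_def split: side.splits)

lemma acts_closed [simp]: "\<forall>p\<in>set ps. snd p \<in> homog A 0 \<Longrightarrow> z \<in> homog A 1 \<Longrightarrow> acts ps z \<in> homog A 1"
  by (induction ps) auto

lemma act_commute:
  assumes "snd p \<in> homog A 0" "snd q \<in> homog A 0" "z \<in> homog A 1"
  shows "act p (act q z) = act q (act p z)"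
proof -
  obtain k x l y where pq: "p = (k, x)" "q = (l, y)" by (cases p, cases q) auto
  have h: "x \<in> homog A 0" "y \<in> homog A 0" using assms pq by auto
  then have c: "x \<in> carrier A" "y \<in> carrier A" "z \<in> carrier A" using assms by auto
  have swap: "x \<otimes> (y \<otimes> z) = y \<otimes> (x \<otimes> z)" "x \<otimes> y = y \<otimes> x"
    using even_left_commute[OF h c(3)] even_commute[OF h] by auto
  show ?thesis
    unfolding pq using c
    by (cases k; cases l)
      (simp_all add: act_def mult_assoc swap mult_add_left mult_add_right mult_smult_left mult_smult_right
        smult_add smult_smult a_ac)
qed

lemma act_zero: "snd p \<in> homog A 0 \<Longrightarrow> act p \<zero> = \<zero>"
  by (cases "fst p") (simp_all add: act_def)

lemma acts_zero: "\<forall>p\<in>set ps. snd p \<in> homog A 0 \<Longrightarrow> acts ps \<zero> = \<zero>"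
  by (induction ps) (auto simp: act_zero)

lemma acts_act:
  assumes "\<forall>p\<in>set ps. snd p \<in> homog A 0" "snd q \<in> homog A 0" "z \<in> homog A 1"
  shows "acts ps (act q z) = act q (acts ps z)"
  using assms by (induction ps) (auto simp: act_commute)

text \<open>
  All three kinds of actions commute with each other, since left and right multiplications do.
\<close>

lemma acts_mset_cong:
  assumes "mset ps = mset qs" "\<forall>p\<in>set ps. snd p \<in> homog A 0" "z \<in> homog A 1"
  shows "acts ps z = acts qs z"
proof (rule swap_invariant[OF assms(1), where S = "{p. snd p \<in> homog A 0}" and f = "\<lambda>ps. acts ps z"])
  fix us vs :: "(side \<times> 'a) list" and p q assume "set (us @ p # q # vs) \<subseteq> {p. snd p \<in> homog A 0}"
  then have h: "snd p \<in> homog A 0" "snd q \<in> homog A 0" "\<forall>r\<in>set vs. snd r \<in> homog A 0" by auto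
  show "acts (us @ p # q # vs) z = acts (us @ q # p # vs) z"
    using act_commute[OF h(1,2) acts_closed[OF h(3) assms(3)]] by simp
qed (use assms(2) in auto)

lemma act_Lft: "x \<in> homog A 0 \<Longrightarrow> z \<in> homog A 1 \<Longrightarrow> act (Lft, x) z = act (Rgt, x) z \<oplus> act (Dif, x) z"
proof -
  assume h: "x \<in> homog A 0" "z \<in> homog A 1"
  have "z \<otimes> x \<oplus> (x \<otimes> z \<oplus> (- 1) \<odot> (z \<otimes> x)) = x \<otimes> z \<oplus> (1 + - 1) \<odot> (z \<otimes> x)"
    using h by (subst smult_add') (auto simp: a_ac)
  then show ?thesis using h by (simp add: act_def)
qed

section \<open>Values of words\<close>

abbreviation odd_letters :: "(gvar \<times> 'w) list \<Rightarrow> (gvar \<times> 'w) list"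
  where "odd_letters us \<equiv> filter (\<lambda>p. vdeg (fst p) = 1) us"

lemma even_letters:
  assumes "odd_letters us = []" "admissible A s"
  shows "\<forall>p\<in>set us. s (fst p) \<in> homog A 0"
proof
  fix p assume "p \<in> set us"
  then have "vdeg (fst p) = 0" using assms(1) by (auto simp: filter_empty_conv)
  then show "s (fst p) \<in> homog A 0" using assms(2) by metis
qed

text \<open>
  All coefficients of a word without odd variables can be moved to the front; their product \<open>w\<close> does not
  depend on the values of the variables.
\<close>

lemma eval_even_word:
  assumes "odd_letters us = []" "us \<noteq> []"
  shows "\<exists>w. \<forall>s. admissible A s \<longrightarrow> eval_word A s us = lact A w (mprod (map (\<lambda>p. s (fst p)) us))"
  using assms
proof (induction us)
  case (Cons a us)
  obtain u v where a: "a = (u, v)" by (cases a)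
  have u: "vdeg u = 0" using Cons.prems a by (auto split: if_splits)
  have u0: "s u \<in> homog A 0" if "admissible A s" for s using that u by metis
  show ?case
  proof (cases "us = []")
    case True
    then show ?thesis using u0 a by (auto intro!: exI[of _ v] simp: ract_even)
  next
    case False
    have us: "odd_letters us = []" using Cons.prems by (simp split: if_splits)
    then obtain w where w: "\<And>s. admissible A s \<Longrightarrow> eval_word A s us = lact A w (mprod (map (\<lambda>p. s (fst p)) us))"
      using Cons.IH False by blast
    have "eval_word A s (a # us) = lact A (v * w) (mprod (map (\<lambda>p. s (fst p)) (a # us)))" if s: "admissible A s" for s
    proof -
      let ?x = "s u" and ?P = "mprod (map (\<lambda>p. s (fst p)) us)"
      have "\<forall>p\<in>set us. s (fst p) \<in> homog A 0" by (rule even_letters) (use us s in simp_all)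
      then have P: "?P \<in> homog A 0" by (intro mprod_even) auto
      have x: "?x \<in> homog A 0" using u0 s by blast
      have "eval_word A s (a # us) = lact A v ?x \<otimes> lact A w ?P"
        using False a x by (simp add: eval_word_Cons ract_even w[OF s])
      also have "\<dots> = lact A v (?x \<otimes> lact A w ?P)" using x P by (simp add: lact_mult)
      also have "?x \<otimes> lact A w ?P = lact A w (?x \<otimes> ?P)"
        using x P by (simp add: ract_even lact_mult flip: ract_mult_lact)
      finally show ?thesis using x P False a by (simp add: lact_times mprod_Cons)
    qed
    then show ?thesis by blast
  qed
qed simp

text \<open>
  Next to an odd element, the coefficients of a word become scalars.
\<close>

lemma odd_mult_even_word:
  assumes "odd_letters us = []" "us \<noteq> []"
  shows "\<exists>c. \<forall>s z. admissible A s \<and> z \<in> homog A 1 \<longrightarrow>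
    z \<otimes> eval_word A s us = c \<odot> acts (map (\<lambda>p. (Rgt, s (fst p))) us) z"
  using assms
proof (induction us)
  case (Cons a us)
  obtain u v where a: "a = (u, v)" by (cases a)
  have u: "vdeg u = 0" using Cons.prems a by (auto split: if_splits)
  have u0: "s u \<in> homog A 0" if "admissible A s" for s using that u by metis
  have move: "z \<otimes> ract A (s u) v = \<beta> v \<odot> (z \<otimes> s u)" if "admissible A s" "z \<in> homog A 1" for s z
    using u0[OF that(1)] that(2) by (simp add: ract_even ract_odd mult_smult_left flip: ract_mult_lact)
  show ?case
  proof (cases "us = []")
    case True
    then show ?thesis using move a by (auto intro!: exI[of _ "\<beta> v"] simp: act_def)
  next
    case False
    have us: "odd_letters us = []" using Cons.prems by (simp split: if_splits)
    then obtain c where c: "\<And>s z. admissible A s \<Longrightarrow> z \<in> homog A 1 \<Longrightarrow>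
        z \<otimes> eval_word A s us = c \<odot> acts (map (\<lambda>p. (Rgt, s (fst p))) us) z"
      using Cons.IH False by blast
    have "z \<otimes> eval_word A s (a # us) = (\<beta> v * c) \<odot> acts (map (\<lambda>p. (Rgt, s (fst p))) (a # us)) z"
      if s: "admissible A s" and z: "z \<in> homog A 1" for s z
    proof -
      have "\<forall>p\<in>set us. s (fst p) \<in> homog A 0" by (rule even_letters) (use us s in simp_all)
      then have even: "\<forall>p\<in>set (map (\<lambda>p. (Rgt, s (fst p))) us). snd p \<in> homog A 0" by auto
      have x: "s u \<in> homog A 0" using u0 s by blast
      have "z \<otimes> eval_word A s (a # us) = (z \<otimes> ract A (s u) v) \<otimes> eval_word A s us"
        using False a z x s by (simp add: eval_word_Cons mult_assoc)
      also have "\<dots> = \<beta> v \<odot> ((z \<otimes> s u) \<otimes> eval_word A s us)"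
        using x z s by (simp add: move mult_smult_left)
      also have "(z \<otimes> s u) \<otimes> eval_word A s us = c \<odot> acts (map (\<lambda>p. (Rgt, s (fst p))) us) (act (Rgt, s u) z)"
        using x z by (subst c[OF s]) (auto simp: act_def)
      also have "acts (map (\<lambda>p. (Rgt, s (fst p))) us) (act (Rgt, s u) z)
          = act (Rgt, s u) (acts (map (\<lambda>p. (Rgt, s (fst p))) us) z)"
        using even x z by (intro acts_act) auto
      finally show ?thesis
        using a homog_closed[OF act_closed[OF _ acts_closed[OF even z], of "(Rgt, s u)"]] x by (simp add: smult_smult)
    qed
    then show ?thesis by blast
  qed
qed simp

lemma eval_odd_word:
  assumes "odd_letters us = []" "odd_letters vs = []" "vdeg u = 1"
  shows "\<exists>c. \<forall>s. admissible A s \<longrightarrow> eval_word A s (us @ (u, v) # vs)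
    = c \<odot> acts (map (\<lambda>p. (Lft, s (fst p))) us @ map (\<lambda>p. (Rgt, s (fst p))) vs) (s u)"
  using assms(1)
proof (induction us)
  case Nil
  have u1: "s u \<in> homog A 1" if "admissible A s" for s using that assms(3) by metis
  show ?case
  proof (cases "vs = []")
    case True
    then show ?thesis using u1 by (auto intro!: exI[of _ "\<beta> v"] simp: ract_odd)
  next
    case False
    obtain c where c: "\<And>s z. admissible A s \<Longrightarrow> z \<in> homog A 1 \<Longrightarrow>
        z \<otimes> eval_word A s vs = c \<odot> acts (map (\<lambda>p. (Rgt, s (fst p))) vs) z"
      using odd_mult_even_word[OF assms(2) False] by blast
    have "eval_word A s ((u, v) # vs) = (\<beta> v * c) \<odot> acts (map (\<lambda>p. (Rgt, s (fst p))) vs) (s u)"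
      if s: "admissible A s" for s
    proof -
      have "\<forall>p\<in>set vs. s (fst p) \<in> homog A 0" by (rule even_letters) (use assms(2) s in simp_all)
      then have "acts (map (\<lambda>p. (Rgt, s (fst p))) vs) (s u) \<in> homog A 1" using u1[OF s] by (intro acts_closed) auto
      then show ?thesis using False u1[OF s] s c[OF s u1[OF s]]
        by (simp add: eval_word_Cons ract_odd mult_smult_left smult_smult)
    qed
    then show ?thesis by auto
  qed
next
  case (Cons a us)
  obtain x w where a: "a = (x, w)" by (cases a)
  have x: "vdeg x = 0" using Cons.prems a by (auto split: if_splits)
  have us: "odd_letters us = []" using Cons.prems by (simp split: if_splits)
  then obtain c where c: "\<And>s. admissible A s \<Longrightarrow> eval_word A s (us @ (u, v) # vs)
      = c \<odot> acts (map (\<lambda>p. (Lft, s (fst p))) us @ map (\<lambda>p. (Rgt, s (fst p))) vs) (s u)"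
    using Cons.IH by blast
  have "eval_word A s ((a # us) @ (u, v) # vs)
      = (\<alpha> w * c) \<odot> acts (map (\<lambda>p. (Lft, s (fst p))) (a # us) @ map (\<lambda>p. (Rgt, s (fst p))) vs) (s u)"
    if s: "admissible A s" for s
  proof -
    let ?z = "acts (map (\<lambda>p. (Lft, s (fst p))) us @ map (\<lambda>p. (Rgt, s (fst p))) vs) (s u)"
    have "s (fst p) \<in> homog A 0" if "p \<in> set (us @ vs)" for p
    proof -
      have "vdeg (fst p) = 0" using assms(2) us that by (auto simp: filter_empty_conv)
      then show ?thesis using s by metis
    qed
    then have "\<forall>p\<in>set us. s (fst p) \<in> homog A 0" "\<forall>p\<in>set vs. s (fst p) \<in> homog A 0" by simp_all
    moreover have "s u \<in> homog A 1" using s assms(3) by metis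
    ultimately have z: "?z \<in> homog A 1" by (intro acts_closed) auto
    have x0: "s x \<in> homog A 0" using s x by metis
    have "eval_word A s ((a # us) @ (u, v) # vs) = lact A w (s x) \<otimes> (c \<odot> ?z)"
      using x0 by (simp add: eval_word_Cons a ract_even c[OF s])
    also have "\<dots> = c \<odot> lact A w (s x \<otimes> ?z)"
      using x0 z by (simp add: mult_smult_right lact_mult)
    also have "lact A w (s x \<otimes> ?z) = \<alpha> w \<odot> (s x \<otimes> ?z)" using x0 z by (simp add: lact_odd)
    finally show ?thesis using x0 z by (simp add: a act_def smult_smult mult.commute)
  qed
  then show ?case by blast
qed

text \<open>
  Two odd variables make a word vanish, also if even variables stand between them, because even
  multiples of odd elements are odd.
\<close>

lemma eval_word_two_odd:
  assumes "admissible A s"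
  shows "(length (odd_letters us) = 1 \<longrightarrow> eval_word A s us \<in> homog A 1)
    \<and> (length (odd_letters us) \<ge> 2 \<longrightarrow> eval_word A s us = \<zero>)"
proof (induction us)
  case (Cons a us)
  obtain u v where a: "a = (u, v)" by (cases a)
  have u: "s u \<in> homog A (vdeg u)" using assms by blast
  have "eval_word A s us \<in> carrier A" using assms by simp
  show ?case
  proof (cases u)
    case (Y i)
    then have "s u \<in> homog A 0" using u by simp
    then have "ract A (s u) v \<otimes> z \<in> homog A 1" if "z \<in> homog A 1" for z
      using that by (simp add: ract_even lact_odd flip: lact_mult)
    moreover have "ract A (s u) v \<in> carrier A" using u by simp
    ultimately show ?thesis using Cons a Y by (cases "us = []") (simp_all add: eval_word_Cons)
  next
    case (Z i)
    then have z: "ract A (s u) v \<in> homog A 1" using u by (simp add: ract_odd)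
    show ?thesis
    proof (intro conjI impI)
      assume "length (odd_letters (a # us)) = 1"
      then have "odd_letters us = []" using a Z by simp
      show "eval_word A s (a # us) \<in> homog A 1"
      proof (cases "us = []")
        case False
        obtain c where c: "ract A (s u) v \<otimes> eval_word A s us = c \<odot> acts (map (\<lambda>p. (Rgt, s (fst p))) us) (ract A (s u) v)"
          using odd_mult_even_word[OF \<open>odd_letters us = []\<close> False] assms z by blast
        have "\<forall>p\<in>set us. s (fst p) \<in> homog A 0" by (rule even_letters) (use \<open>odd_letters us = []\<close> assms in simp_all)
        then have "acts (map (\<lambda>p. (Rgt, s (fst p))) us) (ract A (s u) v) \<in> homog A 1"
          using z by (intro acts_closed) auto
        then show ?thesis using False a c by (simp add: eval_word_Cons)
      qed (use a z in simp)
    next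
      assume "length (odd_letters (a # us)) \<ge> 2"
      then have "length (odd_letters us) \<ge> 1" using a Z by simp
      then have "eval_word A s us \<in> homog A 1" "us \<noteq> []"
        using Cons by (cases "length (odd_letters us) = 1"; auto)+
      then show "eval_word A s (a # us) = \<zero>" using z a odd_odd by (simp add: eval_word_Cons)
    qed
  qed
qed simp

end

section \<open>Upper bounds for codimensions\<close>

fun gidx :: "gvar \<Rightarrow> nat" where
  "gidx (Y i) = i"
| "gidx (Z i) = i"

lemma no_odd_letters: "filter (\<lambda>p. vdeg (fst p) = 1) us = [] \<Longrightarrow> p \<in> set us \<Longrightarrow> fst p = Y (gidx (fst p))"
  by (cases "fst p") (auto simp: filter_empty_conv)

context triangular_W_algebra
begin

text \<open>
  The spanning functions. In \<open>odd_value n i \<kappa>\<close> the even variable \<open>y\<^sub>j\<close>, for \<open>j \<noteq> i\<close>, acts on \<open>z\<^sub>i\<close> in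
  the way given by \<open>\<kappa> j\<close>.
\<close>

definition even_value :: "nat \<Rightarrow> 'w \<Rightarrow> (gvar \<Rightarrow> 'a) \<Rightarrow> 'a"
  where "even_value n e s = lact A e (mprod (map (\<lambda>j. s (Y j)) [0..<n]))"

definition odd_value :: "nat \<Rightarrow> nat \<Rightarrow> (nat \<Rightarrow> side) \<Rightarrow> (gvar \<Rightarrow> 'a) \<Rightarrow> 'a"
  where "odd_value n i \<kappa> s = acts (map (\<lambda>j. (\<kappa> j, s (Y j))) (filter (\<lambda>j. j \<noteq> i) [0..<n])) (s (Z i))"

lemma admissible_even: "admissible A s \<Longrightarrow> s (Y j) \<in> homog A 0"
  by (metis vdeg.simps(1))

lemma admissible_odd: "admissible A s \<Longrightarrow> s (Z j) \<in> homog A 1"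
  by (metis vdeg.simps(2))

lemma mprod_admissible: "admissible A s \<Longrightarrow> mprod (map (\<lambda>j. s (Y j)) js) \<in> homog A 0"
  using admissible_even by (intro mprod_even) auto

lemma even_value_closed [simp]: "admissible A s \<Longrightarrow> even_value n e s \<in> carrier A"
  unfolding even_value_def by (intro lact_closed homog_closed[OF mprod_admissible])

lemma odd_value_odd [simp]: "admissible A s \<Longrightarrow> odd_value n i \<kappa> s \<in> homog A 1"
  unfolding odd_value_def using admissible_even admissible_odd by (intro acts_closed) auto

lemma odd_value_cong: "(\<And>j. j < n \<Longrightarrow> \<kappa> j = \<kappa>' j) \<Longrightarrow> odd_value n i \<kappa> s = odd_value n i \<kappa>' s"
  unfolding odd_value_def by (intro arg_cong2[of _ _ _ _ "foldr act"] map_cong arg_cong2[of _ _ _ _ acts]) auto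

text \<open>
  A multilinear monomial with one odd variable \<open>z\<^sub>i\<close> is, up to a scalar, the function \<open>odd_value n i \<kappa>\<close>
  where \<open>\<kappa>\<close> records which variables stand to the left of \<open>z\<^sub>i\<close>. Without odd variable it is
  \<open>w y\<^sub>1 \<dots> y\<^sub>n\<close>, and \<open>w\<close> acts on even elements as a combination of \<open>e1\<close> and \<open>e2\<close>.
\<close>

lemma multilinear_monom_spanned:
  assumes n: "n \<ge> 1" and \<sigma>: "\<sigma> permutes {..<n}" and u: "\<forall>i<n. u i \<in> {Y i, Z i}"
  shows "spanned {s. admissible A s}
    ({even_value n e1, even_value n e2} \<union> {odd_value n i \<kappa> | i \<kappa>. i < n \<and> (\<forall>j. \<kappa> j \<noteq> Dif)})
    (\<lambda>s. eval_monom A s (w 0, map (\<lambda>j. (u (\<sigma> j), w (Suc j))) [0..<n]))"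
    (is "spanned ?S ?G _")
proof -
  define us where "us = map (\<lambda>j. (u (\<sigma> j), w (Suc j))) [0..<n]"
  have closed: "\<forall>g\<in>?G. \<forall>s\<in>?S. g s \<in> carrier A"
    using homog_closed[OF odd_value_odd] by auto
  have \<sigma>_lt: "\<sigma> j < n" if "j < n" for j using permutes_in_image[OF \<sigma>, of j] that by simp
  have idx: "map (\<lambda>p. gidx (fst p)) us = map \<sigma> [0..<n]"
    unfolding us_def using u \<sigma>_lt by (fastforce intro: map_cong)
  have inj: "inj_on \<sigma> {0..<n}" using permutes_inj_on[OF \<sigma>] .
  have mset_\<sigma>: "mset (map \<sigma> [0..<n]) = mset [0..<n]"
  proof (subst set_eq_iff_mset_eq_distinct[symmetric])
    show "set (map \<sigma> [0..<n]) = set [0..<n]" using permutes_image[OF \<sigma>] by (simp add: lessThan_atLeast0)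
  qed (use inj in \<open>simp_all add: distinct_map\<close>)
  have us_ne: "us \<noteq> []" using n by (simp add: us_def)
  consider "odd_letters us = []" | "length (odd_letters us) \<ge> 2" | "length (odd_letters us) = 1"
    by (metis One_nat_def length_0_conv less_2_cases not_le)
  then have "spanned ?S ?G (\<lambda>s. lact A (w 0) (eval_word A s us))"
  proof cases
    case 1
    obtain w' where w': "\<forall>s. admissible A s \<longrightarrow> eval_word A s us = lact A w' (mprod (map (\<lambda>p. s (fst p)) us))"
      using eval_even_word[OF 1 us_ne] by blast
    have val: "lact A (w 0) (eval_word A s us)
        = \<alpha> (w 0 * w') \<odot> even_value n e1 s \<oplus> \<beta> (w 0 * w') \<odot> even_value n e2 s" if s: "admissible A s" for s
    proof -
      have "map (\<lambda>p. s (fst p)) us = map (\<lambda>j. s (Y j)) (map (\<lambda>p. gidx (fst p)) us)"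
        unfolding map_map by (rule map_cong[OF refl]) (metis comp_apply no_odd_letters[OF 1])
      then have "mset (map (\<lambda>p. s (fst p)) us) = image_mset (\<lambda>j. s (Y j)) (mset (map \<sigma> [0..<n]))"
        by (simp only: idx mset_map)
      also have "\<dots> = mset (map (\<lambda>j. s (Y j)) [0..<n])" unfolding mset_\<sigma> by (rule mset_map[symmetric])
      finally have "mprod (map (\<lambda>p. s (fst p)) us) = mprod (map (\<lambda>j. s (Y j)) [0..<n])"
        by (intro mprod_mset_cong[symmetric]) (use admissible_even[OF s] in auto)
      then show ?thesis
        using s w' mprod_admissible[OF s, of "[0..<n]"]
        by (simp add: even_value_def flip: lact_times lact_even)
    qed
    show ?thesis
    proof (rule spanned_add[OF closed])
      show "spanned ?S ?G (\<lambda>s. \<alpha> (w 0 * w') \<odot> even_value n e1 s)"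
        by (rule spanned_smult[OF closed spanned_base[OF closed]]) auto
      show "spanned ?S ?G (\<lambda>s. \<beta> (w 0 * w') \<odot> even_value n e2 s)"
        by (rule spanned_smult[OF closed spanned_base[OF closed]]) auto
    qed (use val in auto)
  next
    case 2
    then show ?thesis
      using eval_word_two_odd by (intro spanned.zero) auto
  next
    case 3
    then obtain p where "odd_letters us = p # []" by (auto simp: length_Suc_conv)
    then obtain as bs where split: "us = as @ p # bs" "\<forall>u\<in>set as. vdeg (fst u) \<noteq> 1" "vdeg (fst p) = 1"
        "[] = odd_letters bs"
      unfolding filter_eq_Cons_iff by blast
    have "odd_letters as = []" unfolding filter_empty_conv by (rule split(2))
    note ab = split(1) this split(3) split(4)[symmetric]
    obtain c where c: "\<forall>s. admissible A s \<longrightarrow> eval_word A s us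
        = c \<odot> acts (map (\<lambda>p. (Lft, s (fst p))) as @ map (\<lambda>p. (Rgt, s (fst p))) bs) (s (fst p))"
      using eval_odd_word[OF ab(2,4,3), of "snd p"] by (auto simp: ab(1))
    define i ia ib where "i = gidx (fst p)" "ia = map (\<lambda>p. gidx (fst p)) as" "ib = map (\<lambda>p. gidx (fst p)) bs"
    note idefs = this
    have mset_i: "mset (ia @ i # ib) = mset [0..<n]"
      using idx mset_\<sigma> by (simp add: idefs ab(1))
    then have set_i: "set (ia @ i # ib) = {0..<n}" by (metis set_mset_mset set_upt)
    have dist: "distinct (ia @ i # ib)" using mset_i by (metis distinct_upt mset_eq_imp_distinct_iff)
    have "i < n" using set_i by auto
    define \<kappa> where "\<kappa> j = (if j \<in> set ia then Lft else Rgt)" for j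
    have "mset (ia @ ib) = mset (filter (\<lambda>j. j \<noteq> i) [0..<n])"
      using dist set_i by (subst set_eq_iff_mset_eq_distinct[symmetric]) auto
    then have mset_\<kappa>: "mset (map (\<lambda>j. (\<kappa> j, s (Y j))) (ia @ ib)) = mset (map (\<lambda>j. (\<kappa> j, s (Y j))) (filter (\<lambda>j. j \<noteq> i) [0..<n]))" for s :: "gvar \<Rightarrow> 'a"
      by (simp only: mset_map)
    have val: "lact A (w 0) (eval_word A s us) = (\<alpha> (w 0) * c) \<odot> odd_value n i \<kappa> s" if s: "admissible A s" for s
    proof -
      have "map (\<lambda>p. (Lft, s (fst p))) as = map (\<lambda>j. (\<kappa> j, s (Y j))) ia"
        unfolding idefs(2) map_map
        by (rule map_cong[OF refl]) (simp add: \<kappa>_def idefs(2) flip: no_odd_letters[OF ab(2)])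
      moreover have "map (\<lambda>p. (Rgt, s (fst p))) bs = map (\<lambda>j. (\<kappa> j, s (Y j))) ib"
      proof -
        have "\<kappa> j = Rgt" if "j \<in> set ib" for j using dist that by (auto simp: \<kappa>_def)
        then show ?thesis
          unfolding idefs(3) map_map
          by (intro map_cong[OF refl]) (simp flip: no_odd_letters[OF ab(4)])
      qed
      moreover have "fst p = Z i" using ab(3) by (cases "fst p") (auto simp: idefs)
      moreover have "acts (map (\<lambda>j. (\<kappa> j, s (Y j))) (ia @ ib)) (s (Z i)) = odd_value n i \<kappa> s"
        unfolding odd_value_def
        by (rule acts_mset_cong[OF mset_\<kappa>]) (use admissible_even[OF s] admissible_odd[OF s] in auto)
      ultimately have "eval_word A s us = c \<odot> odd_value n i \<kappa> s" using c s by simp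
      then show ?thesis
        using odd_value_odd[OF s] homog_closed[OF odd_value_odd[OF s]]
        by (simp add: lact_smult lact_odd smult_smult mult.commute)
    qed
    have "\<forall>j. \<kappa> j \<noteq> Dif" by (simp add: \<kappa>_def)
    then have "odd_value n i \<kappa> \<in> ?G" using \<open>i < n\<close> by blast
    then show ?thesis
      by (intro spanned_smult[OF closed spanned_base[OF closed]]) (use val in auto)
  qed
  then show ?thesis by (simp add: us_def)
qed

text \<open>
  If the functions with \<open>\<kappa>\<close> in a finite set \<open>K\<close> suffice, then they and the two functions without odd
  variable span.
\<close>

lemma codim_le_sides:
  assumes n: "n \<ge> 1" and K: "finite K"
    and spanned: "\<And>i \<kappa>. i < n \<Longrightarrow> \<forall>j. \<kappa> j \<noteq> Dif \<Longrightarrow> spanned {s. admissible A s} (odd_value n i ` K) (odd_value n i \<kappa>)"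
  shows "codim \<B> A n \<le> enat (2 + n * card K)"
proof -
  let ?S = "{s. admissible A s}"
  define G where "G = {even_value n e1, even_value n e2} \<union> (\<Union>i<n. odd_value n i ` K)"
  have fin: "finite G" using K by (simp add: G_def)
  have closed: "\<forall>g\<in>G. \<forall>s\<in>?S. g s \<in> carrier A"
    using homog_closed[OF odd_value_odd] by (auto simp: G_def)
  have "card (\<Union>i<n. odd_value n i ` K) \<le> (\<Sum>i<n. card (odd_value n i ` K))"
    by (rule card_UN_le) simp
  also have "\<dots> \<le> (\<Sum>i<n. card K)" by (intro sum_mono card_image_le K)
  finally have "card (\<Union>i<n. odd_value n i ` K) \<le> n * card K" by simp
  moreover have "card {even_value n e1, even_value n e2} \<le> 2" by (simp add: card_insert_if)
  moreover have "card G \<le> card {even_value n e1, even_value n e2} + card (\<Union>i<n. odd_value n i ` K)"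
    unfolding G_def by (rule card_Un_le)
  ultimately have "card G \<le> 2 + n * card K" by linarith
  moreover have "codim \<B> A n \<le> enat (card G)"
  proof (rule codim_le[OF n fin])
    show "g s \<in> carrier A" if "g \<in> G" "admissible A s" for g s using closed that by simp
    fix w u \<sigma> assume "\<sigma> permutes {..<n}" "\<forall>i<n. u i \<in> {Y i, Z i}"
    note multilinear_monom_spanned[OF n this]
    then show "spanned ?S G (\<lambda>s. eval_monom A s (w 0, map (\<lambda>j. (u (\<sigma> j), w (Suc j))) [0..<n]))"
    proof (rule spanned_trans[OF closed])
      fix h assume "h \<in> {even_value n e1, even_value n e2} \<union> {odd_value n i \<kappa> | i \<kappa>. i < n \<and> (\<forall>j. \<kappa> j \<noteq> Dif)}"
      then consider "h \<in> {even_value n e1, even_value n e2}" | i \<kappa> where "h = odd_value n i \<kappa>" "i < n" "\<forall>j. \<kappa> j \<noteq> Dif"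
        by blast
      then show "spanned ?S G h"
      proof cases
        case 1
        then have "h \<in> G" by (auto simp: G_def)
        then show ?thesis by (rule spanned_base[OF closed]) auto
      next
        case 2
        show ?thesis unfolding 2(1)
        proof (rule spanned_trans[OF closed spanned[OF 2(2,3)]])
          fix h assume "h \<in> odd_value n i ` K"
          then have "h \<in> G" using 2(2) by (auto simp: G_def)
          then show "spanned ?S G h" by (rule spanned_base[OF closed]) auto
        qed
      qed
    qed
  qed
  ultimately show ?thesis by (meson enat_ord_simps(1) order_trans)
qed

lemma codim_le_exponential:
  assumes n: "n \<ge> 1"
  shows "codim \<B> A n \<le> enat (2 + n * 2 ^ n)"
proof -
  define side_of :: "nat set \<Rightarrow> nat \<Rightarrow> side" where "side_of I j = (if j \<in> I then Lft else Rgt)" for I j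
  let ?K = "side_of ` Pow {..<n}"
  have closed: "\<forall>g\<in>odd_value n i ` ?K. \<forall>s\<in>{s. admissible A s}. g s \<in> carrier A" for i
    using homog_closed[OF odd_value_odd] by auto
  have "codim \<B> A n \<le> enat (2 + n * card ?K)"
  proof (rule codim_le_sides[OF n])
    fix i and \<kappa> :: "nat \<Rightarrow> side" assume \<kappa>: "\<forall>j. \<kappa> j \<noteq> Dif"
    define I where "I = {j. j < n \<and> \<kappa> j = Lft}"
    have "side_of I j = \<kappa> j" if "j < n" for j using \<kappa> that by (cases "\<kappa> j") (auto simp: side_of_def I_def)
    then have "odd_value n i \<kappa> = odd_value n i (side_of I)"
      by (intro ext odd_value_cong) simp
    moreover have "side_of I \<in> ?K" by (auto simp: I_def)
    ultimately show "spanned {s. admissible A s} (odd_value n i ` ?K) (odd_value n i \<kappa>)"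
      by (intro spanned_base[OF closed, of "odd_value n i \<kappa>"]) auto
  qed simp
  also have "card ?K \<le> 2 ^ n" using card_image_le[of "Pow {..<n}" side_of] by (simp add: card_Pow)
  then have "enat (2 + n * card ?K) \<le> enat (2 + n * 2 ^ n)" by simp
  finally show ?thesis .
qed

end

section \<open>A commutator identity forces polynomial growth\<close>

lemma UNIV_side: "UNIV = {Lft, Rgt, Dif}"
  by (auto intro: side.exhaust)

lemma card_UNIV_side: "card (UNIV :: side set) = 3"
  by (simp add: UNIV_side)

instance side :: finite
  by standard (simp add: UNIV_side)

context triangular_W_algebra
begin

text \<open>
  Odd elements vanish once even elements have acted at least \<open>k\<close> times in each of the three ways.
  Stating this for all longer sequences of actions makes it directly applicable to \<open>odd_value\<close>.
\<close>

definition commutator_identity :: "nat \<Rightarrow> bool"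
  where "commutator_identity k \<longleftrightarrow> (\<forall>ps z. (\<forall>p\<in>set ps. snd p \<in> homog A 0) \<and> z \<in> homog A 1
    \<and> (\<forall>x. length (filter (\<lambda>p. fst p = x) ps) \<ge> k) \<longrightarrow> acts ps z = \<zero>)"

text \<open>
  Exactly \<open>k\<close> actions of each kind, in a fixed order, are enough: additional ones are carried out first,
  and the order is irrelevant.
\<close>

lemma commutator_identityI:
  assumes "\<And>xs ys ds z. \<lbrakk>length xs = k; length ys = k; length ds = k;
      set (xs @ ys @ ds) \<subseteq> homog A 0; z \<in> homog A 1\<rbrakk>
    \<Longrightarrow> acts (map (Pair Lft) xs @ map (Pair Rgt) ys @ map (Pair Dif) ds) z = \<zero>"
  shows "commutator_identity k"
  unfolding commutator_identity_def
proof (intro allI impI, elim conjE)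
  fix ps :: "(side \<times> 'a) list" and z :: 'a
  assume even: "\<forall>p\<in>set ps. snd p \<in> homog A 0" and z: "z \<in> homog A 1"
    and len: "\<forall>x. k \<le> length (filter (\<lambda>p. fst p = x) ps)"
  define f where "f x = filter (\<lambda>p. fst p = x) ps" for x :: side
  define block where "block = take k (f Lft) @ take k (f Rgt) @ take k (f Dif)"
  define rest where "rest = drop k (f Lft) @ drop k (f Rgt) @ drop k (f Dif)"
  have take_drop: "mset (take k xs) + mset (drop k xs) = mset xs" for xs :: "(side \<times> 'a) list"
    by (metis append_take_drop_id mset_append)
  have "mset (block @ rest) = mset (f Lft) + mset (f Rgt) + mset (f Dif)"
  proof -
    have "mset (block @ rest) = (mset (take k (f Lft)) + mset (drop k (f Lft)))
        + (mset (take k (f Rgt)) + mset (drop k (f Rgt))) + (mset (take k (f Dif)) + mset (drop k (f Dif)))"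
      unfolding block_def rest_def mset_append by (simp only: ac_simps)
    then show ?thesis unfolding take_drop .
  qed
  also have "\<dots> = mset ps"
    unfolding f_def
  proof (induction ps)
    case (Cons p ps)
    then show ?case by (cases "fst p") auto
  qed simp
  finally have mset_eq: "mset ps = mset (block @ rest)" ..
  then have "set ps = set (block @ rest)" by (metis set_mset_mset)
  then have even': "\<forall>p\<in>set (block @ rest). snd p \<in> homog A 0" using even by simp
  have pair: "take k (f x) = map (Pair x) (map snd (take k (f x)))" for x
  proof -
    have "\<forall>p\<in>set (take k (f x)). fst p = x" unfolding f_def by (auto dest: in_set_takeD)
    then show ?thesis
      unfolding map_map by (intro map_idI[symmetric]) (auto simp: prod_eq_iff)
  qed
  have lens: "length (map snd (take k (f x))) = k" for x using len by (simp add: f_def)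
  have "acts ps z = acts block (acts rest z)"
    using acts_mset_cong[OF mset_eq even z] by simp
  also have "\<dots> = \<zero>"
  proof -
    have block: "block = map (Pair Lft) (map snd (take k (f Lft))) @ map (Pair Rgt) (map snd (take k (f Rgt)))
        @ map (Pair Dif) (map snd (take k (f Dif)))"
      by (simp only: block_def flip: pair)
    have "acts rest z \<in> homog A 1" using even' z by (intro acts_closed) auto
    moreover have "snd ` set block \<subseteq> homog A 0" using even' by auto
    then have "set (map snd (take k (f Lft)) @ map snd (take k (f Rgt)) @ map snd (take k (f Dif))) \<subseteq> homog A 0"
      unfolding block_def by (simp only: set_append set_map image_Un)
    ultimately show ?thesis unfolding block by (intro assms[OF lens lens lens])
  qed
  finally show "acts ps z = \<zero>" .
qed

lemma odd_value_extract:
  assumes s: "admissible A s" and j: "j < n" "j \<noteq> i"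
  shows "odd_value n i \<kappa> s = act (\<kappa> j, s (Y j))
    (acts (map (\<lambda>j. (\<kappa> j, s (Y j))) (remove1 j (filter (\<lambda>j. j \<noteq> i) [0..<n]))) (s (Z i)))"
proof -
  let ?js = "filter (\<lambda>j. j \<noteq> i) [0..<n]" and ?f = "\<lambda>j. (\<kappa> j, s (Y j))"
  have "mset ?js = mset (j # remove1 j ?js)" using j by (simp add: insert_DiffM)
  then have "mset (map ?f ?js) = mset (map ?f (j # remove1 j ?js))" by (metis mset_map)
  then have "odd_value n i \<kappa> s = acts (map ?f (j # remove1 j ?js)) (s (Z i))"
    unfolding odd_value_def
    by (rule acts_mset_cong) (use admissible_even[OF s] admissible_odd[OF s] in auto)
  then show ?thesis by simp
qed

text \<open>
  Left multiplication is right multiplication plus commutator.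
\<close>

lemma odd_value_split:
  assumes s: "admissible A s" and j: "j < n" "j \<noteq> i" "\<kappa> j = Lft"
  shows "odd_value n i \<kappa> s = odd_value n i (\<kappa>(j := Rgt)) s \<oplus> odd_value n i (\<kappa>(j := Dif)) s"
proof -
  let ?js = "remove1 j (filter (\<lambda>j. j \<noteq> i) [0..<n])"
  have "j \<notin> set ?js" by simp
  then have eq: "map (\<lambda>l. ((\<kappa>(j := x)) l, s (Y l))) ?js = map (\<lambda>l. (\<kappa> l, s (Y l))) ?js" for x
    by (intro map_cong) auto
  have "acts (map (\<lambda>l. (\<kappa> l, s (Y l))) ?js) (s (Z i)) \<in> homog A 1"
    using admissible_even[OF s] admissible_odd[OF s] by (intro acts_closed) auto
  then show ?thesis
    unfolding odd_value_extract[OF s j(1,2)] eq using j admissible_even[OF s] by (simp add: act_Lft)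
qed

definition count_side :: "nat \<Rightarrow> nat \<Rightarrow> (nat \<Rightarrow> side) \<Rightarrow> side \<Rightarrow> nat"
  where "count_side n i \<kappa> x = card {j. j < n \<and> j \<noteq> i \<and> \<kappa> j = x}"

lemma odd_value_zero:
  assumes "commutator_identity k" "\<And>x. count_side n i \<kappa> x \<ge> k" and s: "admissible A s"
  shows "odd_value n i \<kappa> s = \<zero>"
proof -
  let ?ps = "map (\<lambda>j. (\<kappa> j, s (Y j))) (filter (\<lambda>j. j \<noteq> i) [0..<n])"
  have "length (filter (\<lambda>p. fst p = x) ?ps) = count_side n i \<kappa> x" for x
  proof -
    have "length (filter (\<lambda>p. fst p = x) ?ps) = length (filter (\<lambda>j. j \<noteq> i \<and> \<kappa> j = x) [0..<n])"
      by (simp add: filter_map comp_def conj_commute)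
    also have "\<dots> = card (set (filter (\<lambda>j. j \<noteq> i \<and> \<kappa> j = x) [0..<n]))"
      by (intro distinct_card[symmetric] distinct_filter distinct_upt)
    also have "set (filter (\<lambda>j. j \<noteq> i \<and> \<kappa> j = x) [0..<n]) = {j. j < n \<and> j \<noteq> i \<and> \<kappa> j = x}" by auto
    finally show ?thesis by (simp add: count_side_def)
  qed
  then have "\<forall>x. length (filter (\<lambda>p. fst p = x) ?ps) \<ge> k" using assms(2) by simp
  moreover have "\<forall>p\<in>set ?ps. snd p \<in> homog A 0" using admissible_even[OF s] by auto
  ultimately show ?thesis
    using assms(1) admissible_odd[OF s] unfolding odd_value_def commutator_identity_def by blast
qed

definition update_side :: "nat \<times> side \<Rightarrow> (nat \<Rightarrow> side) \<Rightarrow> (nat \<Rightarrow> side)"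
  where "update_side p \<kappa> = \<kappa>(fst p := snd p)"

text \<open>
  The constant functions \<open>Lft\<close> and \<open>Rgt\<close>, changed at no more than \<open>m\<close> places below \<open>n\<close>. The lists have
  length exactly \<open>m\<close>, which makes them easy to count; a shorter list of changes is padded with changes at
  the irrelevant place \<open>i\<close>.
\<close>

definition few_changes :: "nat \<Rightarrow> nat \<Rightarrow> (nat \<Rightarrow> side) set"
  where "few_changes n m = (\<lambda>(us, b). foldr update_side us (\<lambda>_. b)) `
    ({us. set us \<subseteq> {..<n} \<times> UNIV \<and> length us = m} \<times> {Lft, Rgt})"

lemma card_few_changes: "finite (few_changes n m)" "card (few_changes n m) \<le> 2 * (3 * n) ^ m"
proof -
  let ?U = "{us :: (nat \<times> side) list. set us \<subseteq> {..<n} \<times> UNIV \<and> length us = m}"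
  have fin: "finite ?U" by (rule finite_lists_length_eq) simp
  then show "finite (few_changes n m)" by (simp add: few_changes_def)
  have "card (few_changes n m) \<le> card (?U \<times> {Lft, Rgt})"
    unfolding few_changes_def by (rule card_image_le) (use fin in simp)
  also have "\<dots> = 2 * (n * 3) ^ m"
    by (simp add: card_cartesian_product card_lists_length_eq card_UNIV_side)
  finally show "card (few_changes n m) \<le> 2 * (3 * n) ^ m" by (simp add: mult.commute)
qed

lemma odd_value_few_changes:
  assumes i: "i < n" and b: "b \<in> {Lft, Rgt}" and few: "card {j. j < n \<and> j \<noteq> i \<and> \<kappa> j \<noteq> b} \<le> m"
  shows "odd_value n i \<kappa> \<in> odd_value n i ` few_changes n m"
proof -
  define E where "E = {j. j < n \<and> j \<noteq> i \<and> \<kappa> j \<noteq> b}"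
  define es where "es = sorted_list_of_set E"
  have es: "set es = E" "length es = card E" by (simp_all add: es_def E_def)
  define pad where "pad = replicate (m - card E) (i, Lft)"
  define us where "us = map (\<lambda>j. (j, \<kappa> j)) es @ pad"
  define \<kappa>' where "\<kappa>' = foldr update_side us (\<lambda>_. b)"
  have mem: "\<kappa>' \<in> few_changes n m"
    unfolding few_changes_def \<kappa>'_def
  proof (rule image_eqI[of _ _ "(us, b)"])
    have "length us = m" using few es(2) by (simp add: us_def pad_def flip: E_def)
    moreover have "set us \<subseteq> {..<n} \<times> UNIV" 
    proof -
      have "set es \<subseteq> {..<n}" unfolding es(1) E_def by blast
      then show ?thesis using i by (auto simp: us_def pad_def)
    qed
    ultimately show "(us, b) \<in> {us. set us \<subseteq> {..<n} \<times> UNIV \<and> length us = m} \<times> {Lft, Rgt}"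
      using b by blast
  qed simp
  have pad: "foldr update_side (replicate l (i, Lft)) (\<lambda>_. b) j = b" if "j \<noteq> i" for l j
    using that by (induction l) (auto simp: update_side_def)
  have upd: "foldr update_side (map (\<lambda>j. (j, \<kappa> j)) js) f j = (if j \<in> set js then \<kappa> j else f j)" for js f j
    by (induction js) (auto simp: update_side_def)
  have "\<kappa>' j = \<kappa> j" if "j < n" "j \<noteq> i" for j
  proof -
    have "\<kappa>' j = (if j \<in> E then \<kappa> j else b)"
      unfolding \<kappa>'_def us_def foldr_append upd es(1) pad_def using pad[OF that(2)] by simp
    then show ?thesis using that by (simp add: E_def)
  qed
  then have "odd_value n i \<kappa> s = odd_value n i \<kappa>' s" for s
    unfolding odd_value_def by (intro arg_cong2[of _ _ _ _ acts] map_cong) auto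
  then have "odd_value n i \<kappa> = odd_value n i \<kappa>'" by (rule ext)
  then show ?thesis using mem by (rule image_eqI)
qed

text \<open>
  Induction on the number of left multiplications. If at most \<open>k\<close> of them occur, then only these and the at
  most \<open>k\<close> commutators are not right multiplications; likewise with left and right exchanged. Otherwise
  the product vanishes if \<open>k\<close> commutators occur, and if fewer occur, one left multiplication is split.
\<close>

lemma odd_value_spanned:
  assumes id: "commutator_identity k" and i: "i < n" and "count_side n i \<kappa> Dif \<le> k"
  shows "spanned {s. admissible A s} (odd_value n i ` few_changes n (2 * k)) (odd_value n i \<kappa>)"
  using assms(3)
proof (induction "count_side n i \<kappa> Lft" arbitrary: \<kappa> rule: less_induct)
  case less
  let ?G = "odd_value n i ` few_changes n (2 * k)"
  have closed: "\<forall>g\<in>?G. \<forall>s\<in>{s. admissible A s}. g s \<in> carrier A"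
    using homog_closed[OF odd_value_odd] by auto
  have good: ?case if "b \<in> {Lft, Rgt}" "c \<in> {Lft, Rgt}" "b \<noteq> c" "count_side n i \<kappa> c \<le> k" for b c
  proof -
    have "x = c \<or> x = Dif" if "x \<noteq> b" for x
      using that \<open>b \<in> {Lft, Rgt}\<close> \<open>c \<in> {Lft, Rgt}\<close> \<open>b \<noteq> c\<close> by (cases x) auto
    then have "card {j. j < n \<and> j \<noteq> i \<and> \<kappa> j \<noteq> b}
        \<le> card ({j. j < n \<and> j \<noteq> i \<and> \<kappa> j = c} \<union> {j. j < n \<and> j \<noteq> i \<and> \<kappa> j = Dif})"
      by (intro card_mono) auto
    also have "\<dots> \<le> count_side n i \<kappa> c + count_side n i \<kappa> Dif"
      unfolding count_side_def by (rule card_Un_le)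
    finally have "card {j. j < n \<and> j \<noteq> i \<and> \<kappa> j \<noteq> b} \<le> 2 * k" using that less.prems by linarith
    from odd_value_few_changes[OF i that(1) this] show ?thesis by (rule spanned_base[OF closed]) simp
  qed
  consider "count_side n i \<kappa> Lft \<le> k" | "count_side n i \<kappa> Rgt \<le> k"
    | "count_side n i \<kappa> Lft > k" "count_side n i \<kappa> Rgt > k" "count_side n i \<kappa> Dif = k"
    | "count_side n i \<kappa> Lft > k" "count_side n i \<kappa> Dif < k"
    using less.prems by linarith
  then show ?case
  proof cases
    case 1
    then show ?thesis by (intro good[of Rgt Lft]) auto
  next
    case 2
    then show ?thesis by (intro good[of Lft Rgt]) auto
  next
    case 3
    have "count_side n i \<kappa> x \<ge> k" for x using 3 by (cases x) auto
    then show ?thesis using odd_value_zero[OF id] by (intro spanned.zero) auto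
  next
    case 4
    then have "{j. j < n \<and> j \<noteq> i \<and> \<kappa> j = Lft} \<noteq> {}" unfolding count_side_def by (metis card.empty not_less_zero)
    then obtain j where j: "j < n" "j \<noteq> i" "\<kappa> j = Lft" by blast
    have lt: "count_side n i (\<kappa>(j := x)) Lft < count_side n i \<kappa> Lft" if "x \<noteq> Lft" for x
      unfolding count_side_def using j that by (intro psubset_card_mono) auto
    have "count_side n i (\<kappa>(j := Rgt)) Dif \<le> count_side n i \<kappa> Dif"
      unfolding count_side_def by (intro card_mono) auto
    then have 1: "spanned {s. admissible A s} ?G (odd_value n i (\<kappa>(j := Rgt)))"
      using less.prems by (intro less.hyps lt) auto
    have "count_side n i (\<kappa>(j := Dif)) Dif \<le> card (insert j {l. l < n \<and> l \<noteq> i \<and> \<kappa> l = Dif})"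
      unfolding count_side_def by (intro card_mono) auto
    also have "\<dots> \<le> Suc (count_side n i \<kappa> Dif)" unfolding count_side_def by (rule card_insert_le_m1) auto
    finally have 2: "spanned {s. admissible A s} ?G (odd_value n i (\<kappa>(j := Dif)))"
      using 4 by (intro less.hyps lt) auto
    show ?thesis
      by (rule spanned_add[OF closed 1 2]) (use odd_value_split j in auto)
  qed
qed

lemma codim_polynomially_bounded:
  assumes "commutator_identity k"
  shows "polynomially_bounded (codim \<B> A)"
  unfolding polynomially_bounded_def
proof (intro exI allI impI)
  fix n :: nat assume n: "1 \<le> n"
  let ?K = "few_changes n (2 * k)"
  have "codim \<B> A n \<le> enat (2 + n * card ?K)"
  proof (rule codim_le_sides[OF n card_few_changes(1)])
    fix i and \<kappa> :: "nat \<Rightarrow> side" assume "i < n" "\<forall>j. \<kappa> j \<noteq> Dif"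
    then show "spanned {s. admissible A s} (odd_value n i ` ?K) (odd_value n i \<kappa>)"
      by (intro odd_value_spanned[OF assms]) (simp_all add: count_side_def)
  qed
  also have "2 + n * card ?K \<le> (2 + 2 * 3 ^ (2 * k)) * n ^ (2 * k + 1)"
  proof -
    have "2 + n * card ?K \<le> 2 * n ^ (2 * k + 1) + n * (2 * (3 * n) ^ (2 * k))"
      using n card_few_changes(2)[of n "2 * k"] by (intro add_mono mult_left_mono) auto
    also have "\<dots> = (2 + 2 * 3 ^ (2 * k)) * n ^ (2 * k + 1)"
      by (simp add: power_mult_distrib algebra_simps)
    finally show ?thesis .
  qed
  then have "enat (2 + n * card ?K) \<le> enat ((2 + 2 * 3 ^ (2 * k)) * n ^ (2 * k + 1))" by simp
  finally show "codim \<B> A n \<le> enat ((2 + 2 * 3 ^ (2 * k)) * n ^ (2 * k + 1))" .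
qed

end

section \<open>Polarisation\<close>

context graded_W_algebra
begin

text \<open>
  Polynomials in a scalar \<open>t\<close> with coefficients in the algebra, given by the list of coefficients.
\<close>

fun horner :: "'a list \<Rightarrow> 'f \<Rightarrow> 'a" where
  "horner [] t = \<zero>"
| "horner (m # ms) t = m \<oplus> t \<odot> horner ms t"

fun coeff_add :: "'a list \<Rightarrow> 'a list \<Rightarrow> 'a list" where
  "coeff_add [] ns = ns"
| "coeff_add (m # ms) [] = m # ms"
| "coeff_add (m # ms) (n # ns) = (m \<oplus> n) # coeff_add ms ns"

lemma horner_closed [simp]: "set ms \<subseteq> carrier A \<Longrightarrow> horner ms t \<in> carrier A"
  by (induction ms) auto

lemma coeff_add_closed: "set ms \<subseteq> carrier A \<Longrightarrow> set ns \<subseteq> carrier A \<Longrightarrow> set (coeff_add ms ns) \<subseteq> carrier A"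
  by (induction ms ns rule: coeff_add.induct) auto

lemma horner_coeff_add:
  "set ms \<subseteq> carrier A \<Longrightarrow> set ns \<subseteq> carrier A \<Longrightarrow> horner (coeff_add ms ns) t = horner ms t \<oplus> horner ns t"
  by (induction ms ns rule: coeff_add.induct) (auto simp: smult_add a_ac)

text \<open>
  The coefficients of \<open>F(2 t) - F(t)\<close>, where the given list begins with the coefficient of \<open>t\<^sup>k\<close>.
\<close>

fun dilate :: "nat \<Rightarrow> 'a list \<Rightarrow> 'a list" where
  "dilate k [] = []"
| "dilate k (m # ms) = (2 ^ k - 1) \<odot> m # dilate (Suc k) ms"

lemma length_dilate [simp]: "length (dilate k ms) = length ms"
  by (induction ms arbitrary: k) auto

lemma dilate_closed: "set ms \<subseteq> carrier A \<Longrightarrow> set (dilate k ms) \<subseteq> carrier A"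
  by (induction ms arbitrary: k) auto

lemma smult_diff: "x \<in> carrier A \<Longrightarrow> (c - d) \<odot> x = c \<odot> x \<oplus> (- d) \<odot> x"
  by (simp flip: smult_add')

lemma horner_dilate:
  "set ms \<subseteq> carrier A \<Longrightarrow> horner (dilate k ms) t = 2 ^ k \<odot> horner ms (2 * t) \<oplus> (- 1) \<odot> horner ms t"
  by (induction ms arbitrary: k) (simp_all add: smult_diff smult_add smult_smult a_ac mult_ac)

end

lemma (in triangular_W_algebra) dilate_eq_zeroD:
  "\<forall>m\<in>set (dilate (Suc k) ms). m = \<zero> \<Longrightarrow> set ms \<subseteq> carrier A \<Longrightarrow> \<forall>m\<in>set ms. m = \<zero>"
proof (induction ms arbitrary: k)
  case (Cons m ms)
  have "(2 :: 'f) ^ Suc k \<noteq> 1"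
  proof -
    have "(2 :: nat) ^ Suc k \<noteq> 1" by simp
    then show ?thesis by (metis of_nat_eq_1_iff of_nat_numeral of_nat_power)
  qed
  then show ?case using Cons.prems Cons.IH[of "Suc k"] smult_eq_zero[of m "2 ^ Suc k - 1"] by simp
qed simp

text \<open>
  The polynomial \<open>F(2 t) - F(t)\<close> has no constant term. After division by \<open>t\<close> it has lower degree and still
  vanishes for all \<open>t \<noteq> 0\<close>; in characteristic zero it determines all coefficients of \<open>F\<close> but the constant one.
\<close>

lemma (in triangular_W_algebra) horner_eq_zeroD:
  assumes "\<And>t. t \<noteq> 0 \<Longrightarrow> horner ms t = \<zero>" "set ms \<subseteq> carrier A"
  shows "\<forall>m\<in>set ms. m = \<zero>"
  using assms
proof (induction "length ms" arbitrary: ms)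
  case (Suc l)
  then obtain m ns where ms: "ms = m # ns" "length ns = l" by (metis length_Suc_conv)
  have c: "m \<in> carrier A" "set ns \<subseteq> carrier A" using Suc.prems ms by auto
  have "horner (dilate 1 ns) t = \<zero>" if t: "t \<noteq> 0" for t
  proof -
    let ?h = "horner ns (2 * t)" and ?k = "horner ns t"
    have 1: "m \<oplus> (2 * t) \<odot> ?h = \<zero>" using Suc.prems(1)[of "2 * t"] t ms by simp
    have 2: "m \<oplus> t \<odot> ?k = \<zero>" using Suc.prems(1)[of t] t ms by simp
    have "t \<odot> horner (dilate 1 ns) t = (2 * t) \<odot> ?h \<oplus> (- 1) \<odot> (t \<odot> ?k)"
      using c by (simp add: horner_dilate smult_add smult_smult mult.commute)
    also have "(2 * t) \<odot> ?h = t \<odot> ?k" using 1 2 c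
      by (metis a_comm horner_closed minus_equality minus_minus smult_closed')
    also have "t \<odot> ?k \<oplus> (- 1) \<odot> (t \<odot> ?k) = \<zero>" using c by (simp add: r_neg flip: minus_eq_smult)
    finally show ?thesis using smult_eq_zero t c by (metis dilate_closed horner_closed)
  qed
  then have "\<forall>x\<in>set (dilate 1 ns). x = \<zero>"
    using ms dilate_closed[OF c(2)] by (intro Suc.hyps(1)) auto
  then have ns: "\<forall>x\<in>set ns. x = \<zero>" using dilate_eq_zeroD[of 0 ns] c by simp
  have "horner ns 1 = \<zero>" using ns by (induction ns) auto
  then have "m = \<zero>" using Suc.prems(1)[of 1] ms c by simp
  then show ?case using ns ms by simp
qed simp

context triangular_W_algebra
begin

text \<open>
  A symmetric multilinear map that vanishes on the diagonal vanishes. The arguments are replaced one by one: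
  if \<open>G(x\<^sub>1, \<dots>, x\<^sub>l, v, \<dots>, v) = 0\<close> for all \<open>v\<close>, then the coefficient of \<open>t\<close> in the expansion
  for \<open>v = t x + y\<close>, which is a positive multiple of \<open>G(x\<^sub>1, \<dots>, x\<^sub>l, x, y, \<dots>, y)\<close>, is zero too.
\<close>

lemma polarisation:
  fixes G :: "'a list \<Rightarrow> 'a"
  assumes closed: "\<And>xs. length xs = d \<Longrightarrow> set xs \<subseteq> homog A 0 \<Longrightarrow> G xs \<in> carrier A"
    and sym: "\<And>xs ys. length xs = d \<Longrightarrow> set xs \<subseteq> homog A 0 \<Longrightarrow> mset xs = mset ys \<Longrightarrow> G xs = G ys"
    and lin: "\<And>t x y xs. Suc (length xs) = d \<Longrightarrow> set xs \<subseteq> homog A 0 \<Longrightarrow> x \<in> homog A 0 \<Longrightarrow> y \<in> homog A 0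
      \<Longrightarrow> G ((t \<odot> x \<oplus> y) # xs) = t \<odot> G (x # xs) \<oplus> G (y # xs)"
    and diag: "\<And>y. y \<in> homog A 0 \<Longrightarrow> G (replicate d y) = \<zero>"
    and xs: "length xs = d" "set xs \<subseteq> homog A 0"
  shows "G xs = \<zero>"
proof -
  (* only the coefficients of 1 and t in the expansion are needed *)
  have expand: "\<exists>cs. set cs \<subseteq> carrier A \<and> (\<forall>t. G (pre @ replicate m (t \<odot> x \<oplus> y)) = horner cs t)
      \<and> (if m = 0 then cs = [G pre] else \<exists>cs'. cs = G (pre @ replicate m y) # of_nat m \<odot> G (pre @ x # replicate (m - 1) y) # cs')"
    if "length pre + m = d" "set pre \<subseteq> homog A 0" "x \<in> homog A 0" "y \<in> homog A 0" for pre m x y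
    using that
  proof (induction m arbitrary: pre)
    case 0
    then show ?case using closed[of pre] by (intro exI[of _ "[G pre]"]) simp
  next
    case (Suc m)
    let ?v = "\<lambda>t. t \<odot> x \<oplus> y"
    obtain cx where cx: "set cx \<subseteq> carrier A" "\<And>t. G ((x # pre) @ replicate m (?v t)) = horner cx t"
      "if m = 0 then cx = [G (x # pre)] else \<exists>cs'. cx = G ((x # pre) @ replicate m y) # of_nat m \<odot> G ((x # pre) @ x # replicate (m - 1) y) # cs'"
      using Suc.IH[of "x # pre"] Suc.prems by auto
    obtain cy where cy: "set cy \<subseteq> carrier A" "\<And>t. G ((y # pre) @ replicate m (?v t)) = horner cy t"
      "if m = 0 then cy = [G (y # pre)] else \<exists>cs'. cy = G ((y # pre) @ replicate m y) # of_nat m \<odot> G ((y # pre) @ x # replicate (m - 1) y) # cs'"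
      using Suc.IH[of "y # pre"] Suc.prems by auto
    have even_v: "?v t \<in> homog A 0" for t using Suc.prems by simp
    define cs where "cs = coeff_add cy (\<zero> # cx)"
    have "G (pre @ replicate (Suc m) (?v t)) = horner cs t" for t
    proof -
      have "G (pre @ replicate (Suc m) (?v t)) = G (?v t # pre @ replicate m (?v t))"
        using Suc.prems even_v by (intro sym) auto
      also have "\<dots> = t \<odot> G (x # pre @ replicate m (?v t)) \<oplus> G (y # pre @ replicate m (?v t))"
        using Suc.prems even_v by (intro lin) auto
      also have "\<dots> = horner cs t"
        using cx cy by (simp add: cs_def horner_coeff_add a_comm)
      finally show ?thesis .
    qed
    moreover have "set cs \<subseteq> carrier A" using cx cy by (simp add: cs_def coeff_add_closed)
    moreover have "\<exists>cs'. cs = G (pre @ replicate (Suc m) y) # of_nat (Suc m) \<odot> G (pre @ x # replicate m y) # cs'"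
    proof -
      have 1: "G (y # pre @ replicate m y) = G (pre @ replicate (Suc m) y)"
        and 2: "G (x # pre @ replicate m y) = G (pre @ x # replicate m y)"
        using Suc.prems by (intro sym; auto)+
      have 3: "G (y # pre @ x # replicate (m - 1) y) = G (pre @ x # replicate m y)" if "m \<noteq> 0"
      proof -
        obtain l where "m = Suc l" using \<open>m \<noteq> 0\<close> not0_implies_Suc by blast
        then show ?thesis using Suc.prems by (intro sym) auto
      qed
      have c: "G (pre @ replicate (Suc m) y) \<in> carrier A" "G (pre @ x # replicate m y) \<in> carrier A"
        using Suc.prems by (intro closed; auto)+
      show ?thesis
      proof (cases "m = 0")
        case True
        then show ?thesis using cx(3) cy(3) 1 2 c by (simp add: cs_def)
      next
        case False
        then obtain cx' cy' where "cx = G (x # pre @ replicate m y) # cx'"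
          "cy = G (y # pre @ replicate m y) # of_nat m \<odot> G (y # pre @ x # replicate (m - 1) y) # cy'"
          using cx(3) cy(3) by auto
        then show ?thesis using 1 2 3 c False by (simp add: cs_def a_comm)
      qed
    qed
    ultimately show ?case by auto
  qed
  have "G (pre @ replicate m y) = \<zero>" if "length pre + m = d" "set pre \<subseteq> homog A 0" "y \<in> homog A 0" for pre m y
    using that
  proof (induction pre arbitrary: m y)
    case Nil
    then show ?case using diag by simp
  next
    case (Cons x pre)
    have IH: "G (pre @ replicate (Suc m) v) = \<zero>" if "v \<in> homog A 0" for v
      using Cons that by (intro Cons.IH) auto
    obtain cs cs' where cs: "set cs \<subseteq> carrier A" "\<And>t. G (pre @ replicate (Suc m) (t \<odot> x \<oplus> y)) = horner cs t"
      "cs = G (pre @ replicate (Suc m) y) # of_nat (Suc m) \<odot> G (pre @ x # replicate m y) # cs'"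
      using expand[of pre "Suc m" x y] Cons.prems by auto
    have "horner cs t = \<zero>" for t
      using IH[of "t \<odot> x \<oplus> y"] Cons.prems by (simp flip: cs(2))
    then have "\<forall>c\<in>set cs. c = \<zero>" using cs(1) by (intro horner_eq_zeroD)
    then have "of_nat (Suc m) \<odot> G (pre @ x # replicate m y) = \<zero>" using cs(3) by simp
    moreover have "G (pre @ x # replicate m y) \<in> carrier A" using Cons.prems by (intro closed) auto
    moreover have "of_nat (Suc m) \<noteq> (0 :: 'f)" by (simp only: of_nat_eq_0_iff)
    ultimately have "G (pre @ x # replicate m y) = \<zero>" using smult_eq_zero by blast
    moreover have "G (pre @ x # replicate m y) = G ((x # pre) @ replicate m y)"
      using Cons.prems by (intro sym) auto
    ultimately show ?case by simp
  qed
  from this[of xs 0 \<zero>] show ?thesis using xs by simp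
qed

section \<open>Symmetric multilinear forms in left and right multiplications\<close>

text \<open>
  \<open>symm a [y\<^sub>1, \<dots>, y\<^sub>d] z\<close> is the sum of \<open>a\<^sub>|\<^sub>I\<^sub>| y\<^sub>I z y\<^sub>J\<close> over all partitions of the indices into
  sets \<open>I\<close> and \<open>J\<close>, that is, the polarisation of the sum of \<open>(d choose i) a\<^sub>i y\<^sup>i z y\<^sup>d\<^sup>-\<^sup>i\<close>.
\<close>

fun symm :: "(nat \<Rightarrow> 'f) \<Rightarrow> 'a list \<Rightarrow> 'a \<Rightarrow> 'a" where
  "symm a [] z = a 0 \<odot> z"
| "symm a (y # ys) z = symm (\<lambda>i. a (Suc i)) ys (y \<otimes> z) \<oplus> symm a ys (z \<otimes> y)"

lemma symm_closed [simp]: "set ys \<subseteq> homog A 0 \<Longrightarrow> z \<in> homog A 1 \<Longrightarrow> symm a ys z \<in> homog A 1"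
  by (induction ys arbitrary: a z) auto

lemma symm_lin:
  "set ys \<subseteq> homog A 0 \<Longrightarrow> z \<in> homog A 1 \<Longrightarrow> z' \<in> homog A 1
    \<Longrightarrow> symm a ys (t \<odot> z \<oplus> z') = t \<odot> symm a ys z \<oplus> symm a ys z'"
proof (induction ys arbitrary: a z z')
  case Nil
  then show ?case by (simp add: smult_add smult_smult mult.commute)
next
  case (Cons y ys)
  have "symm (\<lambda>i. a (Suc i)) ys (y \<otimes> z) \<in> carrier A" "symm a ys (z \<otimes> y) \<in> carrier A"
    "symm (\<lambda>i. a (Suc i)) ys (y \<otimes> z') \<in> carrier A" "symm a ys (z' \<otimes> y) \<in> carrier A"
    using Cons.prems by (intro homog_closed[OF symm_closed]; simp)+
  note cl = this
  have 1: "y \<otimes> (t \<odot> z \<oplus> z') = t \<odot> (y \<otimes> z) \<oplus> y \<otimes> z'" "(t \<odot> z \<oplus> z') \<otimes> y = t \<odot> (z \<otimes> y) \<oplus> z' \<otimes> y"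
  proof -
    have "y \<in> carrier A" "z \<in> carrier A" "z' \<in> carrier A" using Cons.prems homog_closed by auto
    then show "y \<otimes> (t \<odot> z \<oplus> z') = t \<odot> (y \<otimes> z) \<oplus> y \<otimes> z'" "(t \<odot> z \<oplus> z') \<otimes> y = t \<odot> (z \<otimes> y) \<oplus> z' \<otimes> y"
      by (simp_all add: mult_add_left mult_add_right mult_smult_left mult_smult_right)
  qed
  have 2: "symm b ys (t \<odot> (y \<otimes> z) \<oplus> y \<otimes> z') = t \<odot> symm b ys (y \<otimes> z) \<oplus> symm b ys (y \<otimes> z')"
    "symm b ys (t \<odot> (z \<otimes> y) \<oplus> z' \<otimes> y) = t \<odot> symm b ys (z \<otimes> y) \<oplus> symm b ys (z' \<otimes> y)" for b
    using Cons.prems by (intro Cons.IH; simp)+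
  show ?case unfolding symm.simps 1 2 using cl by (simp add: smult_add a_ac)
qed

lemma symm_coeff_lin:
  "set ys \<subseteq> homog A 0 \<Longrightarrow> z \<in> homog A 1
    \<Longrightarrow> symm (\<lambda>i. t * a i + b i) ys z = t \<odot> symm a ys z \<oplus> symm b ys z"
proof (induction ys arbitrary: a b z)
  case Nil
  then show ?case by (simp add: smult_smult)
next
  case (Cons y ys)
  have "symm (\<lambda>i. a (Suc i)) ys (y \<otimes> z) \<in> carrier A" "symm a ys (z \<otimes> y) \<in> carrier A"
    "symm (\<lambda>i. b (Suc i)) ys (y \<otimes> z) \<in> carrier A" "symm b ys (z \<otimes> y) \<in> carrier A"
    using Cons.prems by (intro homog_closed[OF symm_closed]; simp)+
  with Cons show ?case by (simp add: smult_add a_ac)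
qed

lemma symm_zero: "(\<And>i. i \<le> length ys \<Longrightarrow> a i = 0) \<Longrightarrow> set ys \<subseteq> homog A 0 \<Longrightarrow> z \<in> homog A 1 \<Longrightarrow> symm a ys z = \<zero>"
  by (induction ys arbitrary: a z) auto

lemma symm_swap:
  assumes "x \<in> homog A 0" "y \<in> homog A 0" "set ys \<subseteq> homog A 0" "z \<in> homog A 1"
  shows "symm a (x # y # ys) z = symm a (y # x # ys) z"
proof -
  have c: "x \<in> carrier A" "y \<in> carrier A" "z \<in> carrier A" using assms by auto
  have 1: "y \<otimes> (x \<otimes> z) = x \<otimes> (y \<otimes> z)" using even_left_commute[OF assms(2,1) c(3)] .
  have 2: "(z \<otimes> x) \<otimes> y = (z \<otimes> y) \<otimes> x" using even_commute[OF assms(1,2)] c by (simp add: mult_assoc)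
  have 3: "(x \<otimes> z) \<otimes> y = x \<otimes> (z \<otimes> y)" "(y \<otimes> z) \<otimes> x = y \<otimes> (z \<otimes> x)" using c by (simp_all add: mult_assoc)
  have "symm b ys (x \<otimes> (y \<otimes> z)) \<in> carrier A" "symm b ys (x \<otimes> (z \<otimes> y)) \<in> carrier A"
    "symm b ys (y \<otimes> (z \<otimes> x)) \<in> carrier A" "symm b ys ((z \<otimes> y) \<otimes> x) \<in> carrier A" for b
    using assms by (intro homog_closed[OF symm_closed]; simp)+
  then show ?thesis by (simp add: 1 2 3 a_ac)
qed

lemma symm_mset_cong:
  assumes "mset xs = mset ys" "set xs \<subseteq> homog A 0" "z \<in> homog A 1"
  shows "symm a xs z = symm a ys z"
proof (rule swap_invariant[OF assms(1,2), where f = "\<lambda>xs. symm a xs z"])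
  fix us x y vs assume "set (us @ x # y # vs) \<subseteq> homog A 0"
  then show "symm a (us @ x # y # vs) z = symm a (us @ y # x # vs) z"
    using assms(3)
  proof (induction us arbitrary: a z)
    case Nil
    then show ?case using symm_swap[of x y vs z a] by simp
  qed simp
qed

lemma symm_polarised:
  assumes diag: "\<And>y z. y \<in> homog A 0 \<Longrightarrow> z \<in> homog A 1 \<Longrightarrow> symm a (replicate d y) z = \<zero>"
    and ys: "length ys = d" "set ys \<subseteq> homog A 0" and z: "z \<in> homog A 1"
  shows "symm a ys z = \<zero>"
proof (rule polarisation[where G = "\<lambda>ys. symm a ys z" and d = d])
  fix t x y and xs :: "'a list"
  assume "set xs \<subseteq> homog A 0" and h: "x \<in> homog A 0" "y \<in> homog A 0"
  then have cl: "symm b xs v \<in> carrier A" if "v \<in> homog A 1" for b v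
    using that by (intro homog_closed[OF symm_closed])
  show "symm a ((t \<odot> x \<oplus> y) # xs) z = t \<odot> symm a (x # xs) z \<oplus> symm a (y # xs) z"
  proof -
    have 1: "(t \<odot> x \<oplus> y) \<otimes> z = t \<odot> (x \<otimes> z) \<oplus> y \<otimes> z" "z \<otimes> (t \<odot> x \<oplus> y) = t \<odot> (z \<otimes> x) \<oplus> z \<otimes> y"
      using h z by (simp_all add: mult_add_left mult_add_right mult_smult_left mult_smult_right)
    have 2: "symm b xs (t \<odot> (x \<otimes> z) \<oplus> y \<otimes> z) = t \<odot> symm b xs (x \<otimes> z) \<oplus> symm b xs (y \<otimes> z)"
      "symm b xs (t \<odot> (z \<otimes> x) \<oplus> z \<otimes> y) = t \<odot> symm b xs (z \<otimes> x) \<oplus> symm b xs (z \<otimes> y)" for b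
      using \<open>set xs \<subseteq> homog A 0\<close> h z by (intro symm_lin; simp)+
    show ?thesis unfolding symm.simps 1 2 using h z by (simp add: smult_add cl a_ac)
  qed
next
  show "symm a xs z \<in> carrier A" if "set xs \<subseteq> homog A 0" for xs
    by (rule homog_closed[OF symm_closed[OF that z]])
  show "symm a xs z = symm a ys z" if "set xs \<subseteq> homog A 0" "mset xs = mset ys" for xs ys
    by (rule symm_mset_cong[OF that(2,1) z])
  show "symm a (replicate d y) z = \<zero>" if "y \<in> homog A 0" for y
    by (rule diag[OF that z])
qed (rule ys)+

end

section \<open>From identities to commutator identities\<close>

context triangular_W_algebra
begin

text \<open>
  Let \<open>r(y\<^sub>1, \<dots>, y\<^sub>d\<^sub>+\<^sub>1; w) = 0\<close> be the identity given by \<open>a\<close>, on the odd elements \<open>w\<close> obtained by the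
  actions \<open>ops\<close>. It has the form \<open>r\<^sub>1(y w) + r\<^sub>0(w y) = 0\<close> in its first variable \<open>y\<close>, where \<open>r\<^sub>1\<close> and
  \<open>r\<^sub>0\<close> are the forms in the other variables given by the shifted sequence and by \<open>a\<close>. Comparing the
  instances with \<open>x y\<close> for \<open>y\<close>, with \<open>x w\<close> for \<open>w\<close> and with \<open>w x\<close> for \<open>w\<close> shows that both
  \<open>r\<^sub>0\<close> and \<open>r\<^sub>1\<close> vanish on the commutators of \<open>x\<close> with \<open>w y\<close> and \<open>y w\<close>, respectively.
  One of the two forms is nonzero, and the induction goes on with two more actions in \<open>ops\<close>. At the end a
  nonzero multiple of an odd element is left, on which at most \<open>d\<close> actions of each kind have been carried out.
\<close>

lemma commutator_extraction:
  assumes "\<exists>i\<le>d. a i \<noteq> 0" "\<forall>p\<in>set ops. snd p \<in> homog A 0"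
    and "\<forall>ys z. length ys = d \<and> set ys \<subseteq> homog A 0 \<and> z \<in> homog A 1 \<longrightarrow> symm a ys (acts ops z) = \<zero>"
    and "length xs = d" "length ls = d" "length ds = d" "set (xs @ ls @ ds) \<subseteq> homog A 0" "z \<in> homog A 1"
  shows "acts (map (Pair Lft) xs @ map (Pair Rgt) ls @ map (Pair Dif) ds) (acts ops z) = \<zero>"
  using assms
proof (induction d arbitrary: a ops xs ls ds z)
  case 0
  have "symm a [] (acts ops z) = \<zero>" using 0(3)[rule_format, of "[]" z] 0(8) by simp
  then have "a 0 \<odot> acts ops z = \<zero>" by simp
  moreover have "acts ops z \<in> carrier A" by (rule homog_closed[OF acts_closed[OF 0(2,8)]])
  moreover have "a 0 \<noteq> 0" using 0(1) by simp
  ultimately have "acts ops z = \<zero>" using smult_eq_zero by blast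
  then show ?case using 0(4-6) by simp
next
  case (Suc d)
  obtain x0 xs' l0 ls' d0 ds' where lists: "xs = x0 # xs'" "ls = l0 # ls'" "ds = d0 # ds'"
    using Suc.prems(4-6) by (cases xs; cases ls; cases ds) simp_all
  have even: "x0 \<in> homog A 0" "l0 \<in> homog A 0" "d0 \<in> homog A 0" "set (xs' @ ls' @ ds') \<subseteq> homog A 0"
    using Suc.prems(7) lists by auto
  have lens: "length xs' = d" "length ls' = d" "length ds' = d" using Suc.prems lists by auto
  have ops: "\<forall>p\<in>set ops. snd p \<in> homog A 0" by (rule Suc.prems(2))
  have van: "symm a (y # ys) (acts ops z) = \<zero>"
    if "length ys = d" "set ys \<subseteq> homog A 0" "y \<in> homog A 0" "z \<in> homog A 1" for y ys z
    using Suc.prems(3)[rule_format, of "y # ys" z] that by simp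
  have cancel: "v = v'" if "u \<oplus> v = \<zero>" "u \<oplus> v' = \<zero>" "u \<in> carrier A" "v \<in> carrier A" "v' \<in> carrier A" for u v v'
    using that a_comm[of u v] a_comm[of u v'] minus_equality[of v u] minus_equality[of v' u] by simp
  have sub_self: "(- 1) \<odot> v \<oplus> v = \<zero>" if "v \<in> carrier A" for v
    using that by (simp add: l_neg flip: minus_eq_smult)
  have key: "symm a ys (act (Dif, x) (act (Rgt, y) (acts ops z))) = \<zero>
    \<and> symm (\<lambda>i. a (Suc i)) ys (act (Dif, x) (act (Lft, y) (acts ops z))) = \<zero>"
    if ys: "length ys = d" "set ys \<subseteq> homog A 0" and xy: "x \<in> homog A 0" "y \<in> homog A 0" and z: "z \<in> homog A 1"
    for x y ys z
  proof -
    define w where "w = acts ops z"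
    have w: "w \<in> homog A 1" using ops z unfolding w_def by (rule acts_closed)
    have c: "x \<in> carrier A" "y \<in> carrier A" "w \<in> carrier A" using xy w by (auto simp: homog_closed)
    let ?a = "\<lambda>i. a (Suc i)"
    have cl: "symm b ys v \<in> carrier A" if "v \<in> homog A 1" for b v
      by (rule homog_closed[OF symm_closed[OF ys(2) that]])
    have xy': "x \<otimes> y \<in> homog A 0" using xy by simp
    have E2: "symm ?a ys ((x \<otimes> y) \<otimes> w) \<oplus> symm a ys (w \<otimes> (x \<otimes> y)) = \<zero>"
      using van[OF ys xy' z] by (simp add: w_def)
    have "symm a (y # ys) (x \<otimes> w) = \<zero>"
      using van[OF ys xy(2), of "act (Lft, x) z"] xy z acts_act[OF ops, of "(Lft, x)" z] by (simp add: act_def w_def)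
    then have E1: "symm ?a ys (y \<otimes> (x \<otimes> w)) \<oplus> symm a ys ((x \<otimes> w) \<otimes> y) = \<zero>" by simp
    have "symm a (y # ys) (w \<otimes> x) = \<zero>"
      using van[OF ys xy(2), of "act (Rgt, x) z"] xy z acts_act[OF ops, of "(Rgt, x)" z] by (simp add: act_def w_def)
    then have E3: "symm ?a ys (y \<otimes> (w \<otimes> x)) \<oplus> symm a ys ((w \<otimes> x) \<otimes> y) = \<zero>" by simp
    have assoc: "y \<otimes> (x \<otimes> w) = (x \<otimes> y) \<otimes> w" "(w \<otimes> x) \<otimes> y = w \<otimes> (x \<otimes> y)"
      using c even_left_commute[OF xy(2,1) c(3)] by (simp_all add: mult_assoc)
    have "(x \<otimes> y) \<otimes> w \<in> homog A 1" "w \<otimes> (x \<otimes> y) \<in> homog A 1" "(x \<otimes> w) \<otimes> y \<in> homog A 1" "y \<otimes> (w \<otimes> x) \<in> homog A 1"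
      using w xy by simp_all
    note clh = cl[OF this(1)] cl[OF this(2)] cl[OF this(3)] cl[OF this(4)]
    have 1: "symm a ys (w \<otimes> (x \<otimes> y)) = symm a ys ((x \<otimes> w) \<otimes> y)"
      by (rule cancel[OF E2 E1[unfolded assoc]]) (rule clh)+
    have "symm a ys (w \<otimes> (x \<otimes> y)) \<oplus> symm ?a ys ((x \<otimes> y) \<otimes> w) = \<zero>"
      "symm a ys (w \<otimes> (x \<otimes> y)) \<oplus> symm ?a ys (y \<otimes> (w \<otimes> x)) = \<zero>"
      using E2 E3[unfolded assoc] a_comm[OF clh(2) clh(1)] a_comm[OF clh(2) clh(4)] by simp_all
    from cancel[OF this clh(2,1,4)]
    have 2: "symm ?a ys ((x \<otimes> y) \<otimes> w) = symm ?a ys (y \<otimes> (w \<otimes> x))" .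
    have "act (Dif, x) (act (Rgt, y) w) = (- 1) \<odot> (w \<otimes> (x \<otimes> y)) \<oplus> (x \<otimes> w) \<otimes> y"
      using c even_commute[OF xy] by (simp add: act_def mult_assoc a_comm)
    moreover have "symm a ys ((- 1) \<odot> (w \<otimes> (x \<otimes> y)) \<oplus> (x \<otimes> w) \<otimes> y)
        = (- 1) \<odot> symm a ys (w \<otimes> (x \<otimes> y)) \<oplus> symm a ys ((x \<otimes> w) \<otimes> y)"
      using ys w xy by (intro symm_lin) auto
    ultimately have "symm a ys (act (Dif, x) (act (Rgt, y) w)) = \<zero>"
      using sub_self cl[of "(x \<otimes> w) \<otimes> y" a] w xy by (simp add: 1)
    moreover
    have "act (Dif, x) (act (Lft, y) w) = (- 1) \<odot> (y \<otimes> (w \<otimes> x)) \<oplus> (x \<otimes> y) \<otimes> w"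
      using c by (simp add: act_def mult_assoc a_comm)
    moreover have "symm ?a ys ((- 1) \<odot> (y \<otimes> (w \<otimes> x)) \<oplus> (x \<otimes> y) \<otimes> w)
        = (- 1) \<odot> symm ?a ys (y \<otimes> (w \<otimes> x)) \<oplus> symm ?a ys ((x \<otimes> y) \<otimes> w)"
      using ys w xy by (intro symm_lin) auto
    ultimately show ?thesis
      using sub_self cl[of "y \<otimes> (w \<otimes> x)" ?a] w xy by (simp add: 2[unfolded w_def] w_def)
  qed
  let ?block = "map (Pair Lft) xs' @ map (Pair Rgt) ls' @ map (Pair Dif) ds'"
  have block_even: "\<forall>p\<in>set ?block. snd p \<in> homog A 0" using even(4) by auto
  have w: "acts ops z \<in> homog A 1" using ops Suc.prems(8) by (rule acts_closed)
  consider "\<exists>i\<le>d. a i \<noteq> 0" | "\<exists>i\<le>d. a (Suc i) \<noteq> 0"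
  proof -
    obtain i where "i \<le> Suc d" "a i \<noteq> 0" using Suc.prems(1) by blast
    then show ?thesis using that by (cases i) auto
  qed
  then show ?case
  proof cases
    case 1
    have "acts ?block (acts ((Dif, d0) # (Rgt, l0) # ops) z) = \<zero>"
      by (rule Suc.IH[OF 1]) (use ops even lens key Suc.prems(8) in auto)
    moreover have "acts (map (Pair Lft) xs @ map (Pair Rgt) ls @ map (Pair Dif) ds) (acts ops z)
        = acts ((Lft, x0) # ?block @ [(Dif, d0), (Rgt, l0)]) (acts ops z)"
      by (rule acts_mset_cong) (use Suc.prems(7) w lists in auto)
    ultimately show ?thesis using even by (simp add: act_zero)
  next
    case 2
    have "acts ?block (acts ((Dif, d0) # (Lft, x0) # ops) z) = \<zero>"
      by (rule Suc.IH[OF 2]) (use ops even lens key Suc.prems(8) in auto)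
    moreover have "acts (map (Pair Lft) xs @ map (Pair Rgt) ls @ map (Pair Dif) ds) (acts ops z)
        = acts ((Rgt, l0) # ?block @ [(Dif, d0), (Lft, x0)]) (acts ops z)"
      by (rule acts_mset_cong) (use Suc.prems(7) w lists in auto)
    ultimately show ?thesis using even by (simp add: act_zero)
  qed
qed

lemma commutator_identity_of_odd:
  assumes "\<exists>i\<le>d. a i \<noteq> 0"
    and "\<And>y z. y \<in> homog A 0 \<Longrightarrow> z \<in> homog A 1 \<Longrightarrow> symm a (replicate d y) z = \<zero>"
  shows "commutator_identity d"
proof (rule commutator_identityI)
  fix xs ys ds z
  assume "length xs = d" "length ys = d" "length ds = d" "set (xs @ ys @ ds) \<subseteq> homog A 0" "z \<in> homog A 1"
  then show "acts (map (Pair Lft) xs @ map (Pair Rgt) ys @ map (Pair Dif) ds) z = \<zero>"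
    using commutator_extraction[OF assms(1), of "[]" xs ys ds z] symm_polarised[OF assms(2)] by simp
qed

lemma acts_Lft: "xs \<noteq> [] \<Longrightarrow> set xs \<subseteq> homog A 0 \<Longrightarrow> z \<in> homog A 1 \<Longrightarrow> acts (map (Pair Lft) xs) z = mprod xs \<otimes> z"
proof (induction xs)
  case (Cons x xs)
  have "set xs \<subseteq> homog A 0" "x \<in> homog A 0" using Cons.prems by simp_all
  note h = this homog_closed[OF this(2)] homog_closed[OF Cons.prems(3)] homog_closed[OF mprod_even[OF this(1)]]
  show ?case
  proof (cases "xs = []")
    case False
    then show ?thesis using Cons.IH[OF False h(1) Cons.prems(3)] h(3-5) by (simp add: act_def mprod_Cons mult_assoc)
  qed (simp add: act_def)
qed simp

lemma acts_Rgt: "xs \<noteq> [] \<Longrightarrow> set xs \<subseteq> homog A 0 \<Longrightarrow> z \<in> homog A 1 \<Longrightarrow> acts (map (Pair Rgt) xs) z = z \<otimes> mprod xs"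
proof (induction xs)
  case (Cons x xs)
  have "set xs \<subseteq> homog A 0" "x \<in> homog A 0" using Cons.prems by simp_all
  note h = this homog_closed[OF this(2)] homog_closed[OF Cons.prems(3)] homog_closed[OF mprod_even[OF this(1)]]
  show ?case
  proof (cases "xs = []")
    case False
    then show ?thesis
      using Cons.IH[OF False h(1) Cons.prems(3)] h(3-5) even_commute[OF h(2) mprod_even[OF h(1)]]
      by (simp add: act_def mprod_Cons mult_assoc)
  qed (simp add: act_def)
qed simp

text \<open>
  If \<open>\<alpha> \<omega> \<noteq> 0\<close>, then \<open>\<alpha> \<omega> y\<^sub>1 \<dots> y\<^sub>d z = y\<^sub>1 \<dots> y\<^sub>d \<omega> z = \<omega> y\<^sub>1 \<dots> y\<^sub>d z = 0\<close> for all odd \<open>z\<close>; if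
  \<open>\<beta> \<omega> \<noteq> 0\<close>, then \<open>z y\<^sub>1 \<dots> y\<^sub>d = 0\<close> in the same way.
\<close>

lemma commutator_identity_of_even:
  assumes \<omega>: "\<alpha> \<omega> \<noteq> 0 \<or> \<beta> \<omega> \<noteq> 0"
    and diag: "\<And>y. y \<in> homog A 0 \<Longrightarrow> lact A \<omega> (mprod (replicate (Suc d) y)) = \<zero>"
  shows "commutator_identity (Suc d)"
proof (rule commutator_identityI)
  fix xs ys ds z
  assume lens: "length xs = Suc d" "length ys = Suc d" "length ds = Suc d"
    and even: "set (xs @ ys @ ds) \<subseteq> homog A 0" and z: "z \<in> homog A 1"
  have zero: "lact A \<omega> (mprod us) = \<zero>" if us: "length us = Suc d" "set us \<subseteq> homog A 0" for us
  proof (rule polarisation[where G = "\<lambda>us. lact A \<omega> (mprod us)" and d = "Suc d"])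
    fix vs :: "'a list" assume vs: "set vs \<subseteq> homog A 0"
    then have P: "mprod vs \<in> carrier A" by (intro homog_closed[OF mprod_even])
    then show "lact A \<omega> (mprod vs) \<in> carrier A" by simp
    show "lact A \<omega> (mprod vs) = lact A \<omega> (mprod vs')" if "mset vs = mset vs'" for vs'
      using mprod_mset_cong[OF that vs] by simp
    show "lact A \<omega> (mprod ((t \<odot> x \<oplus> y) # vs)) = t \<odot> lact A \<omega> (mprod (x # vs)) \<oplus> lact A \<omega> (mprod (y # vs))"
      if "x \<in> homog A 0" "y \<in> homog A 0" for t x y
      using that P by (cases "vs = []")
        (simp_all add: mprod_Cons mult_add_left mult_smult_left lact_add lact_smult)
  qed (rule diag us | assumption)+
  have sub: "set xs \<subseteq> homog A 0" "set ys \<subseteq> homog A 0" "set ds \<subseteq> homog A 0" using even by auto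
  have ne: "xs \<noteq> []" "ys \<noteq> []" using lens by auto
  let ?w = "acts (map (Pair Dif) ds) z"
  have w: "?w \<in> homog A 1" using sub z by (intro acts_closed) auto
  have evens: "\<forall>p\<in>set (map (Pair Lft) xs). snd p \<in> homog A 0" "\<forall>p\<in>set (map (Pair Rgt) ys). snd p \<in> homog A 0"
    using sub by auto
  have P: "mprod us \<in> homog A 0" "mprod us \<in> carrier A" if "set us \<subseteq> homog A 0" for us
    using mprod_even[OF that] homog_closed by blast+
  show "acts (map (Pair Lft) xs @ map (Pair Rgt) ys @ map (Pair Dif) ds) z = \<zero>"
  proof (cases "\<alpha> \<omega> = 0")
    case False
    let ?v = "acts (map (Pair Rgt) ys) ?w"
    have v: "?v \<in> homog A 1" using evens(2) w by (rule acts_closed)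
    have "\<alpha> \<omega> \<odot> (mprod xs \<otimes> ?v) = mprod xs \<otimes> lact A \<omega> ?v"
      using v P[OF sub(1)] by (simp add: lact_odd mult_smult_right)
    also have "\<dots> = ract A (mprod xs) \<omega> \<otimes> ?v" using v P[OF sub(1)] by (simp add: ract_mult_lact)
    also have "\<dots> = \<zero>" using v P[OF sub(1)] zero[OF lens(1) sub(1)] by (simp add: ract_even)
    finally have "mprod xs \<otimes> ?v = \<zero>" 
      using smult_eq_zero[of "mprod xs \<otimes> ?v" "\<alpha> \<omega>"] False v P[OF sub(1)] by simp
    then show ?thesis using acts_Lft[OF ne(1) sub(1) v] by simp
  next
    case True
    have "\<beta> \<omega> \<odot> (?w \<otimes> mprod ys) = ract A ?w \<omega> \<otimes> mprod ys"
      using w P[OF sub(2)] by (simp add: ract_odd mult_smult_left)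
    also have "\<dots> = \<zero>" using w P[OF sub(2)] zero[OF lens(2) sub(2)] by (simp add: ract_mult_lact)
    finally have "?w \<otimes> mprod ys = \<zero>" 
      using smult_eq_zero[of "?w \<otimes> mprod ys" "\<beta> \<omega>"] True \<omega> w P[OF sub(2)] by simp
    then have "acts (map (Pair Rgt) ys) ?w = \<zero>" using acts_Rgt[OF ne(2) sub(2) w] by simp
    then show ?thesis using acts_zero[OF evens(1)] by simp
  qed
qed

text \<open>
  On the diagonal, the forms with a single nonzero coefficient are multiples of the monomials \<open>y\<^sup>i z y\<^sup>n\<^sup>-\<^sup>i\<close>.
\<close>

lemma symm_delta:
  assumes y: "y \<in> homog A 0" and "z \<in> homog A 1"
  shows "symm (\<lambda>l. if l = i then c else 0) (replicate n y) z
    = (c * of_nat (n choose i)) \<odot> acts (replicate i (Lft, y) @ replicate (n - i) (Rgt, y)) z"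
  using assms(2)
proof (induction n arbitrary: i z)
  case 0
  then have "acts (replicate i (Lft, y)) z \<in> carrier A" using y by (intro homog_closed[OF acts_closed]) auto
  then show ?case using 0 by (cases i) simp_all
next
  case (Suc n)
  have even: "\<forall>p\<in>set (replicate i (Lft, y) @ replicate j (Rgt, y)). snd p \<in> homog A 0" for i j
    using y by (auto dest: in_set_replicate[THEN iffD1])
  have cl: "acts (replicate i (Lft, y) @ replicate j (Rgt, y)) v \<in> carrier A" if "v \<in> homog A 1" for i j v
    by (rule homog_closed[OF acts_closed[OF even that]])
  have L: "acts (replicate i (Lft, y) @ replicate j (Rgt, y)) (y \<otimes> z) = acts (replicate (Suc i) (Lft, y) @ replicate j (Rgt, y)) z" for i j
    using acts_act[OF even, of "(Lft, y)" z i j] y Suc.prems by (simp add: act_def)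
  have R: "acts (replicate i (Lft, y) @ replicate j (Rgt, y)) (z \<otimes> y) = acts (replicate i (Lft, y) @ replicate (Suc j) (Rgt, y)) z" for i j
  proof -
    have "acts (replicate i (Lft, y) @ replicate j (Rgt, y)) (z \<otimes> y) = acts ((replicate i (Lft, y) @ replicate j (Rgt, y)) @ [(Rgt, y)]) z"
      by (simp add: act_def)
    also have "\<dots> = acts (replicate i (Lft, y) @ replicate (Suc j) (Rgt, y)) z"
      by (rule acts_mset_cong) (use y Suc.prems in auto)
    finally show ?thesis .
  qed
  have yz: "y \<otimes> z \<in> homog A 1" "z \<otimes> y \<in> homog A 1" using y Suc.prems by auto
  show ?case
  proof (cases i)
    case 0
    have "symm (\<lambda>l. 0) (replicate n y) (y \<otimes> z) = \<zero>" using y yz by (intro symm_zero) auto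
    then show ?thesis using Suc.IH[OF yz(2), of 0] R[of 0 n] cl[OF Suc.prems, of 0 "Suc n"] by (simp add: 0)
  next
    case (Suc k)
    let ?T = "acts (replicate (Suc k) (Lft, y) @ replicate (n - k) (Rgt, y)) z"
    have "symm (\<lambda>l. if Suc l = i then c else 0) (replicate n y) (y \<otimes> z) = (c * of_nat (n choose k)) \<odot> ?T"
      using Suc.IH[OF yz(1), of k] L[of k "n - k"] by (simp add: Suc)
    moreover have "symm (\<lambda>l. if l = i then c else 0) (replicate n y) (z \<otimes> y) = (c * of_nat (n choose Suc k)) \<odot> ?T"
    proof (cases "Suc k \<le> n")
      case True
      then have "Suc (n - Suc k) = n - k" by simp
      then show ?thesis using Suc.IH[OF yz(2), of "Suc k"] R[of "Suc k" "n - Suc k"] by (simp only: Suc)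
    next
      case False
      then show ?thesis
        using Suc.IH[OF yz(2), of "Suc k"] cl[OF yz(2), of "Suc k" "n - Suc k"] cl[OF Suc.prems, of "Suc k" "n - k"]
        by (simp only: Suc) (simp add: binomial_eq_0)
    qed
    ultimately have "symm (\<lambda>l. if l = i then c else 0) (replicate (Suc n) y) z
        = (c * of_nat (n choose k) + c * of_nat (n choose Suc k)) \<odot> ?T"
      using cl[OF Suc.prems, of "Suc k" "n - k"] by (simp only: replicate_Suc symm.simps smult_add')
    then show ?thesis by (simp add: Suc algebra_simps)
  qed
qed

end

section \<open>Generic substitutions\<close>

context triangular_W_algebra
begin

lemma lact_zero_left [simp]: "x \<in> carrier A \<Longrightarrow> lact A 0 x = \<zero>"
  using lact_scale[of x 0 0] by simp

lemma symm_zero_arg: "set ys \<subseteq> homog A 0 \<Longrightarrow> symm a ys \<zero> = \<zero>"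
  by (induction ys arbitrary: a) auto

lemma symm_smult:
  assumes "set ys \<subseteq> homog A 0" "z \<in> homog A 1"
  shows "symm a ys (t \<odot> z) = t \<odot> symm a ys z"
  using symm_lin[OF assms homog_zero, of a t] homog_closed[OF symm_closed[OF assms]] assms symm_zero_arg
  by simp

lemma mprod_smult: "y \<in> homog A 0 \<Longrightarrow> mprod (replicate (Suc d) (t \<odot> y)) = t ^ Suc d \<odot> mprod (replicate (Suc d) y)"
proof (induction d)
  case (Suc d)
  have "mprod (replicate (Suc d) y) \<in> carrier A" "y \<in> carrier A"
    using Suc.prems by (auto intro!: homog_closed[OF mprod_even])
  then show ?case using Suc.IH[OF Suc.prems]
    by (simp del: replicate_Suc add: replicate_Suc[of "Suc d"] mprod_Cons mult_smult_left mult_smult_right smult_smult mult_ac)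
qed simp

lemma symm_replicate_smult:
  "y \<in> homog A 0 \<Longrightarrow> z \<in> homog A 1 \<Longrightarrow> symm a (replicate d (t \<odot> y)) z = t ^ d \<odot> symm a (replicate d y) z"
proof (induction d arbitrary: a z)
  case 0
  then show ?case by simp
next
  case (Suc d)
  have c: "y \<in> carrier A" "z \<in> carrier A" using Suc.prems homog_closed by blast+
  have e: "set (replicate d (t \<odot> y)) \<subseteq> homog A 0" "set (replicate d y) \<subseteq> homog A 0" using Suc.prems by auto
  have yz: "y \<otimes> z \<in> homog A 1" "z \<otimes> y \<in> homog A 1" using Suc.prems by auto
  show ?case
    using c Suc.IH[OF Suc.prems(1) yz(1)] Suc.IH[OF Suc.prems(1) yz(2)]
      symm_smult[OF e(1) yz(1)] symm_smult[OF e(1) yz(2)]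
      homog_closed[OF symm_closed[OF e(2) yz(1)]] homog_closed[OF symm_closed[OF e(2) yz(2)]]
    by (simp add: mult_smult_left mult_smult_right smult_add smult_smult)
qed

lemma horner_zero: "\<forall>m\<in>set ms. m = \<zero> \<Longrightarrow> horner ms t = \<zero>"
  by (induction ms) auto

lemma horner_map_smult: "set ms \<subseteq> carrier A \<Longrightarrow> horner (map (smult A c) ms) t = c \<odot> horner ms t"
  by (induction ms) (simp_all add: smult_add smult_smult mult.commute)

end

text \<open>
  Substituting polynomials in one even element \<open>y\<close> for the even variables and multiples of one odd
  element \<open>z\<close> for the odd ones turns every element of the free algebra into a linear combination
  of the elements \<open>\<omega> y\<^sup>j\<^sup>+\<^sup>1\<close> and \<open>y\<^sup>i z y\<^sup>j\<close>, with coefficients that do not depend on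
  the algebra. The locale collects the computation rules for these elements.
\<close>

locale even_odd_pair = triangular_W_algebra scaleW gradeW A \<alpha> \<beta> e1 e2
  for scaleW :: "'f::field_char_0 \<Rightarrow> 'w::ring_1 \<Rightarrow> 'w" and gradeW :: "bit \<Rightarrow> 'w set"
    and A :: "('f, 'w, 'a) walg" (structure) and \<alpha> \<beta> :: "'w \<Rightarrow> 'f" and e1 e2 :: 'w +
  fixes y z :: 'a
  assumes y: "y \<in> homog A 0" and z: "z \<in> homog A 1"
begin

lemmas y_closed [simp] = homog_closed[OF y]
lemmas z_closed [simp] = homog_closed[OF z]

lemmas y_linear = mult_closed[OF y_closed] mult_add_right[OF _ _ y_closed] mult_smult_right[OF y_closed]
lemmas z_linear = mult_closed[OF z_closed] mult_add_right[OF _ _ z_closed] mult_smult_right[OF z_closed]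

definition even_power :: "nat \<Rightarrow> 'a"
  where "even_power j = mprod (replicate (Suc j) y)"

definition odd_word :: "nat \<Rightarrow> nat \<Rightarrow> 'a"
  where "odd_word i j = acts (replicate i (Lft, y) @ replicate j (Rgt, y)) z"

lemma replicate_y [simp]: "set (replicate j y) \<subseteq> homog A 0"
  using y by auto

lemma even_power [simp]: "even_power j \<in> homog A 0"
  unfolding even_power_def by (rule mprod_even) (rule replicate_y)

lemmas even_power_closed [simp] = homog_closed[OF even_power]

lemma odd_word [simp]: "odd_word i j \<in> homog A 1"
  unfolding odd_word_def using y z by (intro acts_closed) auto

lemmas odd_word_closed [simp] = homog_closed[OF odd_word]

lemma lact_even_power: "lact A w (lact A \<omega> (even_power j)) = lact A (w * \<omega>) (even_power j)"
  by (simp add: lact_times)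

lemma lact_odd_word: "lact A w (odd_word i j) = \<alpha> w \<odot> odd_word i j"
  by (simp add: lact_odd)

lemma y_mult_even_power: "y \<otimes> lact A \<omega> (even_power j) = lact A \<omega> (even_power (Suc j))"
proof -
  have "y \<otimes> lact A \<omega> (even_power j) = lact A \<omega> (y \<otimes> even_power j)"
    using y by (simp add: ract_even lact_mult flip: ract_mult_lact)
  then show ?thesis by (simp add: even_power_def)
qed

lemma y_mult_odd_word: "y \<otimes> odd_word i j = odd_word (Suc i) j"
  by (simp add: odd_word_def act_def)

lemma z_mult_even_power: "z \<otimes> lact A \<omega> (even_power j) = \<beta> \<omega> \<odot> odd_word 0 (Suc j)"
proof -
  have "z \<otimes> lact A \<omega> (even_power j) = \<beta> \<omega> \<odot> (z \<otimes> even_power j)"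
    using z by (simp add: ract_odd mult_smult_left flip: ract_mult_lact)
  also have "z \<otimes> even_power j = acts (map (Pair Rgt) (replicate (Suc j) y)) z"
    unfolding even_power_def using y z by (intro acts_Rgt[symmetric]) auto
  finally show ?thesis by (simp add: odd_word_def)
qed

lemma z_mult_odd_word: "z \<otimes> odd_word i j = \<zero>"
  by (rule odd_odd[OF z odd_word])

fun subst :: "(nat \<Rightarrow> 'f) \<Rightarrow> (nat \<Rightarrow> 'f) \<Rightarrow> (nat \<Rightarrow> 'f) \<Rightarrow> gvar \<Rightarrow> 'a" where
  "subst p q c (Y i) = p i \<odot> y \<oplus> q i \<odot> (y \<otimes> y)"
| "subst p q c (Z i) = c i \<odot> z"

lemma subst_admissible: "admissible A (subst p q c)"
proof
  fix x show "subst p q c x \<in> homog A (vdeg x)" using y z by (cases x) auto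
qed

lemma subst_mult:
  assumes "u \<in> carrier A"
  shows "subst p q c (Y i) \<otimes> u = p i \<odot> (y \<otimes> u) \<oplus> q i \<odot> (y \<otimes> (y \<otimes> u))"
    "subst p q c (Z i) \<otimes> u = c i \<odot> (z \<otimes> u)"
  using assms by (simp_all add: mult_add_left mult_smult_left mult_assoc)

lemma ract_subst:
  "ract A (subst p q c (Y i)) w = p i \<odot> lact A w (even_power 0) \<oplus> q i \<odot> lact A w (even_power 1)"
  "ract A (subst p q c (Z i)) w = (c i * \<beta> w) \<odot> odd_word 0 0"
  using y z by (simp_all add: even_power_def odd_word_def ract_even ract_odd ract_smult lact_add lact_smult
    smult_smult mult.commute)

lemma eval_word_subst_Cons:
  "us \<noteq> [] \<Longrightarrow> eval_word A (subst p q c) ((u, w) # us) = subst p q c u \<otimes> lact A w (eval_word A (subst p q c) us)"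
proof -
  assume "us \<noteq> []"
  moreover have "subst p q c u \<in> carrier A" using subst_admissible homog_closed by blast
  ultimately show ?thesis
    using eval_word_closed[OF subst_admissible] by (simp add: eval_word_Cons ract_mult_lact)
qed

text \<open>
  The homogeneous component of degree \<open>d + 1\<close> of a combination of the elements above; its odd
  part is written as a value of the symmetric form \<open>symm\<close>, since that is what polarisation needs.
\<close>

definition component :: "nat \<Rightarrow> 'w \<times> (nat \<Rightarrow> 'f) \<Rightarrow> 'a"
  where "component d c = lact A (fst c) (even_power d) \<oplus> symm (snd c) (replicate d y) z"

fun components :: "nat \<Rightarrow> ('w \<times> (nat \<Rightarrow> 'f)) list \<Rightarrow> 'a list" where
  "components d [] = []"
| "components d (c # cs) = component d c # components (Suc d) cs"

lemma set_components: "set (components d cs) = {component (d + k) (cs ! k) | k. k < length cs}"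
proof (induction cs arbitrary: d)
  case (Cons c cs)
  have "{component (d + k) ((c # cs) ! k) | k. k < length (c # cs)}
      = insert (component d c) {component (Suc d + k) (cs ! k) | k. k < length cs}"
    (is "?L = ?R")
  proof
    show "?L \<subseteq> ?R"
    proof
      fix x assume "x \<in> ?L"
      then obtain k where "x = component (d + k) ((c # cs) ! k)" "k < Suc (length cs)" by auto
      then show "x \<in> ?R" by (cases k) auto
    qed
    show "?R \<subseteq> ?L" by (auto intro: exI[of _ 0] exI[of _ "Suc _"])
  qed
  then show ?case using Cons.IH[of "Suc d"] by simp
qed simp

lemmas symm_power = symm_closed[OF replicate_y z] homog_closed[OF symm_closed[OF replicate_y z]]

lemma component_closed [simp]: "component d c \<in> carrier A"
  unfolding component_def by (intro a_closed lact_closed even_power_closed symm_power)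

lemma components_closed [simp]: "set (components d cs) \<subseteq> carrier A"
  by (auto simp: set_components)

fun coeffs_add :: "('w \<times> (nat \<Rightarrow> 'f)) list \<Rightarrow> ('w \<times> (nat \<Rightarrow> 'f)) list \<Rightarrow> ('w \<times> (nat \<Rightarrow> 'f)) list" where
  "coeffs_add [] ds = ds"
| "coeffs_add (c # cs) [] = c # cs"
| "coeffs_add (c # cs) (d # ds) = (fst c + fst d, \<lambda>i. snd c i + snd d i) # coeffs_add cs ds"

lemma components_coeffs_add:
  "components k (coeffs_add cs ds) = coeff_add (components k cs) (components k ds)"
proof -
  have "component k (fst c + fst d, \<lambda>i. snd c i + snd d i) = component k c \<oplus> component k d" for k c d
    using symm_coeff_lin[OF replicate_y z, of 1 "snd c" "snd d" k] symm_power
    by (simp add: component_def lact_plus a_ac)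
  then show ?thesis
    by (induction cs ds arbitrary: k rule: coeffs_add.induct) simp_all
qed

lemma component_zero: "component d (0, \<lambda>_. 0) = \<zero>"
  using symm_zero[OF _ replicate_y z, of d "\<lambda>_. 0"] by (simp add: component_def)

lemma components_smult:
  "components k (map (\<lambda>c. (scaleW t (fst c), \<lambda>i. t * snd c i)) cs) = map (smult A t) (components k cs)"
proof -
  have "component k (scaleW t (fst c), \<lambda>i. t * snd c i) = t \<odot> component k c" for k c
    using symm_coeff_lin[OF replicate_y z, of t "snd c" "\<lambda>_. 0" k] symm_power
      symm_zero[OF _ replicate_y z, of k "\<lambda>_. 0"]
    by (simp add: component_def lact_scale smult_add)
  then show ?thesis by (induction cs arbitrary: k) simp_all
qed

lemma horner_single_component: "horner (components d (replicate j (0, \<lambda>_. 0) @ [c])) 1 = component (d + j) c"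
  by (induction j arbitrary: d) (simp_all add: component_zero)

lemma component_even: "component j (\<omega>, \<lambda>_. 0) = lact A \<omega> (even_power j)"
  using symm_zero[OF _ replicate_y z, of j "\<lambda>_. 0"] by (simp add: component_def)

lemma component_odd:
  "component (i + j) (0, \<lambda>l. if l = i then inverse (of_nat ((i + j) choose i)) else 0) = odd_word i j"
proof -
  have "(of_nat ((i + j) choose i) :: 'f) \<noteq> 0" by (simp add: binomial_eq_0_iff)
  then show ?thesis
    using symm_delta[OF y z, of i "inverse (of_nat ((i + j) choose i))" "i + j"] odd_word_closed[of i j]
    by (simp add: component_def odd_word_def)
qed

lemma even_odd_pair_smult: "even_odd_pair scaleW gradeW A \<alpha> \<beta> e1 e2 (t \<odot> y) (t \<odot> z)"
  using y z by unfold_locales simp_all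

text \<open>
  Multiplying \<open>y\<close> and \<open>z\<close> by \<open>t\<close> multiplies the component of degree \<open>d + 1\<close> by \<open>t\<^sup>d\<^sup>+\<^sup>1\<close>, so the sum
  of the components becomes a polynomial in \<open>t\<close> with the components as coefficients.
\<close>

lemma horner_components_dilate:
  "horner (even_odd_pair.components A (t \<odot> y) (t \<odot> z) d cs) 1 = t ^ Suc d \<odot> horner (components d cs) t"
proof -
  interpret dilated: even_odd_pair scaleW gradeW A \<alpha> \<beta> e1 e2 "t \<odot> y" "t \<odot> z" by (rule even_odd_pair_smult)
  have comp: "dilated.component d c = t ^ Suc d \<odot> component d c" for d c
  proof -
    have "symm (snd c) (replicate d (t \<odot> y)) (t \<odot> z) = t \<odot> (t ^ d \<odot> symm (snd c) (replicate d y) z)"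
      using symm_smult[OF dilated.replicate_y z] symm_replicate_smult[OF y z] by simp
    moreover have "dilated.even_power d = t ^ Suc d \<odot> even_power d"
      unfolding dilated.even_power_def even_power_def by (rule mprod_smult[OF y])
    ultimately show ?thesis
      using symm_power by (simp add: component_def dilated.component_def smult_add smult_smult lact_smult)
  qed
  show ?thesis
    by (induction cs arbitrary: d) (simp_all add: comp smult_add smult_smult mult.commute)
qed

end

context
  fixes scaleW :: "'f::field_char_0 \<Rightarrow> 'w::ring_1 \<Rightarrow> 'w" and gradeW :: "bit \<Rightarrow> 'w set"
    and \<alpha> \<beta> :: "'w \<Rightarrow> 'f" and e1 e2 :: 'w
begin

abbreviation pair :: "('f, 'w, 'a) walg \<Rightarrow> 'a \<Rightarrow> 'a \<Rightarrow> bool"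
  where "pair A y z \<equiv> even_odd_pair scaleW gradeW A \<alpha> \<beta> e1 e2 y z"

text \<open>
  The functions of a pair, in all algebras at once, that are combinations with fixed coefficients
  of the elements \<open>\<omega> y\<^sup>j\<^sup>+\<^sup>1\<close> and \<open>y\<^sup>i z y\<^sup>j\<close>. Uniformity in the algebra is what
  lets a nonzero value in one algebra refute the triviality of an identity in another.
\<close>

inductive form :: "(('f, 'w, 'a) walg \<Rightarrow> 'a \<Rightarrow> 'a \<Rightarrow> 'a) \<Rightarrow> bool" where
  zero: "(\<And>A y z. pair A y z \<Longrightarrow> F A y z = \<zero>\<^bsub>A\<^esub>) \<Longrightarrow> form F"
| even_term: "(\<And>A y z. pair A y z \<Longrightarrow> F A y z = lact A \<omega> (even_odd_pair.even_power A y j)) \<Longrightarrow> form F"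
| odd_term: "(\<And>A y z. pair A y z \<Longrightarrow> F A y z = even_odd_pair.odd_word A y z i j) \<Longrightarrow> form F"
| add: "form F1 \<Longrightarrow> form F2 \<Longrightarrow> (\<And>A y z. pair A y z \<Longrightarrow> F A y z = F1 A y z \<oplus>\<^bsub>A\<^esub> F2 A y z) \<Longrightarrow> form F"
| smult: "form F1 \<Longrightarrow> (\<And>A y z. pair A y z \<Longrightarrow> F A y z = c \<odot>\<^bsub>A\<^esub> F1 A y z) \<Longrightarrow> form F"

lemma form_closed:
  assumes "form F" "pair A y z"
  shows "F A y z \<in> carrier A"
proof -
  interpret even_odd_pair scaleW gradeW A \<alpha> \<beta> e1 e2 y z by (rule assms(2))
  show ?thesis using assms(1)
    by induction (simp_all only: assms(2) zero_closed a_closed smult_closed' lact_closed even_power_closed odd_word_closed)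
qed

lemma form_cong:
  assumes "form F" "\<And>A y z. pair A y z \<Longrightarrow> F' A y z = F A y z"
  shows "form F'"
proof (rule form.smult[OF assms(1), where c = 1])
  fix A :: "('f, 'w, 'a) walg" and y z assume p: "pair A y z"
  then interpret even_odd_pair scaleW gradeW A \<alpha> \<beta> e1 e2 y z .
  show "F' A y z = 1 \<odot>\<^bsub>A\<^esub> F A y z" using assms(2)[OF p] form_closed[OF assms(1) p] by simp
qed

text \<open>
  Words are evaluated from the right by operations that are linear in the rest of the word, and it suffices to
  know how such an operation acts on the spanning elements.
\<close>

lemma form_linear_image:
  fixes T :: "('f, 'w, 'a) walg \<Rightarrow> 'a \<Rightarrow> 'a \<Rightarrow> 'a \<Rightarrow> 'a"
  assumes F: "form F"
    and closed: "\<And>A y z u. pair A y z \<Longrightarrow> u \<in> carrier A \<Longrightarrow> T A y z u \<in> carrier A"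
    and additive: "\<And>A y z u v. pair A y z \<Longrightarrow> u \<in> carrier A \<Longrightarrow> v \<in> carrier A
      \<Longrightarrow> T A y z (u \<oplus>\<^bsub>A\<^esub> v) = T A y z u \<oplus>\<^bsub>A\<^esub> T A y z v"
    and homogeneous: "\<And>A y z c u. pair A y z \<Longrightarrow> u \<in> carrier A \<Longrightarrow> T A y z (c \<odot>\<^bsub>A\<^esub> u) = c \<odot>\<^bsub>A\<^esub> T A y z u"
    and even: "\<And>\<omega> j. form (\<lambda>A y z. T A y z (lact A \<omega> (even_odd_pair.even_power A y j)))"
    and odd: "\<And>i j. form (\<lambda>A y z. T A y z (even_odd_pair.odd_word A y z i j))"
  shows "form (\<lambda>A y z. T A y z (F A y z))"
  using F
proof induction
  case (zero F)
  note vanish = this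
  show ?case
  proof (rule form.zero)
    fix A :: "('f, 'w, 'a) walg" and y z assume p: "pair A y z"
    then interpret even_odd_pair scaleW gradeW A \<alpha> \<beta> e1 e2 y z .
    show "T A y z (F A y z) = \<zero>\<^bsub>A\<^esub>"
      using vanish[OF p] homogeneous[OF p zero_closed, of 0] closed[OF p zero_closed] by simp
  qed
next
  case (even_term F \<omega> j)
  show ?case by (rule form_cong[OF even]) (simp only: even_term)
next
  case (odd_term F i j)
  show ?case by (rule form_cong[OF odd]) (simp only: odd_term)
next
  case (add F1 F2 F)
  show ?case
    by (rule form.add[OF add.IH]) (simp only: add.hyps(3) additive form_closed[OF add.hyps(1)] form_closed[OF add.hyps(2)])
next
  case (smult F1 F c)
  show ?case
    by (rule form.smult[OF smult.IH]) (simp only: smult.hyps(2) homogeneous form_closed[OF smult.hyps(1)])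
qed

lemma form_even_power: "form (\<lambda>A y z. lact A w (even_odd_pair.even_power A y j))"
  by (rule form.even_term) (rule refl)

lemma form_odd_word: "form (\<lambda>A y z. even_odd_pair.odd_word A y z i j)"
  by (rule form.odd_term) (rule refl)

lemma form_lact: "form F \<Longrightarrow> form (\<lambda>A y z. lact A w (F A y z))"
proof (erule form_linear_image)
  show "form (\<lambda>(A :: ('f, 'w, 'a) walg) y z. lact A w (lact A \<omega> (even_odd_pair.even_power A y j)))" for \<omega> j
    by (rule form_cong[OF form_even_power]) (rule even_odd_pair.lact_even_power)
  show "form (\<lambda>(A :: ('f, 'w, 'a) walg) y z. lact A w (even_odd_pair.odd_word A y z i j))" for i j
    by (rule form.smult[OF form_odd_word]) (rule even_odd_pair.lact_odd_word)
qed (unfold even_odd_pair_def triangular_W_algebra_def,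
  auto intro: graded_W_algebra.lact_closed graded_W_algebra.lact_add graded_W_algebra.lact_smult)

lemma form_y_mult: "form F \<Longrightarrow> form (\<lambda>A y z. y \<otimes>\<^bsub>A\<^esub> F A y z)"
proof (erule form_linear_image)
  show "form (\<lambda>(A :: ('f, 'w, 'a) walg) y z. y \<otimes>\<^bsub>A\<^esub> lact A \<omega> (even_odd_pair.even_power A y j))" for \<omega> j
    by (rule form_cong[OF form_even_power]) (rule even_odd_pair.y_mult_even_power)
  show "form (\<lambda>(A :: ('f, 'w, 'a) walg) y z. y \<otimes>\<^bsub>A\<^esub> even_odd_pair.odd_word A y z i j)" for i j
    by (rule form_cong[OF form_odd_word]) (rule even_odd_pair.y_mult_odd_word)
qed (rule even_odd_pair.y_linear; assumption)+

lemma form_z_mult: "form F \<Longrightarrow> form (\<lambda>A y z. z \<otimes>\<^bsub>A\<^esub> F A y z)"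
proof (erule form_linear_image)
  show "form (\<lambda>(A :: ('f, 'w, 'a) walg) y z. z \<otimes>\<^bsub>A\<^esub> lact A \<omega> (even_odd_pair.even_power A y j))" for \<omega> j
    by (rule form.smult[OF form_odd_word]) (rule even_odd_pair.z_mult_even_power)
  show "form (\<lambda>(A :: ('f, 'w, 'a) walg) y z. z \<otimes>\<^bsub>A\<^esub> even_odd_pair.odd_word A y z i j)" for i j
    by (rule form.zero) (rule even_odd_pair.z_mult_odd_word)
qed (rule even_odd_pair.z_linear; assumption)+

abbreviation pair_subst :: "(nat \<Rightarrow> 'f) \<Rightarrow> (nat \<Rightarrow> 'f) \<Rightarrow> (nat \<Rightarrow> 'f) \<Rightarrow> ('f, 'w, 'a) walg \<Rightarrow> 'a \<Rightarrow> 'a \<Rightarrow> gvar \<Rightarrow> 'a"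
  where "pair_subst p q c A y z \<equiv> even_odd_pair.subst A y z p q c"

lemma form_subst_mult:
  assumes "form F"
  shows "form (\<lambda>A y z. pair_subst p q c A y z u \<otimes>\<^bsub>A\<^esub> F A y z)"
proof (cases u)
  case (Y i)
  have 1: "form (\<lambda>A y z. p i \<odot>\<^bsub>A\<^esub> (y \<otimes>\<^bsub>A\<^esub> F A y z))"
    by (rule form.smult[OF form_y_mult[OF assms]]) (rule refl)
  have 2: "form (\<lambda>A y z. q i \<odot>\<^bsub>A\<^esub> (y \<otimes>\<^bsub>A\<^esub> (y \<otimes>\<^bsub>A\<^esub> F A y z)))"
    by (rule form.smult[OF form_y_mult[OF form_y_mult[OF assms]]]) (rule refl)
  show ?thesis
    unfolding Y by (rule form.add[OF 1 2]) (rule even_odd_pair.subst_mult(1)[OF _ form_closed[OF assms]])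
next
  case (Z i)
  show ?thesis
    unfolding Z by (rule form.smult[OF form_z_mult[OF assms]])
      (rule even_odd_pair.subst_mult(2)[OF _ form_closed[OF assms]])
qed

lemma form_letter: "form (\<lambda>A y z. ract A (pair_subst p q c A y z u) w)"
proof (cases u)
  case (Y i)
  have "form (\<lambda>A y z. p i \<odot>\<^bsub>A\<^esub> lact A w (even_odd_pair.even_power A y 0))"
    "form (\<lambda>A y z. q i \<odot>\<^bsub>A\<^esub> lact A w (even_odd_pair.even_power A y 1))"
    by (rule form.smult, rule form_even_power, rule refl)+
  then show ?thesis unfolding Y by (rule form.add) (rule even_odd_pair.ract_subst)
next
  case (Z i)
  show ?thesis unfolding Z by (rule form.smult[OF form_odd_word]) (rule even_odd_pair.ract_subst)
qed

lemma form_word: "form (\<lambda>A y z. eval_word A (pair_subst p q c A y z) us)"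
proof (induction us)
  case Nil
  show ?case by (rule form.zero) simp
next
  case (Cons a us)
  obtain u w where a: "a = (u, w)" by (cases a)
  show ?case
  proof (cases "us = []")
    case True
    then show ?thesis using form_letter by (simp add: a)
  next
    case False
    show ?thesis
      unfolding a by (rule form_cong[OF form_subst_mult[OF form_lact[OF Cons.IH]]])
        (rule even_odd_pair.eval_word_subst_Cons[OF _ False])
  qed
qed

lemma form_poly: "form (\<lambda>(A :: ('f, 'w, 'a) walg) y z. eval_poly A (pair_subst p q c A y z) f)"
proof -
  let ?t = "\<lambda>m (A :: ('f, 'w, 'a) walg) y z. Poly_Mapping.lookup f m \<odot>\<^bsub>A\<^esub> eval_monom A (pair_subst p q c A y z) m"
  have fin: "form (\<lambda>A y z. finsum A (\<lambda>m. ?t m A y z) K)" if "finite K" for K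
    using that
  proof induction
    case empty
    show ?case
    proof (rule form.zero)
      fix A :: "('f, 'w, 'a) walg" and y z assume "pair A y z"
      then interpret even_odd_pair scaleW gradeW A \<alpha> \<beta> e1 e2 y z .
      show "finsum A (\<lambda>m. ?t m A y z) {} = \<zero>\<^bsub>A\<^esub>" by simp
    qed
  next
    case (insert m K)
    have "form (?t m)" by (rule form.smult[OF form_lact[OF form_word]]) (rule refl)
    then show ?case
    proof (rule form.add[OF _ insert.IH])
      fix A :: "('f, 'w, 'a) walg" and y z assume "pair A y z"
      then interpret even_odd_pair scaleW gradeW A \<alpha> \<beta> e1 e2 y z .
      show "finsum A (\<lambda>m. ?t m A y z) (insert m K) = ?t m A y z \<oplus>\<^bsub>A\<^esub> finsum A (\<lambda>m. ?t m A y z) K"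
        using insert.hyps eval_word_closed[OF subst_admissible] by (intro finsum_insert) auto
    qed
  qed
  show ?thesis unfolding eval_poly_def by (rule fin) (rule finite_keys)
qed

text \<open>
  The coefficients can be collected by degree, into one list that is the same for all algebras.
\<close>

lemma form_normal_form:
  assumes "form F"
  shows "\<exists>cs. \<forall>A y z. pair A y z \<longrightarrow> F A y z = graded_W_algebra.horner A (even_odd_pair.components A y z 0 cs) 1"
  using assms
proof induction
  case (zero F)
  note vanish = this
  have "F A y z = graded_W_algebra.horner A (even_odd_pair.components A y z 0 []) 1" if p: "pair A y z" for A y z
  proof -
    interpret even_odd_pair scaleW gradeW A \<alpha> \<beta> e1 e2 y z by (rule p)
    show ?thesis using vanish[OF p] by simp
  qed
  then show ?case by blast
next
  case (even_term F \<omega> j)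
  have "F A y z = graded_W_algebra.horner A
      (even_odd_pair.components A y z 0 (replicate j (0, \<lambda>_. 0) @ [(\<omega>, \<lambda>_. 0)])) 1" if p: "pair A y z" for A y z
  proof -
    interpret even_odd_pair scaleW gradeW A \<alpha> \<beta> e1 e2 y z by (rule p)
    show ?thesis by (simp add: horner_single_component component_even even_term[OF p])
  qed
  then show ?case by blast
next
  case (odd_term F i j)
  let ?a = "\<lambda>l. if l = i then inverse (of_nat ((i + j) choose i)) else 0"
  have "F A y z = graded_W_algebra.horner A
      (even_odd_pair.components A y z 0 (replicate (i + j) (0, \<lambda>_. 0) @ [(0, ?a)])) 1" if p: "pair A y z" for A y z
  proof -
    interpret even_odd_pair scaleW gradeW A \<alpha> \<beta> e1 e2 y z by (rule p)
    show ?thesis unfolding horner_single_component add_0 component_odd by (rule odd_term[OF p])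
  qed
  then show ?case by blast
next
  case (add F1 F2 F)
  obtain cs ds where
    cs: "\<And>A y z. pair A y z \<Longrightarrow> F1 A y z = graded_W_algebra.horner A (even_odd_pair.components A y z 0 cs) 1" and
    ds: "\<And>A y z. pair A y z \<Longrightarrow> F2 A y z = graded_W_algebra.horner A (even_odd_pair.components A y z 0 ds) 1"
    using add.IH by blast
  have "F A y z = graded_W_algebra.horner A
      (even_odd_pair.components A y z 0 (even_odd_pair.coeffs_add cs ds)) 1" if p: "pair A y z" for A y z
  proof -
    interpret even_odd_pair scaleW gradeW A \<alpha> \<beta> e1 e2 y z by (rule p)
    show ?thesis
      by (simp add: add.hyps(3)[OF p] cs[OF p] ds[OF p] components_coeffs_add horner_coeff_add)
  qed
  then show ?case by blast
next
  case (smult F1 F t)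
  obtain cs where
    cs: "\<And>A y z. pair A y z \<Longrightarrow> F1 A y z = graded_W_algebra.horner A (even_odd_pair.components A y z 0 cs) 1"
    using smult.IH by blast
  have "F A y z = graded_W_algebra.horner A
      (even_odd_pair.components A y z 0 (map (\<lambda>c. (scaleW t (fst c), \<lambda>i. t * snd c i)) cs)) 1"
    if p: "pair A y z" for A y z
  proof -
    interpret even_odd_pair scaleW gradeW A \<alpha> \<beta> e1 e2 y z by (rule p)
    show ?thesis
      unfolding components_smult by (simp add: smult.hyps(2)[OF p] cs[OF p] horner_map_smult)
  qed
  then show ?case by blast
qed

text \<open>
  On \<open>A\<close> every homogeneous component vanishes, and so does its even part (put \<open>z = 0\<close>) as well as its odd
  part. As the whole form does not vanish on \<open>U\<close>, one of its components has a part with nonzero coefficients.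
\<close>

lemma commutator_identity_of_form:
  fixes A U :: "('f, 'w, 'a) walg"
  assumes F: "form F" and U: "pair U y0 z0" "F U y0 z0 \<noteq> \<zero>\<^bsub>U\<^esub>"
    and A: "triangular_W_algebra scaleW gradeW A \<alpha> \<beta> e1 e2"
    and vanish: "\<And>y z. pair A y z \<Longrightarrow> F A y z = \<zero>\<^bsub>A\<^esub>"
  shows "\<exists>k. triangular_W_algebra.commutator_identity A k"
proof -
  interpret A: triangular_W_algebra scaleW gradeW A \<alpha> \<beta> e1 e2 by (rule A)
  interpret U: even_odd_pair scaleW gradeW U \<alpha> \<beta> e1 e2 y0 z0 by (rule U(1))
  obtain cs where
    cs: "\<And>A y z. pair A y z \<Longrightarrow> F A y z = graded_W_algebra.horner A (even_odd_pair.components A y z 0 cs) 1"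
    using form_normal_form[OF F] by blast
  have pairI: "pair A y z" if "y \<in> homog A 0" "z \<in> homog A 1" for y z
    by (rule even_odd_pair.intro[OF A even_odd_pair_axioms.intro]) (rule that)+
  (* homogeneous components: replace (y, z) by (t y, t z) for all scalars t *)
  have comp: "even_odd_pair.component A y z d (cs ! d) = \<zero>\<^bsub>A\<^esub>"
    if d: "d < length cs" and p: "pair A y z" for d y z
  proof -
    interpret even_odd_pair scaleW gradeW A \<alpha> \<beta> e1 e2 y z by (rule p)
    have "A.horner (components 0 cs) t = \<zero>\<^bsub>A\<^esub>" if t: "t \<noteq> 0" for t :: 'f
    proof -
      have "t \<odot>\<^bsub>A\<^esub> A.horner (components 0 cs) t = \<zero>\<^bsub>A\<^esub>"
        using horner_components_dilate[of t 0 cs] cs[OF even_odd_pair_smult] vanish[OF even_odd_pair_smult] by simp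
      then show ?thesis using A.smult_eq_zero[OF A.horner_closed[OF components_closed]] t by blast
    qed
    then have "\<forall>c\<in>set (components 0 cs). c = \<zero>\<^bsub>A\<^esub>"
      using components_closed by (rule A.horner_eq_zeroD)
    then show ?thesis using d by (auto simp: set_components)
  qed
  have split: "lact A (fst (cs ! d)) (A.mprod (replicate (Suc d) y)) = \<zero>\<^bsub>A\<^esub>
      \<and> A.symm (snd (cs ! d)) (replicate d y) z = \<zero>\<^bsub>A\<^esub>"
    if d: "d < length cs" and yz: "y \<in> homog A 0" "z \<in> homog A 1" for d y z
  proof -
    interpret even: even_odd_pair scaleW gradeW A \<alpha> \<beta> e1 e2 y "\<zero>\<^bsub>A\<^esub>" by (rule pairI[OF yz(1) A.homog_zero])
    interpret even_odd_pair scaleW gradeW A \<alpha> \<beta> e1 e2 y z by (rule pairI[OF yz])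
    have "lact A (fst (cs ! d)) (even_power d) = \<zero>\<^bsub>A\<^esub>"
      using comp[OF d even.even_odd_pair_axioms] A.symm_zero_arg[OF replicate_y]
      by (simp add: even.component_def)
    then show ?thesis
      using comp[OF d even_odd_pair_axioms] symm_power by (simp add: component_def even_power_def)
  qed
  have "\<exists>d<length cs. U.component d (cs ! d) \<noteq> \<zero>\<^bsub>U\<^esub>"
  proof (rule ccontr)
    assume "\<not> ?thesis"
    then have "\<forall>m\<in>set (U.components 0 cs). m = \<zero>\<^bsub>U\<^esub>" by (auto simp: U.set_components)
    then have "U.horner (U.components 0 cs) 1 = \<zero>\<^bsub>U\<^esub>" by (rule U.horner_zero)
    then show False using U(2) cs[OF U(1)] by simp
  qed
  then obtain d where d: "d < length cs" "U.component d (cs ! d) \<noteq> \<zero>\<^bsub>U\<^esub>" by blast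
  consider "lact U (fst (cs ! d)) (U.even_power d) \<noteq> \<zero>\<^bsub>U\<^esub>" | "U.symm (snd (cs ! d)) (replicate d y0) z0 \<noteq> \<zero>\<^bsub>U\<^esub>"
  proof -
    have "\<not> (lact U (fst (cs ! d)) (U.even_power d) = \<zero>\<^bsub>U\<^esub> \<and> U.symm (snd (cs ! d)) (replicate d y0) z0 = \<zero>\<^bsub>U\<^esub>)"
      using d(2) by (auto simp: U.component_def)
    then show ?thesis using that by blast
  qed
  then show ?thesis
  proof cases
    case 1
    then have "\<alpha> (fst (cs ! d)) \<noteq> 0 \<or> \<beta> (fst (cs ! d)) \<noteq> 0"
      using U.lact_even[OF U.even_power, of "fst (cs ! d)"] by auto
    then have "A.commutator_identity (Suc d)"
      by (rule A.commutator_identity_of_even) (use split[OF d(1) _ A.homog_zero] in blast)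
    then show ?thesis ..
  next
    case 2
    then have "\<exists>i\<le>d. snd (cs ! d) i \<noteq> 0"
      using U.symm_zero[OF _ U.replicate_y U.z, of d "snd (cs ! d)"] by auto
    then have "A.commutator_identity d"
      by (rule A.commutator_identity_of_odd) (use split[OF d(1)] in blast)
    then show ?thesis ..
  qed
qed

end

section \<open>Exponential growth of the two varieties\<close>

text \<open>
  The permutation in the definition of the multilinear elements is read off from the indices of the letters.
\<close>

lemma multilinear_wordI:
  fixes u :: "nat \<Rightarrow> gvar"
  assumes "b \<in> \<B>" "snd ` set us \<subseteq> \<B>" and u: "\<And>i. u i \<in> {Y i, Z i}" "\<And>p. p \<in> set us \<Longrightarrow> fst p = u (gidx (fst p))"
    and idx: "distinct (map (\<lambda>p. gidx (fst p)) us)" "set (map (\<lambda>p. gidx (fst p)) us) = {..<n}"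
  shows "Poly_Mapping.single (b, us) (1 :: 'f::field) \<in> multilinear \<B> n"
  unfolding multilinear_def
proof (rule P.span_base, intro CollectI exI conjI)
  let ?is = "map (\<lambda>p. gidx (fst p)) us"
  have len: "length us = n" using distinct_card[OF idx(1)] idx(2) by simp
  define \<sigma> where "\<sigma> j = (if j < n then ?is ! j else j)" for j
  define w where "w j = (if j = 0 then b else snd (us ! (j - 1)))" for j
  show "\<sigma> permutes {..<n}"
  proof (rule bij_imp_permutes)
    have "bij_betw ((!) ?is) {..<n} {..<n}" by (rule bij_betw_nth) (use idx len in auto)
    then show "bij_betw \<sigma> {..<n} {..<n}" by (rule bij_betw_cong[THEN iffD1, rotated]) (simp add: \<sigma>_def)
  qed (simp add: \<sigma>_def)
  show "\<forall>j\<le>n. w j \<in> \<B>"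
  proof (intro allI impI)
    fix j assume "j \<le> n"
    then show "w j \<in> \<B>" using assms(1,2) len by (cases j) (auto simp: w_def image_subset_iff)
  qed
  show "\<forall>i<n. u i \<in> {Y i, Z i}" using u(1) by blast
  have "us = map (\<lambda>j. (u (\<sigma> j), w (Suc j))) [0..<n]"
  proof (rule nth_equalityI)
    fix j assume j: "j < length us"
    then have "u (\<sigma> j) = fst (us ! j)" using len u(2)[of "us ! j"] by (simp add: \<sigma>_def)
    then show "us ! j = map (\<lambda>j. (u (\<sigma> j), w (Suc j))) [0..<n] ! j"
      using j len by (simp add: w_def)
  qed (simp add: len)
  then show "Poly_Mapping.single (b, us) 1 = Poly_Mapping.single (w 0, map (\<lambda>j. (u (\<sigma> j), w (Suc j))) [0..<n]) 1"
    by (simp add: w_def)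
qed

context
  fixes scaleW :: "'f::field_char_0 \<Rightarrow> 'w::ring_1 \<Rightarrow> 'w" and gradeW :: "bit \<Rightarrow> 'w set" and \<B> :: "'w set"
    and B :: "('f^2^2) set" and \<phi> :: "'w \<Rightarrow> 'f^2^2"
  assumes W: "graded_unital_algebra scaleW gradeW" and basis: "Modules.module.span scaleW \<B> = UNIV"
    and \<phi>: "graded_unital_hom_onto scaleW gradeW B \<phi>" "B \<subseteq> diagonal_matrices"
begin

interpretation W: graded_unital_algebra scaleW gradeW by (rule W)

interpretation UT2: graded_W_algebra scaleW gradeW "UT2 \<phi>"
  by (rule graded_W_algebra_UT2[OF W \<phi>])

lemma hom_diagonal: "\<phi> w $ 1 $ 2 = 0" "\<phi> w $ 2 $ 1 = 0"
  using \<phi> by (auto simp: graded_unital_hom_onto_def diagonal_matrices_iff subset_iff)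

lemma hom_linear: "\<phi> (v + w) = \<phi> v + \<phi> w" "\<phi> (scaleW c w) = mscale c (\<phi> w)" "\<phi> 1 = mat 1"
  using \<phi> by (auto simp: graded_unital_hom_onto_def)

text \<open>
  The unit of \<open>W\<close> is a combination of basis elements and acts as the identity matrix.
\<close>

lemma basis_nonzero_entry: "\<exists>b\<in>\<B>. \<phi> b $ i $ i \<noteq> 0"
proof (rule ccontr)
  let ?V = "{w. \<phi> w $ i $ i = 0}"
  assume "\<not> ?thesis"
  then have "\<B> \<subseteq> ?V" by blast
  moreover have "W.subspace ?V"
  proof (rule W.subspaceI)
    show "0 \<in> ?V" using arg_cong[OF hom_linear(2)[of 0 0], of "\<lambda>M. M $ i $ i"] by simp
  qed (simp_all add: hom_linear)
  ultimately have "W.span \<B> \<subseteq> ?V" by (rule W.span_minimal)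
  then have "\<phi> 1 $ i $ i = 0" using basis by blast
  then show False by (simp add: hom_linear mat_1_nth)
qed

definition unit_subst :: "nat set \<Rightarrow> gvar \<Rightarrow> 'f^2^2"
  where "unit_subst L x = (case x of Y i \<Rightarrow> if i \<in> L then munit 1 1 else munit 2 2 | Z i \<Rightarrow> munit 1 2)"

lemma unit_subst_simps [simp]:
  "unit_subst L (Y i) = (if i \<in> L then munit 1 1 else munit 2 2)" "unit_subst L (Z i) = munit 1 2"
  by (simp_all add: unit_subst_def)

lemma unit_subst_admissible: "admissible (UT2 \<phi>) (unit_subst L)"
  by (simp add: admissible_UT2)

lemma eval_unit_right:
  "is \<noteq> [] \<Longrightarrow> eval_word (UT2 \<phi>) (unit_subst L) (map (\<lambda>i. (Y i, b)) is) $ 2 $ 2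
      = (\<Prod>i\<leftarrow>is. if i \<in> L then 0 else \<phi> b $ 2 $ 2)
    \<and> eval_word (UT2 \<phi>) (unit_subst L) (map (\<lambda>i. (Y i, b)) is) $ 1 $ 2 = 0"
proof (induction "is")
  case (Cons i "is")
  then show ?case
    by (cases "is = []") (auto simp: UT2.eval_word_Cons mat_mult_2_nth hom_diagonal)
qed simp

lemma eval_unit_word:
  "eval_word (UT2 \<phi>) (unit_subst L) (map (\<lambda>i. (Y i, b)) ks @ (Z 0, b') # map (\<lambda>i. (Y i, b')) rs) $ 1 $ 2
    = (\<Prod>i\<leftarrow>ks. if i \<in> L then \<phi> b $ 1 $ 1 else 0) * (\<phi> b' $ 2 $ 2 * (\<Prod>i\<leftarrow>rs. if i \<in> L then 0 else \<phi> b' $ 2 $ 2))"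
proof (induction ks)
  case Nil
  show ?case
    using eval_unit_right[of rs L b'] by (cases "rs = []")
      (auto simp: UT2.eval_word_Cons mat_mult_2_nth hom_diagonal)
next
  case (Cons k ks)
  then show ?case using Cons
    by (auto simp: UT2.eval_word_Cons mat_mult_2_nth hom_diagonal)
qed

text \<open>
  For \<open>K \<subseteq> {1, \<dots>, n - 1}\<close>, the monomial with \<open>y\<^sub>K\<close> to the left and the other even variables to the right of
  \<open>z\<^sub>0\<close> has a nonzero value at \<open>unit_subst L\<close> only if \<open>K = L\<close>: a variable to the left of \<open>e\<^sub>1\<^sub>2\<close> must be
  \<open>e\<^sub>1\<^sub>1\<close>, one to the right must be \<open>e\<^sub>2\<^sub>2\<close>. The coefficients \<open>b\<close> and \<open>b'\<close> of the monomials are basis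
  elements that act invertibly on these two idempotents.
\<close>

lemma codim_UT2_ge:
  assumes n: "n \<ge> 1"
  shows "enat (2 ^ (n - 1)) \<le> codim \<B> (UT2 \<phi>) n"
proof -
  obtain b b' where b: "b \<in> \<B>" "\<phi> b $ 1 $ 1 \<noteq> 0" and b': "b' \<in> \<B>" "\<phi> b' $ 2 $ 2 \<noteq> 0"
    using basis_nonzero_entry by blast
  define word where "word K = map (\<lambda>i. (Y i, b)) (sorted_list_of_set K)
    @ (Z 0, b') # map (\<lambda>i. (Y i, b')) (sorted_list_of_set ({1..<n} - K))" for K
  have fin: "finite K" if "K \<in> Pow {1..<n}" for K using that finite_subset by auto
  have "enat (card (Pow {1..<n})) \<le> codim \<B> (UT2 \<phi>) n"
    unfolding codim_def
  proof (rule P.quotient_dim_ge[where g = "\<lambda>p L. eval_poly (UT2 \<phi>) (unit_subst L) p $ 1 $ 2"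
        and v = "\<lambda>K. Poly_Mapping.single (b, word K) 1"])
    show "P.subspace (multilinear \<B> n)" by (rule subspace_multilinear)
    then show "P.subspace (multilinear \<B> n \<inter> W_Id \<B> (UT2 \<phi>))"
      by (rule P.subspace_inter[OF _ UT2.subspace_W_Id])
    show "eval_poly (UT2 \<phi>) (unit_subst L) (p + q) $ 1 $ 2
        = eval_poly (UT2 \<phi>) (unit_subst L) p $ 1 $ 2 + eval_poly (UT2 \<phi>) (unit_subst L) q $ 1 $ 2" for p q L
      using UT2.eval_poly_add[OF unit_subst_admissible] by simp
    show "eval_poly (UT2 \<phi>) (unit_subst L) (pscale c p) $ 1 $ 2 = c * eval_poly (UT2 \<phi>) (unit_subst L) p $ 1 $ 2" for c p L
      using UT2.eval_poly_pscale[OF unit_subst_admissible] by simp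
    show "eval_poly (UT2 \<phi>) (unit_subst L) p $ 1 $ 2 = 0" if "p \<in> multilinear \<B> n \<inter> W_Id \<B> (UT2 \<phi>)" for p L
    proof -
      have "eval_poly (UT2 \<phi>) (unit_subst L) p = \<zero>\<^bsub>UT2 \<phi>\<^esub>"
        using that unit_subst_admissible[of L] unfolding W_Id_def by blast
      then show ?thesis by simp
    qed
    show "Poly_Mapping.single (b, word K) 1 \<in> multilinear \<B> n" if K: "K \<in> Pow {1..<n}" for K
    proof (rule multilinear_wordI[where u = "\<lambda>i. if i = 0 then Z 0 else Y i"])
      have idx: "map (\<lambda>p. gidx (fst p)) (word K) = sorted_list_of_set K @ 0 # sorted_list_of_set ({1..<n} - K)"
        by (simp add: word_def comp_def)
      show "distinct (map (\<lambda>p. gidx (fst p)) (word K))"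
        unfolding idx using K fin[OF K] by auto
      show "set (map (\<lambda>p. gidx (fst p)) (word K)) = {..<n}"
        unfolding idx using K fin[OF K] n by auto
      show "snd ` set (word K) \<subseteq> \<B>" using b b' by (auto simp: word_def)
      show "fst p = (if gidx (fst p) = 0 then Z 0 else Y (gidx (fst p)))" if "p \<in> set (word K)" for p
        using that K fin[OF K] by (auto simp: word_def)
    qed (use b in auto)
    show "eval_poly (UT2 \<phi>) (unit_subst L) (Poly_Mapping.single (b, word K) 1) $ 1 $ 2 = 0 \<longleftrightarrow> K \<noteq> L"
      if K: "K \<in> Pow {1..<n}" and L: "L \<in> Pow {1..<n}" for K L
    proof -
      have "eval_poly (UT2 \<phi>) (unit_subst L) (Poly_Mapping.single (b, word K) 1) $ 1 $ 2
          = \<phi> b $ 1 $ 1 * eval_word (UT2 \<phi>) (unit_subst L) (word K) $ 1 $ 2"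
        using UT2.eval_poly_single[OF unit_subst_admissible] by (simp add: mat_mult_2_nth hom_diagonal)
      also have "\<dots> = 0 \<longleftrightarrow> \<not> (K \<subseteq> L \<and> ({1..<n} - K) \<inter> L = {})"
        using b b' fin[OF K] by (auto simp: word_def eval_unit_word prod_list_zero_iff split: if_splits)
      also have "\<dots> \<longleftrightarrow> K \<noteq> L" using K L by auto
      finally show ?thesis .
    qed
  qed auto
  then show ?thesis by (simp add: card_Pow)
qed

end

text \<open>
  The bases \<open>3 / 2\<close> and \<open>8\<close> are crude: \<open>(3 / 2)\<^sup>n \<le> 2\<^sup>n\<^sup>-\<^sup>1\<close> from \<open>n = 3\<close> on, and
  \<open>2 + n 2\<^sup>n \<le> 2 + 4\<^sup>n \<le> 8\<^sup>n\<close>.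
\<close>

lemma exponential_growthI:
  assumes "\<And>n. n \<ge> 1 \<Longrightarrow> enat (2 ^ (n - 1)) \<le> c n" "\<And>n. n \<ge> 1 \<Longrightarrow> c n \<le> enat (2 + n * 2 ^ n)"
  shows "exponential_growth c"
  unfolding exponential_growth_def
proof (intro exI conjI)
  show "1 < (3 / 2 :: real)" by simp
  show "\<forall>\<^sub>F n in sequentially. \<exists>d. c n = enat d \<and> (3 / 2) ^ n \<le> real d \<and> real d \<le> 8 ^ n"
  proof (rule eventually_sequentiallyI[of 3])
    fix n :: nat assume n: "3 \<le> n"
    then obtain d where d: "c n = enat d" using assms(2)[of n] by (cases "c n") auto
    have low: "2 ^ (n - 1) \<le> d" and up: "d \<le> 2 + n * 2 ^ n" using assms[of n] n d by auto
    have "(3 / 2 :: real) ^ n \<le> 2 ^ (n - 1)"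
      using n
    proof (induction n rule: dec_induct)
      case (step m)
      then obtain l where "m = Suc l" by (cases m) auto
      have "(3 / 2 :: real) ^ Suc m \<le> 3 / 2 * 2 ^ (m - 1)" using step.IH by simp
      also have "\<dots> \<le> 2 * 2 ^ (m - 1)" by simp
      finally show ?case using \<open>m = Suc l\<close> by simp
    qed (simp add: power3_eq_cube numeral_eq_Suc)
    also have "\<dots> \<le> real d" using low by (metis of_nat_le_iff of_nat_numeral of_nat_power)
    finally have 1: "(3 / 2) ^ n \<le> real d" .
    have "2 + n * 2 ^ n \<le> (8 :: nat) ^ n"
    proof -
      have "n * 2 ^ n \<le> 2 ^ n * (2 :: nat) ^ n" using less_exp[of n] by (intro mult_right_mono) auto
      also have "\<dots> = 4 ^ n" by (simp flip: power_mult_distrib)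
      finally have "2 + n * 2 ^ n \<le> 2 + (4 :: nat) ^ n" by simp
      also have "\<dots> \<le> 2 * 4 ^ n" using n self_le_power[of "4 :: nat" n] by simp
      also have "\<dots> \<le> 2 ^ n * (4 :: nat) ^ n" using n self_le_power[of "2 :: nat" n] by (intro mult_right_mono) auto
      also have "\<dots> = 8 ^ n" by (simp flip: power_mult_distrib)
      finally show ?thesis .
    qed
    with up have "d \<le> 8 ^ n" by linarith
    then have "real d \<le> 8 ^ n" by (metis of_nat_le_iff of_nat_numeral of_nat_power)
    with 1 d show "\<exists>d. c n = enat d \<and> (3 / 2) ^ n \<le> real d \<and> real d \<le> 8 ^ n" by blast
  qed
qed

section \<open>Almost polynomial growth\<close>

text \<open>
  The four entries of a matrix become the coefficients of four fixed monomials.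
\<close>

lemma matrix_embedding:
  fixes emb :: "('f::field, 'w::ring_1) wpoly \<Rightarrow> 'u"
  assumes "inj emb"
  shows "\<exists>h :: 'f^2^2 \<Rightarrow> 'u. inj h"
proof -
  define m :: "nat \<Rightarrow> 'w wmonom" where "m k = (1, replicate k (Y 0, 1))" for k
  have m: "m k = m l \<longleftrightarrow> k = l" for k l by (auto simp: m_def dest: arg_cong[of _ _ length])
  define p where "p M = Poly_Mapping.single (m 0) (M $ 1 $ 1) + Poly_Mapping.single (m 1) (M $ 1 $ 2)
    + Poly_Mapping.single (m 2) (M $ 2 $ 1) + Poly_Mapping.single (m 3) (M $ 2 $ 2)" for M :: "'f^2^2"
  have lookups: "Poly_Mapping.lookup (p M) (m 0) = M $ 1 $ 1" "Poly_Mapping.lookup (p M) (m 1) = M $ 1 $ 2"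
    "Poly_Mapping.lookup (p M) (m 2) = M $ 2 $ 1" "Poly_Mapping.lookup (p M) (m 3) = M $ 2 $ 2" for M
    by (simp_all add: p_def lookup_add lookup_single m)
  have "inj (\<lambda>M. emb (p M))"
  proof (rule injI)
    fix M N assume "emb (p M) = emb (p N)"
    then have "p M = p N" using assms by (simp add: inj_eq)
    then show "M = N" using lookups[of M] lookups[of N] by (simp add: matrix_2_eq_iff)
  qed
  then show ?thesis by blast
qed

text \<open>
  Interpolation at the two distinct eigenvalues of \<open>diag(1, 2)\<close>. They are nonzero, so no constant term is
  needed.
\<close>

lemma even_UT2_generated:
  assumes "M \<in> UT2_homog 0"
  shows "\<exists>p q. M = mscale p (munit 1 1 + mscale 2 (munit 2 2))
    + mscale q ((munit 1 1 + mscale 2 (munit 2 2)) ** (munit 1 1 + mscale 2 (munit 2 2 :: 'f::field_char_0^2^2)))"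
proof (intro exI)
  let ?q = "(M $ 2 $ 2 - 2 * M $ 1 $ 1) / 2"
  show "M = mscale (M $ 1 $ 1 - ?q) (munit 1 1 + mscale 2 (munit 2 2))
    + mscale ?q ((munit 1 1 + mscale 2 (munit 2 2)) ** (munit 1 1 + mscale 2 (munit 2 2)))"
    using assms by (simp add: matrix_2_eq_iff UT2_homog_iff mat_mult_2_nth field_simps)
qed

text \<open>
  The identity \<open>f\<close> of the smaller variety that fails in \<open>UT2 \<phi>\<close> is evaluated at a substitution built from
  \<open>y = diag(1, 2)\<close> and \<open>z = e\<^sub>1\<^sub>2\<close>; the copy \<open>U\<close> of \<open>UT2 \<phi>\<close> in the universe makes this value comparable
  with those in \<open>A\<close>.
\<close>

theorem almost_polynomial_growth_UT2:
  fixes scaleW :: "'f::field_char_0 \<Rightarrow> 'w::ring_1 \<Rightarrow> 'w" and emb :: "('f, 'w) wpoly \<Rightarrow> 'u"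
  assumes W: "graded_unital_algebra scaleW gradeW" and basis: "Modules.module.span scaleW \<B> = UNIV"
    and \<phi>: "graded_unital_hom_onto scaleW gradeW B \<phi>" "B \<subseteq> diagonal_matrices"
    and e: "\<And>w. \<phi> w = mscale (\<phi> w $ 1 $ 1) (\<phi> e1) + mscale (\<phi> w $ 2 $ 2) (\<phi> e2)"
    and emb: "inj emb"
  shows "almost_polynomial_growth scaleW gradeW \<B> (variety scaleW gradeW \<B> (UT2 \<phi>) :: ('f, 'w, 'u) walg set)"
proof -
  interpret W: graded_unital_algebra scaleW gradeW by (rule W)
  interpret UT2: graded_W_algebra scaleW gradeW "UT2 \<phi>" by (rule graded_W_algebra_UT2[OF W \<phi>])
  obtain h :: "'f^2^2 \<Rightarrow> 'u" where h: "inj h" using matrix_embedding[OF emb] by blast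
  define U where "U = transport h (UT2 \<phi>)"
  have U: "graded_W_algebra scaleW gradeW U" unfolding U_def by (rule UT2.graded_W_algebra_transport[OF h])
  have Id_U: "W_Id \<B> U = W_Id \<B> (UT2 \<phi>)" unfolding U_def by (rule UT2.W_Id_transport[OF h])
  let ?V = "variety scaleW gradeW \<B> (UT2 \<phi>) :: ('f, 'w, 'u) walg set"
  have V: "?V = variety scaleW gradeW \<B> U" by (simp add: variety_def Id_U)
  note triangular = triangular_W_algebraI[OF _ basis \<phi> e]
  have codim_V: "variety_codim \<B> ?V = codim \<B> (UT2 \<phi>)"
    unfolding V variety_codim_generated[OF U] by (simp add: codim_def Id_U fun_eq_iff)
  show ?thesis
    unfolding almost_polynomial_growth_def
  proof (intro conjI allI impI)
    show "is_variety scaleW gradeW \<B> ?V" unfolding is_variety_def V using U by blast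
    interpret T: triangular_W_algebra scaleW gradeW "UT2 \<phi>" "\<lambda>w. \<phi> w $ 1 $ 1" "\<lambda>w. \<phi> w $ 2 $ 2" e1 e2
      by (rule triangular[OF UT2.graded_W_algebra_axioms order_refl])
    show "exponential_growth (variety_codim \<B> ?V)"
      unfolding codim_V
      by (rule exponential_growthI[OF codim_UT2_ge[OF W basis \<phi>] T.codim_le_exponential])
  next
    fix X :: "('f, 'w, 'u) walg set" assume X: "is_variety scaleW gradeW \<B> X \<and> X \<subset> ?V"
    then obtain A :: "('f, 'w, 'u) walg" where A: "graded_W_algebra scaleW gradeW A" "X = variety scaleW gradeW \<B> A"
      by (auto simp: is_variety_def)
    have "A \<in> X" using A by (simp add: variety_def)
    then have sub: "W_Id \<B> (UT2 \<phi>) \<subseteq> W_Id \<B> A" using X by (auto simp: variety_def)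
    have "\<not> W_Id \<B> A \<subseteq> W_Id \<B> (UT2 \<phi>)" using X A(2) by (auto simp: variety_def)
    then obtain f where f: "f \<in> W_Id \<B> A" "f \<notin> W_Id \<B> (UT2 \<phi>)" by blast
    then have "f \<in> free_W_algebra \<B>" by (simp add: W_Id_def)
    then obtain s where s: "admissible (UT2 \<phi>) s" "eval_poly (UT2 \<phi>) s f \<noteq> 0"
      using f(2) by (auto simp: W_Id_def)
    (* write s as a substitution of polynomials in y and multiples of z *)
    define y :: "'f^2^2" where "y = munit 1 1 + mscale 2 (munit 2 2)"
    define z :: "'f^2^2" where "z = munit 1 2"
    have "\<exists>p q. s (Y i) = mscale p y + mscale q (y ** y)" for i
      unfolding y_def using s(1) by (intro even_UT2_generated) (metis UT2_sel(7) vdeg.simps(1))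
    then obtain p q where pq: "\<And>i. s (Y i) = mscale (p i) y + mscale (q i) (y ** y)" by metis
    have "\<exists>c. s (Z i) = mscale c z" for i
    proof -
      have "s (Z i) \<in> UT2_homog 1" using s(1) by (metis UT2_sel(7) vdeg.simps(2))
      then show ?thesis by (auto simp: UT2_homog_def z_def)
    qed
    then obtain c where c: "\<And>i. s (Z i) = mscale (c i) z" by metis
    interpret U: triangular_W_algebra scaleW gradeW U "\<lambda>w. \<phi> w $ 1 $ 1" "\<lambda>w. \<phi> w $ 2 $ 2" e1 e2
      by (rule triangular[OF U]) (simp add: Id_U)
    interpret A: triangular_W_algebra scaleW gradeW A "\<lambda>w. \<phi> w $ 1 $ 1" "\<lambda>w. \<phi> w $ 2 $ 2" e1 e2
      by (rule triangular[OF A(1) sub])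
    let ?F = "\<lambda>(A :: ('f, 'w, 'u) walg) y z. eval_poly A (even_odd_pair.subst A y z p q c) f"
    interpret pair: even_odd_pair scaleW gradeW U "\<lambda>w. \<phi> w $ 1 $ 1" "\<lambda>w. \<phi> w $ 2 $ 2" e1 e2 "h y" "h z"
      by unfold_locales (auto simp: U_def UT2_homog_iff y_def z_def)
    have "pair.subst p q c = (\<lambda>x. h (s x))"
    proof
      fix x show "pair.subst p q c x = h (s x)"
        using pq c UT2.transport_ops[OF h] by (cases x) (simp_all flip: U_def)
    qed
    then have "?F U (h y) (h z) = h (eval_poly (UT2 \<phi>) s f)"
      using UT2.eval_poly_transport[OF h s(1)] by (simp add: U_def)
    then have nonzero: "?F U (h y) (h z) \<noteq> \<zero>\<^bsub>U\<^esub>"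
      using s(2) h by (simp add: U_def inj_eq)
    have "\<exists>k. A.commutator_identity k"
    proof (rule commutator_identity_of_form[OF form_poly pair.even_odd_pair_axioms nonzero A.triangular_W_algebra_axioms])
      fix y z
      assume "even_odd_pair scaleW gradeW A (\<lambda>w. \<phi> w $ 1 $ 1) (\<lambda>w. \<phi> w $ 2 $ 2) e1 e2 y z"
      from even_odd_pair.subst_admissible[OF this] show "?F A y z = \<zero>\<^bsub>A\<^esub>"
        using f(1) by (simp add: W_Id_def)
    qed
    then obtain k where "A.commutator_identity k" by blast
    then have "polynomially_bounded (codim \<B> A)" by (rule A.codim_polynomially_bounded)
    then show "polynomially_bounded (variety_codim \<B> X)"
      unfolding A(2) variety_codim_generated[OF A(1)] .
  qed
qed

text \<open>
  If \<open>w\<close> acts as \<open>e\<^sub>1\<^sub>1\<close> on one algebra and as the scalar \<open>a\<close> on the other, then \<open>w y = a y\<close> is an identity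
  of the second algebra only.
\<close>

lemma varieties_distinct:
  fixes scaleW :: "'f::field_char_0 \<Rightarrow> 'w::ring_1 \<Rightarrow> 'w" and emb :: "('f, 'w) wpoly \<Rightarrow> 'u"
  assumes W: "graded_unital_algebra scaleW gradeW" and basis: "Modules.module.span scaleW \<B> = UNIV"
    and F: "graded_unital_hom_onto scaleW gradeW scalar_matrices \<phi>F"
    and D: "graded_unital_hom_onto scaleW gradeW diagonal_matrices \<phi>D"
    and emb: "inj emb"
  shows "(variety scaleW gradeW \<B> (UT2 \<phi>F) :: ('f, 'w, 'u) walg set) \<noteq> variety scaleW gradeW \<B> (UT2 \<phi>D)"
proof
  assume eq: "(variety scaleW gradeW \<B> (UT2 \<phi>F) :: ('f, 'w, 'u) walg set) = variety scaleW gradeW \<B> (UT2 \<phi>D)"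
  have scalar: "scalar_matrices \<subseteq> (diagonal_matrices :: ('f^2^2) set)"
    by (auto simp: scalar_matrices_def diagonal_matrices_iff mat_1_nth)
  interpret UF: graded_W_algebra scaleW gradeW "UT2 \<phi>F" by (rule graded_W_algebra_UT2[OF W F scalar])
  interpret UD: graded_W_algebra scaleW gradeW "UT2 \<phi>D" by (rule graded_W_algebra_UT2[OF W D order_refl])
  obtain h :: "'f^2^2 \<Rightarrow> 'u" where h: "inj h" using matrix_embedding[OF emb] by blast
  have "transport h (UT2 \<phi>D) \<in> variety scaleW gradeW \<B> (UT2 \<phi>D)"
    using UD.graded_W_algebra_transport[OF h] UD.W_Id_transport[OF h] by (simp add: variety_def)
  then have sub: "W_Id \<B> (UT2 \<phi>F) \<subseteq> W_Id \<B> (UT2 \<phi>D)"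
    unfolding eq[symmetric] using UD.W_Id_transport[OF h] by (simp add: variety_def)
  have "munit 1 1 \<in> range \<phi>D"
    using D by (simp add: graded_unital_hom_onto_def diagonal_matrices_iff)
  then obtain w where w: "\<phi>D w = munit 1 1" by force
  have "\<phi>F w \<in> scalar_matrices" using F by (auto simp: graded_unital_hom_onto_def)
  then obtain a where a: "\<phi>F w = mscale a (mat 1)" by (auto simp: scalar_matrices_def)
  have one: "\<phi>F 1 = mat 1" "\<phi>D 1 = mat 1" using F D by (auto simp: graded_unital_hom_onto_def)
  (* the relation w y = a y, tested at y = 1 *)
  define s :: "gvar \<Rightarrow> 'f^2^2" where "s x = (case x of Y i \<Rightarrow> mat 1 | Z i \<Rightarrow> 0)" for x
  have "eval_monom (UT2 \<phi>D) s (w, [(Y 0, 1)])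
      = a \<odot>\<^bsub>UT2 \<phi>D\<^esub> eval_monom (UT2 \<phi>D) s (1, [(Y 0, 1)]) \<oplus>\<^bsub>UT2 \<phi>D\<^esub> 0 \<odot>\<^bsub>UT2 \<phi>D\<^esub> eval_monom (UT2 \<phi>D) s (1, [(Y 0, 1)])"
  proof (rule UD.linear_relation_transfer[OF UF.graded_W_algebra_axioms basis sub])
    show "admissible (UT2 \<phi>D) s" by (simp add: admissible_UT2 s_def mat_1_nth)
  qed (simp_all add: a one matrix_2_eq_iff mat_mult_2_nth mat_1_nth)
  then show False
    by (auto simp: w one s_def matrix_2_eq_iff mat_mult_2_nth mat_1_nth)
qed

theorem corollary7p4:
  fixes scaleW :: "'f::field_char_0 \<Rightarrow> 'w::ring_1 \<Rightarrow> 'w"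
    and gradeW :: "bit \<Rightarrow> 'w set"
    and \<B> :: "'w set"
    and \<phi>F \<phi>D :: "'w \<Rightarrow> 'f^2^2"
    and emb :: "('f, 'w) wpoly \<Rightarrow> 'u"
  assumes W: "graded_unital_algebra scaleW gradeW"
    and basis: "\<not> Modules.module.dependent scaleW \<B>" "Modules.module.span scaleW \<B> = UNIV"
    and actF: "graded_unital_hom_onto scaleW gradeW scalar_matrices \<phi>F"
    and actD: "graded_unital_hom_onto scaleW gradeW diagonal_matrices \<phi>D"
    and universe: "inj emb"
  shows "almost_polynomial_growth scaleW gradeW \<B>
           (variety scaleW gradeW \<B> (UT2 \<phi>F) :: ('f, 'w, 'u) walg set)
       \<and> almost_polynomial_growth scaleW gradeW \<B>
           (variety scaleW gradeW \<B> (UT2 \<phi>D) :: ('f, 'w, 'u) walg set)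
       \<and> (variety scaleW gradeW \<B> (UT2 \<phi>F) :: ('f, 'w, 'u) walg set)
           \<noteq> variety scaleW gradeW \<B> (UT2 \<phi>D)"
proof (intro conjI)
  have scalar: "scalar_matrices \<subseteq> (diagonal_matrices :: ('f^2^2) set)"
    by (auto simp: scalar_matrices_def diagonal_matrices_iff mat_1_nth)
  have zero: "\<phi>F 0 = 0"
    using actF unfolding graded_unital_hom_onto_def by (metis add_cancel_right_right)
  (* scalar matrices: the unit takes the place of e11, zero that of e22 *)
  have scalar_form: "\<phi>F w = mscale (\<phi>F w $ 1 $ 1) (\<phi>F 1) + mscale (\<phi>F w $ 2 $ 2) (\<phi>F 0)" for w
  proof -
    have "\<phi>F w \<in> scalar_matrices" "\<phi>F 1 = mat 1" using actF by (auto simp: graded_unital_hom_onto_def)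
    then show ?thesis by (auto simp: zero scalar_matrices_def matrix_2_eq_iff mat_1_nth)
  qed
  show "almost_polynomial_growth scaleW gradeW \<B> (variety scaleW gradeW \<B> (UT2 \<phi>F) :: ('f, 'w, 'u) walg set)"
    by (rule almost_polynomial_growth_UT2[OF W basis(2) actF scalar scalar_form universe])
  have "munit 1 1 \<in> range \<phi>D" "munit 2 2 \<in> range \<phi>D"
    using actD by (simp_all add: graded_unital_hom_onto_def diagonal_matrices_iff)
  then obtain e1 e2 where e: "\<phi>D e1 = munit 1 1" "\<phi>D e2 = munit 2 2" by (metis imageE)
  have diagonal_form: "\<phi>D w = mscale (\<phi>D w $ 1 $ 1) (\<phi>D e1) + mscale (\<phi>D w $ 2 $ 2) (\<phi>D e2)" for w
  proof -
    have "\<phi>D w \<in> diagonal_matrices" using actD by (auto simp: graded_unital_hom_onto_def)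
    then show ?thesis by (auto simp: e diagonal_matrices_iff matrix_2_eq_iff)
  qed
  show "almost_polynomial_growth scaleW gradeW \<B> (variety scaleW gradeW \<B> (UT2 \<phi>D) :: ('f, 'w, 'u) walg set)"
    by (rule almost_polynomial_growth_UT2[OF W basis(2) actD order_refl diagonal_form universe])
  show "(variety scaleW gradeW \<B> (UT2 \<phi>F) :: ('f, 'w, 'u) walg set) \<noteq> variety scaleW gradeW \<B> (UT2 \<phi>D)"
    by (rule varieties_distinct[OF W basis(2) actF actD universe])
qed

end
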